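(* There is a randomized (Monte-Carlo) algorithm that constructs a solution of the Dominating Matching Problem or of the Dominating f-factor Problem with the following properties. Its running time is bounded by a polynomial in $n$, the number of vertices of the input graph, whenever $\prod_{j=1}^{k}(m_j+1)=O(p(n))$ for some polynomial $p$ (which holds in particular if the number $k$ of prescribed edge sets stays bounded as $n$ grows). If the algorithm returns a construction, then it is a correct solution; and if a correct solution exists, the algorithm finds one with high probability.
   Context: Dominating Matching Problem: given a finite simple graph $G$, pairwise disjoint edge subsets $E'_1,\dots,E'_k\subseteq E(G)$ and nonnegative integers $m_1,\dots,m_k$, find a perfect matching $M$ of $G$ with $|M\cap E'_j|\ge m_j$ for every $j=1,\dots,k$. Dominating f-factor Problem: given a finite simple graph $G$ on vertices $v_1,\dots,v_n$, pairwise disjoint edge subsets $E_1,\dots,E_k\subseteq E(G)$, nonnegative integers $m_1,\dots,m_k$, and nonnegative integers $d_1,\dots,d_n$, find a spanning subgraph $G'$ of $G$ in which $v_i$ has degree $d_i$ for every $i$ and which contains at least $m_j$ edges of $E_j$ for every $j=1,\dots,k$. "With high probability" means with probability tending to $1$ as $n\to\infty$.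
   Formalization: The remark that the product bound holds for bounded k is proved only when m_j ≤ |E_j| for all j (it fails e.g. for k=1, m_1=2^n; other instances have no solution); polynomial running time for bounded k is proved for arbitrary m_j. *)

theory Defs
  imports "HOL-Probability.Probability" "HOL-Computational_Algebra.Polynomial"
begin

text \<open>The vertices are \<open>0, \<dots>, n - 1\<close>, an edge is a two-element set of vertices, and the list
  \<open>constraints\<close> consists of the pairs \<open>(E\<^sub>j, m\<^sub>j)\<close>, so that its length is \<open>k\<close>.\<close>

record dom_graph =
  nverts :: nat
  edges :: "nat set set"
  constraints :: "(nat set set \<times> nat) list"

definition prescribed :: "dom_graph \<Rightarrow> nat \<Rightarrow> nat set set" where
  "prescribed G j = fst (constraints G ! j)"

definition demand :: "dom_graph \<Rightarrow> nat \<Rightarrow> nat" where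
  "demand G j = snd (constraints G ! j)"

definition nsets :: "dom_graph \<Rightarrow> nat" where
  "nsets G = length (constraints G)"

definition wf_dom_graph :: "dom_graph \<Rightarrow> bool" where
  "wf_dom_graph G \<longleftrightarrow>
     edges G \<subseteq> {{u, v} | u v. u < nverts G \<and> v < nverts G \<and> u \<noteq> v} \<and>
     (\<forall>j<nsets G. prescribed G j \<subseteq> edges G) \<and>
     (\<forall>i<nsets G. \<forall>j<nsets G. i \<noteq> j \<longrightarrow> prescribed G i \<inter> prescribed G j = {})"

definition perfect_matching :: "dom_graph \<Rightarrow> nat set set \<Rightarrow> bool" where
  "perfect_matching G M \<longleftrightarrow>
     M \<subseteq> edges G \<and> (\<forall>e\<in>M. \<forall>e'\<in>M. e \<noteq> e' \<longrightarrow> e \<inter> e' = {}) \<and> \<Union>M = {..<nverts G}"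

definition vdegree :: "nat set set \<Rightarrow> nat \<Rightarrow> nat" where
  "vdegree F v = card {e \<in> F. v \<in> e}"

text \<open>A spanning subgraph is given by its edge set; \<open>d\<close> is the list of prescribed degrees.\<close>

definition f_factor :: "dom_graph \<Rightarrow> nat list \<Rightarrow> nat set set \<Rightarrow> bool" where
  "f_factor G d F \<longleftrightarrow> F \<subseteq> edges G \<and> (\<forall>v<nverts G. vdegree F v = d ! v)"

definition dominating :: "dom_graph \<Rightarrow> nat set set \<Rightarrow> bool" where
  "dominating G F \<longleftrightarrow> (\<forall>j<nsets G. demand G j \<le> card (F \<inter> prescribed G j))"

datatype problem =
    Dominating_Matching (graph: dom_graph)
  | Dominating_F_Factor (graph: dom_graph) "nat list"

fun wf_problem :: "problem \<Rightarrow> bool" where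
  "wf_problem (Dominating_Matching G) \<longleftrightarrow> wf_dom_graph G"
| "wf_problem (Dominating_F_Factor G d) \<longleftrightarrow> wf_dom_graph G \<and> length d = nverts G"

fun solves :: "nat set set \<Rightarrow> problem \<Rightarrow> bool" where
  "solves M (Dominating_Matching G) \<longleftrightarrow> perfect_matching G M \<and> dominating G M"
| "solves F (Dominating_F_Factor G d) \<longleftrightarrow> f_factor G d F \<and> dominating G F"

definition demand_product :: "dom_graph \<Rightarrow> nat" where
  "demand_product G = (\<Prod>j<nsets G. demand G j + 1)"

text \<open>Structured programs for a random access machine over the natural numbers with indirect
  addressing, addition and (truncated) subtraction under the uniform cost criterion. There is no
  multiplication: with it, the uniform cost criterion would no longer be polynomially related to
  Turing machine time. The memory consists of arrays, of which a program can only name finitely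
  many; a scalar variable is cell 0 of an array. Fair coin flips are read off an infinite random
  tape. Every elementary command and every test costs one unit; the expressions in a program have
  a fixed size, so this is machine time up to a constant factor that depends on the program only.\<close>

type_synonym mem = "nat \<Rightarrow> nat \<Rightarrow> nat"

datatype aexp =
    Const nat
  | Fetch nat aexp
  | Plus aexp aexp
  | Minus aexp aexp

datatype bexp =
    Less aexp aexp
  | Equal aexp aexp
  | Neg bexp
  | Conj bexp bexp

datatype com =
    Skip
  | Store nat aexp aexp
  | Flip nat aexp
  | Seq com com
  | Cond bexp com com
  | While bexp com

fun aval :: "aexp \<Rightarrow> mem \<Rightarrow> nat" where
  "aval (Const c) s = c"
| "aval (Fetch x a) s = s x (aval a s)"
| "aval (Plus a b) s = aval a s + aval b s"
| "aval (Minus a b) s = aval a s - aval b s"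

fun bval :: "bexp \<Rightarrow> mem \<Rightarrow> bool" where
  "bval (Less a b) s \<longleftrightarrow> aval a s < aval b s"
| "bval (Equal a b) s \<longleftrightarrow> aval a s = aval b s"
| "bval (Neg b) s \<longleftrightarrow> \<not> bval b s"
| "bval (Conj b c) s \<longleftrightarrow> bval b s \<and> bval c s"

definition upd :: "mem \<Rightarrow> nat \<Rightarrow> nat \<Rightarrow> nat \<Rightarrow> mem" where
  "upd s x i c = s(x := (s x)(i := c))"

text \<open>\<open>exec c s \<omega> t s' \<omega>'\<close>: started in memory \<open>s\<close> with random tape \<open>\<omega>\<close>, the program \<open>c\<close> halts after
  \<open>t\<close> steps in memory \<open>s'\<close>, leaving the unread tape \<open>\<omega>'\<close>.\<close>

inductive exec :: "com \<Rightarrow> mem \<Rightarrow> bool stream \<Rightarrow> nat \<Rightarrow> mem \<Rightarrow> bool stream \<Rightarrow> bool" where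
  Skip: "exec Skip s \<omega> 1 s \<omega>"
| Store: "exec (Store x a b) s \<omega> 1 (upd s x (aval a s) (aval b s)) \<omega>"
| Flip: "exec (Flip x a) s \<omega> 1 (upd s x (aval a s) (of_bool (shd \<omega>))) (stl \<omega>)"
| Seq: "exec c\<^sub>1 s\<^sub>1 \<omega>\<^sub>1 t\<^sub>1 s\<^sub>2 \<omega>\<^sub>2 \<Longrightarrow> exec c\<^sub>2 s\<^sub>2 \<omega>\<^sub>2 t\<^sub>2 s\<^sub>3 \<omega>\<^sub>3 \<Longrightarrow>
    exec (Seq c\<^sub>1 c\<^sub>2) s\<^sub>1 \<omega>\<^sub>1 (t\<^sub>1 + t\<^sub>2) s\<^sub>3 \<omega>\<^sub>3"
| Cond_True: "bval b s \<Longrightarrow> exec c\<^sub>1 s \<omega> t s' \<omega>' \<Longrightarrow> exec (Cond b c\<^sub>1 c\<^sub>2) s \<omega> (t + 1) s' \<omega>'"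
| Cond_False: "\<not> bval b s \<Longrightarrow> exec c\<^sub>2 s \<omega> t s' \<omega>' \<Longrightarrow> exec (Cond b c\<^sub>1 c\<^sub>2) s \<omega> (t + 1) s' \<omega>'"
| While_False: "\<not> bval b s \<Longrightarrow> exec (While b c) s \<omega> 1 s \<omega>"
| While_True: "bval b s\<^sub>1 \<Longrightarrow> exec c s\<^sub>1 \<omega>\<^sub>1 t\<^sub>1 s\<^sub>2 \<omega>\<^sub>2 \<Longrightarrow> exec (While b c) s\<^sub>2 \<omega>\<^sub>2 t\<^sub>2 s\<^sub>3 \<omega>\<^sub>3 \<Longrightarrow>
    exec (While b c) s\<^sub>1 \<omega>\<^sub>1 (t\<^sub>1 + t\<^sub>2 + 1) s\<^sub>3 \<omega>\<^sub>3"

inductive_cases exec_SkipE: "exec Skip s \<omega> t s' \<omega>'"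
inductive_cases exec_StoreE: "exec (Store x a b) s \<omega> t s' \<omega>'"
inductive_cases exec_FlipE: "exec (Flip x a) s \<omega> t s' \<omega>'"
inductive_cases exec_SeqE: "exec (Seq c\<^sub>1 c\<^sub>2) s \<omega> t s' \<omega>'"
inductive_cases exec_CondE: "exec (Cond b c\<^sub>1 c\<^sub>2) s \<omega> t s' \<omega>'"
inductive_cases exec_WhileE: "exec (While b c) s \<omega> t s' \<omega>'"

lemma exec_deterministic:
  "exec c s \<omega> t s' \<omega>' \<Longrightarrow> exec c s \<omega> u s'' \<omega>'' \<Longrightarrow> t = u \<and> s' = s'' \<and> \<omega>' = \<omega>''"
proof (induction arbitrary: u s'' \<omega>'' rule: exec.induct)
  case (Seq c\<^sub>1 s\<^sub>1 \<omega>\<^sub>1 t\<^sub>1 s\<^sub>2 \<omega>\<^sub>2 c\<^sub>2 t\<^sub>2 s\<^sub>3 \<omega>\<^sub>3)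
  from Seq.prems obtain u\<^sub>1 r \<rho> u\<^sub>2
    where u: "u = u\<^sub>1 + u\<^sub>2" and 1: "exec c\<^sub>1 s\<^sub>1 \<omega>\<^sub>1 u\<^sub>1 r \<rho>" and 2: "exec c\<^sub>2 r \<rho> u\<^sub>2 s'' \<omega>''"
    by (rule exec_SeqE)
  from Seq.IH(1)[OF 1] have eq: "t\<^sub>1 = u\<^sub>1" "s\<^sub>2 = r" "\<omega>\<^sub>2 = \<rho>" by simp_all
  from 2 have "exec c\<^sub>2 s\<^sub>2 \<omega>\<^sub>2 u\<^sub>2 s'' \<omega>''" unfolding eq .
  from Seq.IH(2)[OF this] show ?case unfolding u eq(1) by simp
next
  case (Cond_True b s c\<^sub>1 \<omega> t s' \<omega>' c\<^sub>2)
  from Cond_True.prems show ?case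
    by (rule exec_CondE) (use Cond_True.hyps(1) in \<open>simp_all add: Cond_True.IH\<close>)
next
  case (Cond_False b s c\<^sub>2 \<omega> t s' \<omega>' c\<^sub>1)
  from Cond_False.prems show ?case
    by (rule exec_CondE) (use Cond_False.hyps(1) in \<open>simp_all add: Cond_False.IH\<close>)
next
  case (While_True b s\<^sub>1 c \<omega>\<^sub>1 t\<^sub>1 s\<^sub>2 \<omega>\<^sub>2 t\<^sub>2 s\<^sub>3 \<omega>\<^sub>3)
  from While_True.prems obtain u\<^sub>1 r \<rho> u\<^sub>2
    where u: "u = u\<^sub>1 + u\<^sub>2 + 1" and 1: "exec c s\<^sub>1 \<omega>\<^sub>1 u\<^sub>1 r \<rho>"
      and 2: "exec (While b c) r \<rho> u\<^sub>2 s'' \<omega>''"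
    by (rule exec_WhileE) (use While_True.hyps(1) in simp_all)
  from While_True.IH(1)[OF 1] have eq: "t\<^sub>1 = u\<^sub>1" "s\<^sub>2 = r" "\<omega>\<^sub>2 = \<rho>" by simp_all
  from 2 have "exec (While b c) s\<^sub>2 \<omega>\<^sub>2 u\<^sub>2 s'' \<omega>''" unfolding eq .
  from While_True.IH(2)[OF this] show ?case unfolding u eq(1) by simp
next
  case (While_False b s c \<omega>)
  from While_False.prems show ?case
    by (rule exec_WhileE) (use While_False.hyps in simp_all)
qed (auto elim: exec_SkipE exec_StoreE exec_FlipE)

definition coin_tape :: "bool stream measure" where
  "coin_tape = stream_space (measure_pmf (bernoulli_pmf (1 / 2)))"

text \<open>The graph and the prescribed sets are given by an adjacency matrix (row by row) with entries
  0 for a non-edge, 1 for an edge in none of the sets, and \<open>j + 2\<close> for an edge in \<open>E\<^sub>j\<close>. The vector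
  of demands is given in sparse form, as the number of indices \<open>j\<close> with \<open>m\<^sub>j \<noteq> 0\<close> followed by the
  pairs \<open>j\<close>, \<open>m\<^sub>j\<close> for these \<open>j\<close>; in a dense listing, arbitrarily many vacuous demands \<open>m\<^sub>j = 0\<close>
  would make the input length unbounded in terms of \<open>n\<close> and the product of the \<open>m\<^sub>j + 1\<close>.\<close>

definition edge_label :: "dom_graph \<Rightarrow> nat \<Rightarrow> nat \<Rightarrow> nat" where
  "edge_label G u v =
     (if {u, v} \<notin> edges G then 0
      else if \<exists>j<nsets G. {u, v} \<in> prescribed G j
        then (THE j. j < nsets G \<and> {u, v} \<in> prescribed G j) + 2
      else 1)"

definition encode_matrix :: "dom_graph \<Rightarrow> nat list" where
  "encode_matrix G =
     concat (map (\<lambda>u. map (\<lambda>v. edge_label G u v) [0..<nverts G]) [0..<nverts G])"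

definition encode_demands :: "dom_graph \<Rightarrow> nat list" where
  "encode_demands G =
     (let js = filter (\<lambda>j. demand G j \<noteq> 0) [0..<nsets G]
      in length js # concat (map (\<lambda>j. [j, demand G j]) js))"

fun encode :: "problem \<Rightarrow> nat list" where
  "encode (Dominating_Matching G) = [0, nverts G] @ encode_matrix G @ encode_demands G"
| "encode (Dominating_F_Factor G d) = [1, nverts G] @ encode_matrix G @ d @ encode_demands G"

text \<open>The input is put into array 0. The output is read off array 1: a zero in cell 0 means that
  no construction is returned; otherwise cell 1 contains the length of the list of edges that
  follows, two cells per edge.\<close>

definition init_mem :: "nat list \<Rightarrow> mem" where
  "init_mem xs = (\<lambda>x i. if x = 0 \<and> i < length xs then xs ! i else 0)"

definition out_edges :: "mem \<Rightarrow> nat set set option" where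
  "out_edges s =
     (if s 1 0 = 0 then None
      else Some {{s 1 (2 * i + 2), s 1 (2 * i + 3)} | i. i < s 1 1})"

definition returns :: "com \<Rightarrow> problem \<Rightarrow> bool stream \<Rightarrow> nat set set \<Rightarrow> bool" where
  "returns A P \<omega> F \<longleftrightarrow>
     (\<exists>t s \<omega>'. exec A (init_mem (encode P)) \<omega> t s \<omega>' \<and> out_edges s = Some F)"

text \<open>The running time is the worst case over all outcomes of the coin flips.\<close>

definition halts_within :: "com \<Rightarrow> problem \<Rightarrow> real \<Rightarrow> bool" where
  "halts_within A P b \<longleftrightarrow>
     (\<forall>\<omega>. \<exists>t s \<omega>'. exec A (init_mem (encode P)) \<omega> t s \<omega>' \<and> real t \<le> b)"

end

theory Submission
  imports
    Defs
    "HOL-Computational_Algebra.Formal_Power_Series"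
    "HOL-Library.Log_Nat"
    "HOL-Library.Z2"
begin

text \<open>A perfect matching is an f-factor with all degrees 1. Replace every vertex \<open>u\<close> by \<open>n\<close> ports \<open>(u, v)\<close>
  and \<open>n - d u\<close> cores that are adjacent to all ports of \<open>u\<close>, and join \<open>(u, v)\<close> to \<open>(v, u)\<close> for every edge
  \<open>{u, v}\<close>: the perfect matchings of this gadget graph project onto the f-factors. The edges between ports are
  doubled, and only the second copy counts towards a demand, so that ``at least \<open>m\<^sub>j\<close>'' becomes ``exactly
  \<open>m\<^sub>j\<close> counted edges''; the required numbers of edges are encoded in a single integer charge that is
  polynomial in \<open>n\<close> and the product of the \<open>m\<^sub>j + 1\<close>.

  By the isolation lemma of Mulmuley, Vazirani and Vazirani, random weights make the lightest solution
  unique with high probability. It can then be read off from the parities of the numbers of matchings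
  of a given weight that avoid a given edge. As a candidate is returned only after it has been verified,
  randomness affects completeness but not soundness.

  The parities need no determinants. In characteristic 2 the matching polynomial satisfies
  \<open>\<mu>(S \<union> {h}) = \<mu>(S) \<cdot> (1 + W)\<close>, where \<open>W\<close> is the generating function of the walks of positive length that start
  in \<open>h\<close> and stay in \<open>S\<close> afterwards, and walks are counted by dynamic programming.\<close>

section \<open>Matchings and walks in characteristic 2\<close>

lemma bit_fps_add_self: "(f :: bit fps) + f = 0"
  by (rule fps_ext) simp

lemma bit_fps_add_cancel: "(f :: bit fps) + g + f = g"
  by (simp add: add.commute[of f g] add.assoc bit_fps_add_self)

lemma of_nat_bit_eq_odd: "(of_nat n :: bit) = of_bool (odd n)"
  by (induction n) auto

lemma sum_symmetric_off_diagonal_bit_fps: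
  fixes f :: "'a \<Rightarrow> 'a \<Rightarrow> bit fps"
  assumes "finite U" and symmetric: "\<And>u x. f u x = f x u"
  shows "(\<Sum>u\<in>U. \<Sum>x\<in>U - {u}. f u x) = 0"
  using assms(1)
proof (induction U rule: finite_induct)
  case empty
  show ?case by simp
next
  case (insert v U)
  have "(\<Sum>u\<in>insert v U. \<Sum>x\<in>insert v U - {u}. f u x) =
      (\<Sum>x\<in>U. f v x) + (\<Sum>u\<in>U. \<Sum>x\<in>insert v U - {u}. f u x)"
    using insert.hyps by simp
  also have "(\<Sum>u\<in>U. \<Sum>x\<in>insert v U - {u}. f u x) = (\<Sum>u\<in>U. f v u + (\<Sum>x\<in>U - {u}. f u x))"
  proof (rule sum.cong[OF refl])
    fix u assume "u \<in> U"
    then have "insert v U - {u} = insert v (U - {u})" using insert.hyps by auto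
    then show "(\<Sum>x\<in>insert v U - {u}. f u x) = f v u + (\<Sum>x\<in>U - {u}. f u x)"
      using insert.hyps by (simp add: symmetric[of u v])
  qed
  also have "\<dots> = (\<Sum>u\<in>U. f v u)" using insert.IH by (simp add: sum.distrib)
  finally show ?case by (simp add: bit_fps_add_self)
qed

locale weighted_multigraph =
  fixes K :: "'e set" and s t :: "'e \<Rightarrow> nat" and w :: "'e \<Rightarrow> nat"
  assumes finite_K: "finite K"
    and no_loop: "k \<in> K \<Longrightarrow> s k \<noteq> t k"
    and weight_pos: "k \<in> K \<Longrightarrow> 0 < w k"
begin

definition ends :: "'e \<Rightarrow> nat set" where
  "ends k = {s k, t k}"

definition matchings :: "nat set \<Rightarrow> 'e set set" where
  "matchings S = {M. M \<subseteq> K \<and> \<Union> (ends ` M) \<subseteq> S \<and> disjoint_family_on ends M}"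

definition matching_fps :: "nat set \<Rightarrow> bit fps" where
  "matching_fps S = (\<Sum>M\<in>matchings S. fps_X ^ sum w M)"

definition adjacency :: "nat \<Rightarrow> nat \<Rightarrow> bit fps" where
  "adjacency u v = (\<Sum>k\<in>{k\<in>K. ends k = {u, v}}. fps_X ^ w k)"

definition incident_edges :: "nat \<Rightarrow> nat set \<Rightarrow> 'e set" where
  "incident_edges v S = {k \<in> K. v \<in> ends k \<and> ends k \<subseteq> S}"

lemma finite_matchings: "finite (matchings S)"
  by (rule finite_subset[of _ "Pow K"]) (auto simp: matchings_def finite_K)

lemma finite_matching: "M \<in> matchings S \<Longrightarrow> finite M"
  using finite_K finite_subset by (auto simp: matchings_def)

lemma ends_eq_doubleton_iff:
  assumes "k \<in> K"
  shows "ends k = {c, a} \<longleftrightarrow> t k = c \<and> a = s k \<or> s k = c \<and> a = t k"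
  using no_loop[OF assms] by (auto simp: ends_def doubleton_eq_iff)

lemma adjacency_commute: "adjacency u v = adjacency v u"
  by (simp add: adjacency_def insert_commute)

lemma adjacency_self: "adjacency v v = 0"
proof -
  have "ends k \<noteq> {v, v}" if "k \<in> K" for k
    using no_loop[OF that] by (auto simp: ends_def doubleton_eq_iff)
  then have "{k\<in>K. ends k = {v, v}} = {}" by blast
  then show ?thesis unfolding adjacency_def by (simp only: sum.empty)
qed

lemma matching_fps_empty: "matching_fps {} = 1"
proof -
  have "matchings {} = {{}}" by (auto simp: matchings_def ends_def disjoint_family_on_def)
  then show ?thesis by (simp add: matching_fps_def)
qed

lemma insert_matching:
  assumes k: "k \<in> incident_edges v S" and M: "M \<in> matchings (S - ends k)"
  shows "insert k M \<in> matchings S" and "k \<notin> M"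
proof -
  show "k \<notin> M" using M by (auto simp: matchings_def ends_def)
  then show "insert k M \<in> matchings S"
    using assms by (auto simp: matchings_def incident_edges_def disjoint_family_on_insert)
qed

lemma remove_matching:
  assumes M: "M \<in> matchings S" and k: "k \<in> M"
  shows "M - {k} \<in> matchings (S - ends k)"
proof -
  have "ends l \<inter> ends k = {}" if "l \<in> M - {k}" for l
    using M k that by (auto simp: matchings_def dest: disjoint_family_onD)
  then show ?thesis
    using M disjoint_family_on_mono[of "M - {k}" M ends] by (auto simp: matchings_def)
qed

lemma bij_betw_insert_incident_edge:
  "bij_betw (\<lambda>(k, M). insert k M) (SIGMA k:incident_edges v S. matchings (S - ends k))
     {M \<in> matchings S. v \<in> \<Union> (ends ` M)}"
proof (rule bij_betw_imageI)
  let ?I = "SIGMA k:incident_edges v S. matchings (S - ends k)"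
  show "inj_on (\<lambda>(k, M). insert k M) ?I"
  proof (rule inj_onI, clarify)
    fix k M k' M'
    assume k: "k \<in> incident_edges v S" "k' \<in> incident_edges v S"
      and M: "M \<in> matchings (S - ends k)" "M' \<in> matchings (S - ends k')"
      and eq: "insert k M = insert k' M'"
    have "v \<in> ends k" "v \<in> ends k'" "k \<in> insert k' M'" using k eq by (auto simp: incident_edges_def)
    then have "k = k'" using M by (auto simp: matchings_def)
    moreover from this have "M = M'"
      using eq insert_matching(2)[OF k(1) M(1)] insert_matching(2)[OF k(2) M(2)] by (simp add: insert_ident)
    ultimately show "k = k' \<and> M = M'" by simp
  qed
  show "(\<lambda>(k, M). insert k M) ` ?I = {M \<in> matchings S. v \<in> \<Union> (ends ` M)}"
  proof (intro equalityI subsetI)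
    fix M assume "M \<in> (\<lambda>(k, M). insert k M) ` ?I"
    then show "M \<in> {M \<in> matchings S. v \<in> \<Union> (ends ` M)}"
      using insert_matching(1) by (auto simp: incident_edges_def)
  next
    fix M assume "M \<in> {M \<in> matchings S. v \<in> \<Union> (ends ` M)}"
    then obtain k where M: "M \<in> matchings S" and k: "k \<in> M" "v \<in> ends k" by blast
    then have "(k, M - {k}) \<in> ?I"
      using remove_matching[OF M k(1)] by (auto simp: incident_edges_def matchings_def)
    moreover have "M = (\<lambda>(k, M). insert k M) (k, M - {k})" using k by auto
    ultimately show "M \<in> (\<lambda>(k, M). insert k M) ` ?I" by blast
  qed
qed

lemma matching_fps_incident_edges:
  "matching_fps S = matching_fps (S - {v}) + (\<Sum>k\<in>incident_edges v S. fps_X ^ w k * matching_fps (S - ends k))"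
proof -
  let ?J = "{M \<in> matchings S. v \<in> \<Union> (ends ` M)}"
  have finite_incident: "finite (incident_edges v S)" by (simp add: incident_edges_def finite_K)
  have "(\<Sum>M\<in>?J. fps_X ^ sum w M) = (\<Sum>(k, M)\<in>(SIGMA k:incident_edges v S. matchings (S - ends k)).
      fps_X ^ sum w (insert k M) :: bit fps)"
    using sum.reindex_bij_betw[OF bij_betw_insert_incident_edge[of v S], of "\<lambda>M. fps_X ^ sum w M", symmetric]
    by (simp only: case_prod_unfold)
  also have "\<dots> = (\<Sum>k\<in>incident_edges v S. \<Sum>M\<in>matchings (S - ends k). fps_X ^ sum w (insert k M))"
    using finite_incident by (simp add: sum.Sigma finite_matchings)
  also have "\<dots> = (\<Sum>k\<in>incident_edges v S. fps_X ^ w k * matching_fps (S - ends k))"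
    unfolding matching_fps_def sum_distrib_left
    by (intro sum.cong refl) (simp add: insert_matching(2) finite_matching power_add)
  finally have through: "(\<Sum>M\<in>?J. fps_X ^ sum w M) = \<dots>" .
  have "matchings S = matchings (S - {v}) \<union> ?J" and "matchings (S - {v}) \<inter> ?J = {}"
    by (auto simp: matchings_def)
  then have "matching_fps S = matching_fps (S - {v}) + (\<Sum>M\<in>?J. fps_X ^ sum w M)"
    unfolding matching_fps_def using finite_matchings by (subst sum.union_disjoint[symmetric]) auto
  then show ?thesis unfolding through .
qed

lemma matching_fps_expand:
  assumes "finite S" "v \<in> S"
  shows "matching_fps S = matching_fps (S - {v}) + (\<Sum>u\<in>S - {v}. adjacency v u * matching_fps (S - {v, u}))"
proof -
  define joining where "joining u = {k\<in>K. ends k = {v, u}}" for u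
  have "k \<in> incident_edges v S \<longleftrightarrow> k \<in> (\<Union>u\<in>S - {v}. joining u)" for k
    using assms(2) no_loop[of k] by (auto simp: incident_edges_def joining_def ends_def doubleton_eq_iff)
  then have "incident_edges v S = (\<Union>u\<in>S - {v}. joining u)" by blast
  also have "(\<Sum>k\<in>\<dots>. fps_X ^ w k * matching_fps (S - ends k)) =
      (\<Sum>u\<in>S - {v}. \<Sum>k\<in>joining u. fps_X ^ w k * matching_fps (S - ends k))"
    by (rule sum.UNION_disjoint) (use assms(1) finite_K in \<open>auto simp: joining_def doubleton_eq_iff\<close>)
  also have "\<dots> = (\<Sum>u\<in>S - {v}. adjacency v u * matching_fps (S - {v, u}))"
    unfolding adjacency_def sum_distrib_right joining_def by (intro sum.cong refl) simp
  finally show ?thesis by (subst matching_fps_incident_edges[of S v]) simp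
qed

text \<open>If \<open>matching_fps (S - {u})\<close> is expanded at \<open>v\<close>, then the terms in which \<open>v\<close> has a second neighbour are
  symmetric in the two neighbours and cancel.\<close>

lemma matching_fps_deletion_system:
  assumes "finite S" "v \<in> S"
  shows "matching_fps S = matching_fps (S - {v}) + (\<Sum>u\<in>S. adjacency v u * matching_fps (S - {u}))"
proof -
  define U where "U = S - {v}"
  have "(\<Sum>u\<in>S. adjacency v u * matching_fps (S - {u})) = (\<Sum>u\<in>U. adjacency v u * matching_fps (S - {u}))"
    unfolding U_def using assms by (simp add: sum.remove adjacency_self)
  also have "\<dots> = (\<Sum>u\<in>U. adjacency v u * matching_fps (S - {v, u})
      + (\<Sum>x\<in>U - {u}. adjacency v u * (adjacency v x * matching_fps (S - {v, u, x}))))"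
  proof (rule sum.cong[OF refl])
    fix u assume "u \<in> U"
    then have "matching_fps (S - {u}) = matching_fps (S - {u} - {v}) +
        (\<Sum>x\<in>S - {u} - {v}. adjacency v x * matching_fps (S - {u} - {v, x}))"
      using assms by (intro matching_fps_expand) (auto simp: U_def)
    moreover have "S - {u} - {v} = S - {v, u}" "S - {u} - {v, x} = S - {v, u, x}" "S - {v, u} = U - {u}" for x
      by (auto simp: U_def)
    ultimately show "adjacency v u * matching_fps (S - {u}) = adjacency v u * matching_fps (S - {v, u})
        + (\<Sum>x\<in>U - {u}. adjacency v u * (adjacency v x * matching_fps (S - {v, u, x})))"
      by (simp add: distrib_left sum_distrib_left)
  qed
  also have "\<dots> = (\<Sum>u\<in>U. adjacency v u * matching_fps (S - {v, u}))
      + (\<Sum>u\<in>U. \<Sum>x\<in>U - {u}. adjacency v u * (adjacency v x * matching_fps (S - {v, u, x})))"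
    by (rule sum.distrib)
  also have "(\<Sum>u\<in>U. \<Sum>x\<in>U - {u}. adjacency v u * (adjacency v x * matching_fps (S - {v, u, x}))) = 0"
    by (rule sum_symmetric_off_diagonal_bit_fps)
      (use assms(1) in \<open>simp_all add: U_def insert_commute mult.left_commute\<close>)
  finally show ?thesis using matching_fps_expand[OF assms] by (simp add: U_def)
qed

lemma matching_fps_nth_0: "fps_nth (matching_fps S) 0 = 1"
proof -
  have "fps_nth (matching_fps S) 0 = (\<Sum>M\<in>matchings S. if M = {} then 1 else 0)"
    unfolding matching_fps_def fps_sum_nth
  proof (rule sum.cong[OF refl])
    fix M assume M: "M \<in> matchings S"
    have "0 < w k" if "k \<in> M" for k using that M weight_pos[of k] by (auto simp: matchings_def)
    then have "0 < sum w M" if "M \<noteq> {}" using that finite_matching[OF M] by (intro sum_pos)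
    then show "fps_nth (fps_X ^ sum w M) 0 = (if M = {} then 1 else 0 :: bit)"
      by (cases "M = {}") (simp_all add: fps_X_power_nth)
  qed
  also have "\<dots> = 1"
    using finite_matchings[of S] by (subst sum.delta) (auto simp: matchings_def disjoint_family_on_def)
  finally show ?thesis .
qed

text \<open>The coefficient matrix of the system for \<open>E\<close> is symmetric and occurs in \<open>matching_fps_deletion_system\<close> as
  well; multiplying either system by the solution of the other one yields the sum of \<open>E\<close>.\<close>

lemma matching_fps_insert_vertex:
  assumes "finite S" "h \<notin> S"
    and walk_system: "\<And>c. c \<in> S \<Longrightarrow> E c = (\<Sum>a\<in>S. adjacency c a * E a) + adjacency c h * matching_fps S"
  shows "matching_fps (insert h S) = matching_fps S + (\<Sum>c\<in>S. E c)"
proof -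
  let ?mu = matching_fps
  define cross where "cross = (\<Sum>c\<in>S. \<Sum>u\<in>S. E c * adjacency c u * ?mu (S - {u}))"
  have cross_swap: "cross = (\<Sum>u\<in>S. \<Sum>c\<in>S. E c * adjacency c u * ?mu (S - {u}))"
    unfolding cross_def by (rule sum.swap)
  have "(\<Sum>c\<in>S. E c) * ?mu S = (\<Sum>c\<in>S. E c * ?mu (S - {c})) + cross"
    unfolding sum_distrib_right cross_def sum.distrib[symmetric]
    by (rule sum.cong[OF refl], subst matching_fps_deletion_system[OF assms(1)])
       (simp_all add: distrib_left sum_distrib_left mult.assoc)
  also have "(\<Sum>c\<in>S. E c * ?mu (S - {c})) = cross + (\<Sum>u\<in>S. adjacency u h * ?mu S * ?mu (S - {u}))"
    unfolding cross_swap sum.distrib[symmetric]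
  proof (rule sum.cong[OF refl])
    fix u assume "u \<in> S"
    then have "E u * ?mu (S - {u}) =
        (\<Sum>c\<in>S. E c * adjacency u c * ?mu (S - {u})) + adjacency u h * ?mu S * ?mu (S - {u})"
      by (subst walk_system, assumption) (simp only: distrib_right sum_distrib_right mult.commute[of "E _"])
    then show "E u * ?mu (S - {u}) =
        (\<Sum>c\<in>S. E c * adjacency c u * ?mu (S - {u})) + adjacency u h * ?mu S * ?mu (S - {u})"
      by (simp only: adjacency_commute[of u])
  qed
  finally have "(\<Sum>c\<in>S. E c) * ?mu S = (\<Sum>u\<in>S. adjacency u h * ?mu S * ?mu (S - {u}))"
    by (simp only: bit_fps_add_cancel)
  also have "\<dots> = (\<Sum>u\<in>S. adjacency h u * ?mu (S - {u})) * ?mu S"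
    unfolding sum_distrib_right by (rule sum.cong[OF refl]) (simp add: adjacency_commute[of h] ac_simps)
  finally have "(\<Sum>c\<in>S. E c) = (\<Sum>u\<in>S. adjacency h u * ?mu (S - {u}))"
    using matching_fps_nth_0[of S] by auto
  moreover have "insert h S - {h} = S" "insert h S - {h, u} = S - {u}" for u using assms(2) by auto
  ultimately show ?thesis
    using matching_fps_expand[of "insert h S" h] assms(1) by simp
qed

text \<open>\<open>walk_count D h x c\<close> counts the walks of weight \<open>x\<close> from \<open>h\<close> to \<open>c\<close> that stay below \<open>h\<close> after their
  start, where a start with an initial weight \<open>y\<close> is counted \<open>D y\<close> times.\<close>

function walk_count :: "(nat \<Rightarrow> nat) \<Rightarrow> nat \<Rightarrow> nat \<Rightarrow> nat \<Rightarrow> nat" where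
  "walk_count D h x c = (if c = h then D x else 0) +
     (\<Sum>k\<in>K. if c < h \<and> w k \<le> x then
        (if t k = c then walk_count D h (x - w k) (s k) else 0) +
        (if s k = c then walk_count D h (x - w k) (t k) else 0) else 0)"
  by auto
termination
proof (relation "Wellfounded.measure (\<lambda>(D, h, x, c). x)", goal_cases wf to_source to_sink)
  case (to_source D h x c k)
  then show ?case using weight_pos[of k] by simp
next
  case (to_sink D h x c k)
  then show ?case using weight_pos[of k] by simp
qed simp

declare walk_count.simps [simp del]

fun matching_count :: "nat \<Rightarrow> nat \<Rightarrow> nat" where
  "matching_count 0 x = (if x = 0 then 1 else 0)"
| "matching_count (Suc h) x = matching_count h x + (\<Sum>c<h. walk_count (matching_count h) h x c)"

lemma walk_count_start: "walk_count D h x h = D x"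
  by (subst walk_count.simps) simp

lemma walk_count_above: "h < c \<Longrightarrow> walk_count D h x c = 0"
  by (subst walk_count.simps) simp

lemma sum_other_end:
  fixes f :: "nat \<Rightarrow> 'b::comm_monoid_add"
  assumes k: "k \<in> K" and "finite A" and outside: "\<And>a. a \<notin> A \<Longrightarrow> f a = 0"
  shows "(\<Sum>a\<in>A. if ends k = {c, a} then f a else 0) =
    (if t k = c then f (s k) else 0) + (if s k = c then f (t k) else 0)"
proof -
  have single: "(\<Sum>a\<in>A. if P then if a = b then f b else 0 else 0) = (if P then f b else 0)" for P b
    using assms(2) outside[of b] by (cases "b \<in> A") simp_all
  have "(if ends k = {c, a} then f a else 0) = (if t k = c then if a = s k then f (s k) else 0 else 0) +
      (if s k = c then if a = t k then f (t k) else 0 else 0)" for a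
    using no_loop[OF k] by (auto simp: ends_eq_doubleton_iff[OF k])
  then show ?thesis by (simp only: sum.distrib single)
qed

lemma fps_nth_adjacency_mult:
  "fps_nth (adjacency c a * F) x = (\<Sum>k\<in>K.
      if ends k = {c, a} then if w k \<le> x then fps_nth F (x - w k) else 0 else 0)"
proof -
  have "fps_nth (adjacency c a * F) x =
      (\<Sum>k\<in>{k\<in>K. ends k = {c, a}}. if w k \<le> x then fps_nth F (x - w k) else 0)"
    unfolding adjacency_def sum_distrib_right fps_sum_nth
    by (rule sum.cong[OF refl]) (auto simp: fps_X_power_mult_nth)
  then show ?thesis using finite_K by (simp add: sum.inter_filter)
qed

lemma walk_count_linear_system:
  assumes start: "\<And>x. of_nat (D x) = fps_nth m x" and c: "c < h"
    and E: "\<And>a. E a = Abs_fps (\<lambda>x. of_nat (walk_count D h x a) :: bit)"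
  shows "E c = (\<Sum>a<h. adjacency c a * E a) + adjacency c h * m"
proof (rule fps_ext)
  fix x
  have E_h: "E h = m" by (rule fps_ext) (simp add: E walk_count_start start)
  define g where "g k a = (if w k \<le> x then walk_count D h (x - w k) a else 0)" for k a
  have "fps_nth ((\<Sum>a<h. adjacency c a * E a) + adjacency c h * m) x =
      (\<Sum>a<Suc h. fps_nth (adjacency c a * E a) x)"
    by (simp add: fps_sum_nth E_h)
  also have "\<dots> = (\<Sum>a<Suc h. \<Sum>k\<in>K. if ends k = {c, a} then of_nat (g k a) else 0)"
    by (simp add: fps_nth_adjacency_mult g_def E if_distrib[of of_nat] cong: if_cong)
  also have "\<dots> = (\<Sum>k\<in>K. \<Sum>a<Suc h. if ends k = {c, a} then of_nat (g k a) else 0)"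
    by (rule sum.swap)
  also have "\<dots> = (\<Sum>k\<in>K.
      (if t k = c then of_nat (g k (s k)) else 0) + (if s k = c then of_nat (g k (t k)) else 0))"
    by (intro sum.cong refl sum_other_end) (auto simp: g_def walk_count_above)
  also have "\<dots> = of_nat (\<Sum>k\<in>K. (if t k = c then g k (s k) else 0) + (if s k = c then g k (t k) else 0))"
    by (simp add: if_distrib[of of_nat] cong: if_cong)
  also have "(\<Sum>k\<in>K. (if t k = c then g k (s k) else 0) + (if s k = c then g k (t k) else 0)) =
      walk_count D h x c"
    unfolding walk_count.simps[of D h x c] g_def using c
    by (simp cong: if_cong sum.cong) (rule sum.cong, auto)
  finally show "fps_nth (E c) x = fps_nth ((\<Sum>a<h. adjacency c a * E a) + adjacency c h * m) x"
    by (simp add: E)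
qed

lemma of_nat_matching_count: "of_nat (matching_count h x) = fps_nth (matching_fps {..<h}) x"
proof (induction h arbitrary: x)
  case 0
  show ?case by (simp add: matching_fps_empty)
next
  case (Suc h)
  define E where "E c = Abs_fps (\<lambda>x. of_nat (walk_count (matching_count h) h x c) :: bit)" for c
  have "E c = (\<Sum>a<h. adjacency c a * E a) + adjacency c h * matching_fps {..<h}" if "c \<in> {..<h}" for c
    by (rule walk_count_linear_system[of "matching_count h"]) (use that in \<open>auto simp: Suc.IH E_def\<close>)
  then have "matching_fps (insert h {..<h}) = matching_fps {..<h} + (\<Sum>c<h. E c)"
    by (intro matching_fps_insert_vertex) auto
  then show ?case
    by (simp only: matching_count.simps lessThan_Suc of_nat_add of_nat_sum Suc.IH fps_add_nth fps_sum_nth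
        E_def fps_nth_Abs_fps)
qed

theorem matching_count_parity:
  "even (matching_count h x) \<longleftrightarrow> even (card {M \<in> matchings {..<h}. sum w M = x})"
proof -
  have "of_nat (matching_count h x) = (of_nat (card {M \<in> matchings {..<h}. sum w M = x}) :: bit)"
    using finite_matchings[of "{..<h}"]
    unfolding of_nat_matching_count matching_fps_def fps_sum_nth fps_X_power_nth
    by (simp add: sum.inter_filter[symmetric] eq_commute[of x])
  then show ?thesis unfolding of_nat_bit_eq_odd of_bool_eq_iff by blast
qed

end

section \<open>The isolation lemma on the random tape\<close>

definition isolating :: "'a set set \<Rightarrow> ('a \<Rightarrow> nat) \<Rightarrow> bool" where
  "isolating \<F> w \<longleftrightarrow> (\<exists>M\<in>\<F>. \<forall>M'\<in>\<F>. M' \<noteq> M \<longrightarrow> sum w M < sum w M')"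

definition ambiguous_at :: "'a set set \<Rightarrow> ('a \<Rightarrow> nat) \<Rightarrow> 'a \<Rightarrow> bool" where
  "ambiguous_at \<F> w k \<longleftrightarrow> (\<exists>A B. is_arg_min (sum w) (\<lambda>M. M \<in> \<F>) A \<and> is_arg_min (sum w) (\<lambda>M. M \<in> \<F>) B \<and>
     k \<in> A \<and> k \<notin> B)"

lemma isolating_cong:
  assumes "\<And>M k. M \<in> \<F> \<Longrightarrow> k \<in> M \<Longrightarrow> w k = w' k"
  shows "isolating \<F> w \<longleftrightarrow> isolating \<F> w'"
  unfolding isolating_def by (simp add: assms cong: sum.cong)

lemma not_isolating_imp_ambiguous:
  assumes "finite \<F>" "\<F> \<noteq> {}" "\<not> isolating \<F> w"
  shows "\<exists>M\<in>\<F>. \<exists>k\<in>M. ambiguous_at \<F> w k"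
proof -
  obtain A where A: "is_arg_min (sum w) (\<lambda>M. M \<in> \<F>) A"
    using ex_is_arg_min_if_finite[OF assms(1,2)] by blast
  then obtain B where "B \<in> \<F>" "B \<noteq> A" "sum w B \<le> sum w A"
    using assms(3) unfolding isolating_def is_arg_min_def by (meson not_le)
  then have B: "is_arg_min (sum w) (\<lambda>M. M \<in> \<F>) B" "B \<noteq> A"
    using A by (auto simp: is_arg_min_def)
  then obtain k where "k \<in> A \<and> k \<notin> B \<or> k \<in> B \<and> k \<notin> A" by blast
  then show ?thesis using A B unfolding ambiguous_at_def is_arg_min_def by blast
qed

lemma ambiguous_at_determines_weight:
  assumes "\<And>M. M \<in> \<F> \<Longrightarrow> finite M" and "ambiguous_at \<F> w k" "ambiguous_at \<F> w' k"
    and eq: "\<And>M l. M \<in> \<F> \<Longrightarrow> l \<in> M \<Longrightarrow> l \<noteq> k \<Longrightarrow> w l = w' l"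
  shows "w k = w' k"
proof -
  obtain A B where A: "is_arg_min (sum w) (\<lambda>M. M \<in> \<F>) A" "k \<in> A"
    and B: "is_arg_min (sum w) (\<lambda>M. M \<in> \<F>) B" "k \<notin> B"
    using assms(2) unfolding ambiguous_at_def by blast
  obtain A' B' where A': "is_arg_min (sum w') (\<lambda>M. M \<in> \<F>) A'" "k \<in> A'"
    and B': "is_arg_min (sum w') (\<lambda>M. M \<in> \<F>) B'" "k \<notin> B'"
    using assms(3) unfolding ambiguous_at_def by blast
  have without_k: "sum w (M - {k}) = sum w' (M - {k})" if "M \<in> \<F>" for M
    by (rule sum.cong) (use eq[OF that] in auto)
  have with_k: "sum v M = v k + sum v (M - {k})" if "M \<in> \<F>" "k \<in> M" for M and v :: "'a \<Rightarrow> nat"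
    using assms(1) that by (intro sum.remove)
  have "sum w B = sum w' B" "sum w B' = sum w' B'"
    using without_k[of B] without_k[of B'] B B' by (simp_all add: is_arg_min_def)
  moreover have "sum w A = w k + sum w (A - {k})" "sum w A' = w k + sum w (A' - {k})"
      "sum w' A = w' k + sum w (A - {k})" "sum w' A' = w' k + sum w (A' - {k})"
    using with_k[of A] with_k[of A'] without_k[of A] without_k[of A'] A A' by (simp_all add: is_arg_min_def)
  moreover have "sum w A \<le> sum w A'" "sum w' A' \<le> sum w' A" "sum w B \<le> sum w B'" "sum w' B' \<le> sum w' B"
      "sum w A = sum w B" "sum w' A' = sum w' B'"
    using A A' B B' unfolding is_arg_min_linorder by (auto intro: order_antisym)
  ultimately show ?thesis by linarith
qed

lemma card_ambiguous_at:
  assumes "finite E" "k \<in> E" "\<F> \<subseteq> Pow E"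
  shows "card {w \<in> E \<rightarrow>\<^sub>E {..<N}. ambiguous_at \<F> w k} * N \<le> N ^ card E"
proof -
  let ?bad = "{w \<in> E \<rightarrow>\<^sub>E {..<N}. ambiguous_at \<F> w k}"
  have "inj_on (\<lambda>w. restrict w (E - {k})) ?bad"
  proof (rule inj_onI)
    fix w w' assume w: "w \<in> ?bad" "w' \<in> ?bad" and eq: "restrict w (E - {k}) = restrict w' (E - {k})"
    have off_k: "w l = w' l" if "l \<in> E" "l \<noteq> k" for l using fun_cong[OF eq, of l] that by simp
    have "w k = w' k"
    proof (rule ambiguous_at_determines_weight[of \<F> w k w'])
      show "finite M" if "M \<in> \<F>" for M using that assms(1,3) finite_subset by blast
      show "w l = w' l" if "M \<in> \<F>" "l \<in> M" "l \<noteq> k" for M l using that assms(3) off_k by blast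
    qed (use w in auto)
    then have "w l = w' l" if "l \<in> E" for l using that off_k by (cases "l = k") auto
    then show "w = w'" using w by (intro PiE_ext[of w E _ w']) auto
  qed
  moreover have "(\<lambda>w. restrict w (E - {k})) ` ?bad \<subseteq> (E - {k}) \<rightarrow>\<^sub>E {..<N}"
    by (auto intro!: restrict_PiE_iff[THEN iffD2] simp: PiE_mem)
  ultimately have "card ?bad \<le> card ((E - {k}) \<rightarrow>\<^sub>E {..<N})"
    using assms(1) by (intro card_inj_on_le) (auto intro: finite_PiE)
  also have "\<dots> = N ^ (card E - 1)" using assms(1,2) by (simp add: card_PiE)
  finally have "card ?bad * N \<le> N ^ (card E - 1) * N" by (rule mult_le_mono1)
  also have "\<dots> = N ^ card E" using assms(1,2) card_gt_0_iff[of E] by (intro power_minus_mult) auto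
  finally show ?thesis .
qed

theorem card_not_isolating:
  assumes "finite E" "\<F> \<noteq> {}" "\<F> \<subseteq> Pow E"
  shows "card {w \<in> E \<rightarrow>\<^sub>E {..<N}. \<not> isolating \<F> w} * N \<le> card E * N ^ card E"
proof -
  define bad where "bad k = {w \<in> E \<rightarrow>\<^sub>E {..<N}. ambiguous_at \<F> w k}" for k
  have "finite \<F>" using assms(1,3) finite_subset by auto
  then have "{w \<in> E \<rightarrow>\<^sub>E {..<N}. \<not> isolating \<F> w} \<subseteq> (\<Union>k\<in>E. bad k)"
    using not_isolating_imp_ambiguous[OF _ assms(2)] assms(3) by (fastforce simp: bad_def)
  then have "card {w \<in> E \<rightarrow>\<^sub>E {..<N}. \<not> isolating \<F> w} \<le> card (\<Union>k\<in>E. bad k)"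
    using assms(1) by (intro card_mono) (simp_all add: bad_def finite_PiE)
  also have "\<dots> \<le> (\<Sum>k\<in>E. card (bad k))" using assms(1) by (rule card_UN_le)
  finally have "card {w \<in> E \<rightarrow>\<^sub>E {..<N}. \<not> isolating \<F> w} * N \<le> (\<Sum>k\<in>E. card (bad k) * N)"
    unfolding sum_distrib_right[symmetric] by (rule mult_le_mono1)
  also have "\<dots> \<le> (\<Sum>k\<in>E. N ^ card E)"
    unfolding bad_def using assms by (intro sum_mono card_ambiguous_at)
  finally show ?thesis by simp
qed

definition bits_value :: "bool list \<Rightarrow> nat" where
  "bits_value bs = horner_sum of_bool 2 (rev bs)"

lemma bits_value_Nil [simp]: "bits_value [] = 0"
  by (simp add: bits_value_def)

lemma bits_value_snoc [simp]: "bits_value (bs @ [b]) = bits_value bs + bits_value bs + of_bool b"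
  by (simp add: bits_value_def)

lemma bits_value_less: "bits_value bs < 2 ^ length bs"
  using horner_sum_of_bool_2_less[of "rev bs"] by (simp add: bits_value_def)

lemma bits_value_inject:
  assumes "length bs = length bs'" "bits_value bs = bits_value bs'"
  shows "bs = bs'"
proof -
  have "rev bs = rev bs'"
  proof (rule nth_equalityI)
    fix i assume "i < length (rev bs)"
    then show "rev bs ! i = rev bs' ! i"
      using assms(1) arg_cong[OF assms(2), of "\<lambda>x. bit x i"]
      by (simp add: bits_value_def bit_horner_sum_bit_iff)
  qed (simp add: assms(1))
  then show ?thesis by simp
qed

definition block :: "nat \<Rightarrow> nat \<Rightarrow> 'a list \<Rightarrow> 'a list" where
  "block r k xs = take r (drop (k * r) xs)"

lemma length_block_le: "length (block r k xs) \<le> r"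
  by (simp add: block_def)

lemma length_block:
  assumes "k < m" "length xs = m * r"
  shows "length (block r k xs) = r"
proof -
  have "(k + 1) * r \<le> m * r" using assms(1) by (intro mult_le_mono1) simp
  then show ?thesis using assms(2) by (simp add: block_def)
qed

lemma block_stake:
  assumes "k < m"
  shows "block r k (stake (m * r) \<omega>) = stake r (sdrop (k * r) \<omega>)"
proof -
  have "(k + 1) * r \<le> m * r" using assms by (intro mult_le_mono1) simp
  then have "min r (m * r - k * r) = r" by simp
  then show ?thesis by (simp add: block_def drop_stake take_stake)
qed

lemma eq_if_blocks_eq:
  assumes len: "length xs = m * r" "length ys = m * r" and blocks: "\<And>k. k < m \<Longrightarrow> block r k xs = block r k ys"
  shows "xs = ys"
proof (rule nth_equalityI)
  fix i assume i: "i < length xs"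
  then have "0 < r" "i div r < m" using len by (auto simp: less_mult_imp_div_less intro: gr0I)
  moreover have "zs ! i = block r (i div r) zs ! (i mod r)" if "length zs = m * r" for zs :: "'a list"
  proof -
    have "i div r * r \<le> length zs" using that i len div_times_less_eq_dividend[of i r] by linarith
    then show ?thesis using \<open>0 < r\<close> by (simp add: block_def)
  qed
  ultimately show "xs ! i = ys ! i" using len blocks by metis
qed (simp add: len)

lemma card_not_isolating_blocks:
  assumes "\<F> \<noteq> {}" "\<F> \<subseteq> Pow {..<m}"
  shows "card {bs. length bs = m * r \<and> \<not> isolating \<F> (\<lambda>k. bits_value (block r k bs))} * 2 ^ r
    \<le> m * 2 ^ (m * r)"
    (is "card ?bad * _ \<le> _")
proof -
  define weights where "weights bs = (\<lambda>k\<in>{..<m}. bits_value (block r k bs))" for bs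
  have "inj_on weights ?bad"
  proof (rule inj_onI)
    fix bs bs' assume bs: "bs \<in> ?bad" "bs' \<in> ?bad" "weights bs = weights bs'"
    have "block r k bs = block r k bs'" if "k < m" for k
      using fun_cong[OF bs(3), of k] bs(1,2) that
      by (intro bits_value_inject) (auto simp: length_block weights_def)
    then show "bs = bs'" by (rule eq_if_blocks_eq[of _ m r, rotated -1]) (use bs(1,2) in simp_all)
  qed
  moreover have "weights ` ?bad \<subseteq> {w \<in> {..<m} \<rightarrow>\<^sub>E {..<2 ^ r}. \<not> isolating \<F> w}"
  proof (rule image_subsetI)
    fix bs assume bs: "bs \<in> ?bad"
    have "isolating \<F> (weights bs) \<longleftrightarrow> isolating \<F> (\<lambda>k. bits_value (block r k bs))"
      by (rule isolating_cong) (use assms(2) in \<open>auto simp: weights_def\<close>)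
    moreover have "bits_value (block r k bs) < 2 ^ r" if "k < m" for k
      using bits_value_less[of "block r k bs"] length_block[OF that, of bs r] bs by simp
    then have "weights bs \<in> {..<m} \<rightarrow>\<^sub>E {..<2 ^ r}"
      unfolding weights_def by (intro restrict_PiE_iff[THEN iffD2]) simp
    ultimately show "weights bs \<in> {w \<in> {..<m} \<rightarrow>\<^sub>E {..<2 ^ r}. \<not> isolating \<F> w}" using bs by simp
  qed
  ultimately have "card ?bad \<le> card {w \<in> {..<m} \<rightarrow>\<^sub>E {..<2 ^ r}. \<not> isolating \<F> w}"
    by (rule card_inj_on_le) (simp add: finite_PiE)
  then have "card ?bad * 2 ^ r \<le> card {w \<in> {..<m} \<rightarrow>\<^sub>E {..<2 ^ r}. \<not> isolating \<F> w} * 2 ^ r"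
    by (rule mult_le_mono1)
  also have "\<dots> \<le> m * 2 ^ (m * r)"
    using card_not_isolating[of "{..<m}" \<F> "2 ^ r"] assms by (simp add: power_mult[symmetric] mult.commute)
  finally show ?thesis .
qed

lemma prob_space_coin_tape: "prob_space coin_tape"
  unfolding coin_tape_def by (intro prob_space.prob_space_stream_space measure_pmf.prob_space_axioms)

lemma space_coin_tape [simp]: "space coin_tape = UNIV"
  by (simp add: coin_tape_def space_stream_space)

lemma sets_coin_tape_stake: "{\<omega>. stake n \<omega> \<in> A} \<in> sets coin_tape"
proof -
  have "sets coin_tape = sets (stream_space (count_space UNIV))"
    unfolding coin_tape_def by (rule sets_stream_space_cong) simp
  then have "stake n \<in> measurable coin_tape (count_space UNIV)"
    using measurable_stake[of n] measurable_cong_sets by blast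
  then show ?thesis using measurable_sets[of "stake n" coin_tape _ A] by (simp add: vimage_def)
qed

lemma emeasure_coin_tape_stake_eq:
  "length bs = n \<Longrightarrow> emeasure coin_tape {\<omega>. stake n \<omega> = bs} = ennreal ((1 / 2) ^ n)"
proof (induction n arbitrary: bs)
  case 0
  interpret prob_space coin_tape by (rule prob_space_coin_tape)
  show ?case using 0 emeasure_space_1 by simp
next
  case (Suc n)
  let ?coin = "measure_pmf (bernoulli_pmf (1 / 2))"
  obtain b bs' where bs: "bs = b # bs'" "length bs' = n" using Suc.prems by (cases bs) auto
  have "{\<omega>. stake (Suc n) \<omega> = bs} \<in> sets coin_tape"
    using sets_coin_tape_stake[of "Suc n" "{bs}"] by (simp only: singleton_iff)
  then have "emeasure coin_tape {\<omega>. stake (Suc n) \<omega> = bs} =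
     (\<integral>\<^sup>+ t. emeasure coin_tape {\<omega>\<in>space coin_tape. t ## \<omega> \<in> {\<omega>. stake (Suc n) \<omega> = bs}} \<partial>?coin)"
    unfolding coin_tape_def by (intro prob_space.emeasure_stream_space[OF measure_pmf.prob_space_axioms])
  also have "\<dots> = (\<integral>\<^sup>+ t. ennreal ((1 / 2) ^ n) * indicator {b} t \<partial>?coin)"
    by (rule nn_integral_cong) (use Suc.IH[OF bs(2)] in \<open>auto simp: bs(1) indicator_def\<close>)
  also have "\<dots> = ennreal ((1 / 2) ^ n) * emeasure ?coin {b}"
    by (rule nn_integral_cmult_indicator) simp
  also have "emeasure ?coin {b} = ennreal (1 / 2)"
    by (cases b) (simp_all add: emeasure_pmf_single)
  also have "ennreal ((1 / 2) ^ n) * ennreal (1 / 2) = ennreal ((1 / 2) ^ Suc n)"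
    by (subst ennreal_mult[symmetric]) (simp_all add: mult.commute)
  finally show ?case .
qed

lemma measure_coin_tape_stake:
  assumes "A \<subseteq> {bs. length bs = n}"
  shows "measure coin_tape {\<omega>. stake n \<omega> \<in> A} = card A / 2 ^ n"
proof -
  interpret prob_space coin_tape by (rule prob_space_coin_tape)
  have "finite A"
    by (rule finite_subset[OF assms]) (use finite_lists_length_eq[of "UNIV :: bool set" n] in simp)
  moreover have "{\<omega>. stake n \<omega> \<in> A} = (\<Union>bs\<in>A. {\<omega>. stake n \<omega> = bs})" by auto
  ultimately have "measure coin_tape {\<omega>. stake n \<omega> \<in> A} = (\<Sum>bs\<in>A. measure coin_tape {\<omega>. stake n \<omega> = bs})"
    using sets_coin_tape_stake[of n "{bs}" for bs]
    by (simp, intro finite_measure_finite_Union) (auto simp: disjoint_family_on_def)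
  also have "\<dots> = (\<Sum>bs\<in>A. (1 / 2) ^ n)"
    by (rule sum.cong) (use assms emeasure_coin_tape_stake_eq in \<open>auto simp: measure_def\<close>)
  finally show ?thesis by (simp add: power_divide)
qed

theorem prob_isolating_blocks:
  assumes "\<F> \<noteq> {}" "\<F> \<subseteq> Pow {..<m}"
  shows "measure coin_tape {\<omega>. isolating \<F> (\<lambda>k. bits_value (block r k (stake (m * r) \<omega>)))} \<ge> 1 - real m / 2 ^ r"
proof -
  interpret prob_space coin_tape by (rule prob_space_coin_tape)
  define bad where "bad = {bs. length bs = m * r \<and> \<not> isolating \<F> (\<lambda>k. bits_value (block r k bs))}"
  have "card bad * 2 ^ r \<le> m * 2 ^ (m * r)"
    unfolding bad_def by (rule card_not_isolating_blocks[OF assms])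
  then have "real (card bad * 2 ^ r) \<le> real (m * 2 ^ (m * r))" by (rule of_nat_mono)
  then have "card bad / 2 ^ (m * r) \<le> real m / 2 ^ r" by (simp add: field_simps)
  then have "prob {\<omega>. stake (m * r) \<omega> \<in> bad} \<le> real m / 2 ^ r"
    by (subst measure_coin_tape_stake) (auto simp: bad_def)
  moreover have "{\<omega>. isolating \<F> (\<lambda>k. bits_value (block r k (stake (m * r) \<omega>)))} =
      space coin_tape - {\<omega>. stake (m * r) \<omega> \<in> bad}"
    by (auto simp: bad_def)
  ultimately show ?thesis using prob_compl[OF sets_coin_tape_stake[of "m * r" bad]] by simp
qed

section \<open>Reduction to matchings\<close>

lemma mult_add_eq_iff:
  fixes Q :: nat
  assumes "a < Q" "a' < Q"
  shows "x * Q + a = x' * Q + a' \<longleftrightarrow> x = x' \<and> a = a'"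
proof
  assume eq: "x * Q + a = x' * Q + a'"
  have "a = a'" using arg_cong[OF eq, of "\<lambda>y. y mod Q"] assms by simp
  then show "x = x' \<and> a = a'" using eq assms by simp
qed simp

lemma disjoint_family_on_imageI:
  assumes "\<And>x y. x \<in> A \<Longrightarrow> y \<in> A \<Longrightarrow> x \<noteq> y \<Longrightarrow> B (f x) \<inter> B (f y) = {}"
  shows "disjoint_family_on B (f ` A)"
  using assms unfolding disjoint_family_on_def by blast

lemma disjoint_family_on_image_iff:
  "inj_on f A \<Longrightarrow> disjoint_family_on B (f ` A) \<longleftrightarrow> disjoint_family_on (\<lambda>x. B (f x)) A"
  unfolding disjoint_family_on_def by (auto simp: inj_on_eq_iff)

lemma mixed_radix_leading_digit:
  fixes a B :: "nat \<Rightarrow> nat"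
  assumes "(\<Sum>i<Suc c. a i * B i) + 1 = (g + 1) * B c"
  shows "a c \<le> g" and "(\<Sum>i<c. a i * B i) + 1 = (g - a c + 1) * B c"
proof -
  show "a c \<le> g"
  proof (rule ccontr)
    assume "\<not> a c \<le> g"
    then have "(g + 1) * B c \<le> a c * B c" by (intro mult_le_mono1) simp
    then show False using assms by simp
  qed
  then obtain r where "g = a c + r" using le_iff_add by blast
  then show "(\<Sum>i<c. a i * B i) + 1 = (g - a c + 1) * B c" using assms by (simp add: algebra_simps)
qed

lemma mixed_radix_digit_sum_ge:
  fixes m a B :: "nat \<Rightarrow> nat"
  assumes "\<And>i. i < c \<Longrightarrow> 1 \<le> m i" "B 0 = 1" "\<And>i. i < c \<Longrightarrow> B (Suc i) = (m i + 1) * B i"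
    and "(\<Sum>i<c. a i * B i) + 1 = (e + 1) * B c"
  shows "(\<Sum>i<c. m i) + 2 * e \<le> (\<Sum>i<c. a i)"
  using assms
proof (induction c arbitrary: e)
  case 0
  then show ?case by simp
next
  case (Suc c)
  define g where "g = e * (m c + 1) + m c"
  have "(e + 1) * B (Suc c) = (g + 1) * B c"
    using Suc.prems(3)[of c] by (simp add: g_def algebra_simps)
  then have "(\<Sum>i<Suc c. a i * B i) + 1 = (g + 1) * B c" using Suc.prems(4) by simp
  note leading = mixed_radix_leading_digit[OF this]
  have "(\<Sum>i<c. m i) + 2 * (g - a c) \<le> (\<Sum>i<c. a i)"
    using Suc.prems leading(2) by (intro Suc.IH) auto
  moreover have "e * 1 \<le> e * m c" using Suc.prems(1)[of c] by (intro mult_le_mono2) simp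
  then have "2 * e + m c \<le> g" by (simp add: g_def)
  ultimately show ?case using leading(1) by simp
qed

text \<open>Among all representations of \<open>B c - 1\<close> as a sum of place values, the one by digits has the fewest
  summands, so that the number of summands singles it out.\<close>

lemma mixed_radix_max_digits_unique:
  fixes m a B :: "nat \<Rightarrow> nat"
  assumes "\<And>i. i < c \<Longrightarrow> 1 \<le> m i" "B 0 = 1" "\<And>i. i < c \<Longrightarrow> B (Suc i) = (m i + 1) * B i"
    and "(\<Sum>i<c. a i * B i) + 1 = B c" "(\<Sum>i<c. a i) = (\<Sum>i<c. m i)" "i < c"
  shows "a i = m i"
  using assms
proof (induction c arbitrary: i)
  case 0
  then show ?case by simp
next
  case (Suc c)
  have "(\<Sum>i<Suc c. a i * B i) + 1 = (m c + 1) * B c" using Suc.prems(3)[of c] Suc.prems(4) by simp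
  note leading = mixed_radix_leading_digit[OF this]
  have "(\<Sum>i<c. m i) + 2 * (m c - a c) \<le> (\<Sum>i<c. a i)"
    using Suc.prems(1-3) leading(2) by (intro mixed_radix_digit_sum_ge[of c m B]) auto
  then have "a c = m c" "(\<Sum>i<c. a i) = (\<Sum>i<c. m i)" using Suc.prems(5) leading(1) by simp_all
  moreover from this have "a i = m i" if "i < c" using that Suc.prems(1-3) leading(2) by (intro Suc.IH) auto
  ultimately show ?case using Suc.prems(6) by (auto simp: less_Suc_eq)
qed

lemma mixed_radix_max:
  fixes m B :: "nat \<Rightarrow> nat"
  assumes "B 0 = 1" "\<And>i. i < c \<Longrightarrow> B (Suc i) = (m i + 1) * B i"
  shows "(\<Sum>i<c. m i * B i) + 1 = B c"
  using assms by (induction c) auto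

text \<open>\<open>label u v\<close> is an entry of the input matrix, and \<open>tag i\<close>, \<open>dem i\<close> are the matrix label and the demand of
  the \<open>i\<close>-th set with a nonzero demand. A pair \<open>(u, v)\<close> with \<open>v < u\<close> stands for the edge \<open>{u, v}\<close>.\<close>

locale factor_instance =
  fixes n :: nat and label :: "nat \<Rightarrow> nat \<Rightarrow> nat" and d :: "nat \<Rightarrow> nat"
    and c :: nat and tag dem :: "nat \<Rightarrow> nat"
  assumes inj_tag: "inj_on tag {..<c}" and dem_pos: "i < c \<Longrightarrow> 1 \<le> dem i"
begin

definition pairs :: "(nat \<times> nat) set" where
  "pairs = {(u, v). v < u \<and> u < n \<and> label u v \<noteq> 0}"

definition incident :: "(nat \<times> nat) set \<Rightarrow> nat \<Rightarrow> (nat \<times> nat) set" where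
  "incident F u = {p \<in> F. fst p = u \<or> snd p = u}"

definition neighbours :: "(nat \<times> nat) set \<Rightarrow> nat \<Rightarrow> nat set" where
  "neighbours F u = {v. (u, v) \<in> F \<or> (v, u) \<in> F}"

definition class_of :: "(nat \<times> nat) set \<Rightarrow> nat \<Rightarrow> (nat \<times> nat) set" where
  "class_of F l = {p \<in> F. label (fst p) (snd p) = l}"

definition solution :: "(nat \<times> nat) set \<Rightarrow> bool" where
  "solution F \<longleftrightarrow> F \<subseteq> pairs \<and> (\<forall>u<n. card (incident F u) = d u) \<and>
     (\<forall>i<c. dem i \<le> card (class_of F (tag i)))"

text \<open>The port \<open>port u u\<close> has no partner and is always matched to a core, which leaves \<open>d u\<close> ports of \<open>u\<close> for
  the edges of the factor.\<close>

definition port :: "nat \<Rightarrow> nat \<Rightarrow> nat" where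
  "port u v = u * n + v"

definition core :: "nat \<Rightarrow> nat \<Rightarrow> nat" where
  "core u i = n * n + port u i"

definition gadget_vertices :: "nat set" where
  "gadget_vertices = {..<n * n} \<union> (\<lambda>(u, i). core u i) ` (SIGMA u:{..<n}. {..<n - d u})"

definition gadget_order :: nat where
  "gadget_order = n * n + (\<Sum>u<n. n - d u)"

text \<open>Edges of the gadget graph are triples: two end points and the number of the copy.\<close>

definition core_edge :: "nat \<Rightarrow> nat \<Rightarrow> nat \<Rightarrow> nat \<times> nat \<times> nat" where
  "core_edge u i v = (core u i, port u v, 0)"

definition port_edge :: "nat \<times> nat \<Rightarrow> nat \<Rightarrow> nat \<times> nat \<times> nat" where
  "port_edge p b = (port (fst p) (snd p), port (snd p) (fst p), b)"

definition core_edges :: "(nat \<times> nat \<times> nat) set" where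
  "core_edges = {core_edge u i v | u i v. u < n \<and> i < n - d u \<and> v < n}"

definition port_edges :: "(nat \<times> nat \<times> nat) set" where
  "port_edges = {port_edge p b | p b. p \<in> pairs \<and> b < 2}"

definition gadget_edges :: "(nat \<times> nat \<times> nat) set" where
  "gadget_edges = core_edges \<union> port_edges"

definition gadget_ends :: "nat \<times> nat \<times> nat \<Rightarrow> nat set" where
  "gadget_ends k = {fst k, fst (snd k)}"

definition gadget_matching :: "(nat \<times> nat \<times> nat) set \<Rightarrow> bool" where
  "gadget_matching M \<longleftrightarrow> M \<subseteq> gadget_edges \<and> disjoint_family_on gadget_ends M"

definition chosen :: "(nat \<times> nat \<times> nat) set \<Rightarrow> (nat \<times> nat) set" where
  "chosen M = {p \<in> pairs. \<exists>b. port_edge p b \<in> M}"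

text \<open>With \<open>Q = gadget_order + 1\<close>, the charges of the edges of a matching add up to twice the number of edges,
  plus \<open>Q\<close> times the number of counted edges, plus \<open>Q\<^sup>2\<close> times a sum of place values, and there is no carry
  between the first two. The cap bounds the running time; it only affects instances without a solution.\<close>

definition demand_cap :: "nat \<Rightarrow> nat" where
  "demand_cap i = min (dem i) gadget_order"

definition place :: "nat \<Rightarrow> nat" where
  "place i = (\<Prod>i'<i. demand_cap i' + 1)"

definition class_charge :: "nat \<Rightarrow> nat" where
  "class_charge i = (gadget_order + 1) + (gadget_order + 1) * (gadget_order + 1) * place i"

definition label_charge :: "nat \<Rightarrow> nat" where
  "label_charge l = (\<Sum>i | i < c \<and> tag i = l. class_charge i)"

definition gadget_label :: "nat \<times> nat \<times> nat \<Rightarrow> nat" where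
  "gadget_label k = label (fst k div n) (fst k mod n)"

definition charge :: "nat \<times> nat \<times> nat \<Rightarrow> nat" where
  "charge k = 2 + (if snd (snd k) \<noteq> 0 then label_charge (gadget_label k) else 0)"

definition target_charge :: nat where
  "target_charge = gadget_order + (\<Sum>i<c. demand_cap i * class_charge i)"

definition counted_edges :: "(nat \<times> nat \<times> nat) set \<Rightarrow> nat \<Rightarrow> (nat \<times> nat \<times> nat) set" where
  "counted_edges M l = {k \<in> M. snd (snd k) \<noteq> 0 \<and> gadget_label k = l}"

lemma pairs_less: "p \<in> pairs \<Longrightarrow> snd p < fst p" "p \<in> pairs \<Longrightarrow> fst p < n" "p \<in> pairs \<Longrightarrow> snd p < n"
  by (auto simp: pairs_def)

lemma finite_pairs: "finite pairs"
  by (rule finite_subset[of _ "{..<n} \<times> {..<n}"]) (auto simp: pairs_def)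

lemma finite_pairs_subset: "F \<subseteq> pairs \<Longrightarrow> finite F"
  by (rule finite_subset[OF _ finite_pairs])

lemma port_eq_iff: "v < n \<Longrightarrow> v' < n \<Longrightarrow> port u v = port u' v' \<longleftrightarrow> u = u' \<and> v = v'"
  unfolding port_def by (rule mult_add_eq_iff)

lemma port_less: "u < n \<Longrightarrow> v < n \<Longrightarrow> port u v < n * n"
  using mult_le_mono1[of "u + 1" n n] by (simp add: port_def)

lemma port_div_mod: "v < n \<Longrightarrow> port u v div n = u" "v < n \<Longrightarrow> port u v mod n = v"
  by (auto simp: port_def)

lemma core_eq_iff: "i < n \<Longrightarrow> i' < n \<Longrightarrow> core u i = core u' i' \<longleftrightarrow> u = u' \<and> i = i'"
  by (simp add: core_def port_eq_iff)

lemma core_neq_port: "u' < n \<Longrightarrow> v' < n \<Longrightarrow> core u i \<noteq> port u' v'"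
  using port_less[of u' v'] by (simp add: core_def)

lemmas port_neq_core = core_neq_port[symmetric]

lemma gadget_ends_core_edge [simp]: "gadget_ends (core_edge u i v) = {core u i, port u v}"
  by (simp add: gadget_ends_def core_edge_def)

lemma gadget_ends_port_edge [simp]: "gadget_ends (port_edge (u, v) b) = {port u v, port v u}"
  by (simp add: gadget_ends_def port_edge_def)

lemma charge_core_edge [simp]: "charge (core_edge u i v) = 2"
  by (simp add: charge_def core_edge_def)

lemma charge_port_edge:
  assumes "snd p < n"
  shows "charge (port_edge p b) = 2 + (if b \<noteq> 0 then label_charge (label (fst p) (snd p)) else 0)"
  using assms by (simp add: charge_def port_edge_def gadget_label_def port_div_mod)

lemma core_edge_eq_iff:
  assumes "i < n" "v < n" "i' < n" "v' < n"
  shows "core_edge u i v = core_edge u' i' v' \<longleftrightarrow> u = u' \<and> i = i' \<and> v = v'"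
  using assms by (auto simp: core_edge_def core_eq_iff port_eq_iff)

lemma gadget_edge_cases:
  assumes "k \<in> gadget_edges"
  obtains (core) u i v where "k = core_edge u i v" "u < n" "i < n - d u" "v < n"
    | (port) u v b where "k = port_edge (u, v) b" "(u, v) \<in> pairs" "v < u" "u < n" "v < n" "b < 2"
  using assms unfolding gadget_edges_def core_edges_def port_edges_def pairs_def by fastforce

lemma finite_gadget_edges: "finite gadget_edges"
proof -
  have "core_edges \<subseteq> (\<lambda>(u, i, v). core_edge u i v) ` ({..<n} \<times> {..<n} \<times> {..<n})"
    by (force simp: core_edges_def)
  moreover have "port_edges \<subseteq> (\<lambda>(p, b). port_edge p b) ` (pairs \<times> {..<2})"
    by (force simp: port_edges_def)
  ultimately show ?thesis unfolding gadget_edges_def using finite_pairs by (auto dest: finite_subset)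
qed

lemma finite_gadget_matching: "gadget_matching M \<Longrightarrow> finite M"
  using finite_gadget_edges finite_subset unfolding gadget_matching_def by blast

lemma gadget_matching_edge_unique:
  assumes "gadget_matching M" "k \<in> M" "l \<in> M" "x \<in> gadget_ends k" "x \<in> gadget_ends l"
  shows "k = l"
  using assms unfolding gadget_matching_def disjoint_family_on_def by blast

lemma finite_gadget_vertices: "finite gadget_vertices"
  by (simp add: gadget_vertices_def)

lemma card_gadget_vertices: "card gadget_vertices = gadget_order"
proof -
  have "inj_on (\<lambda>(u, i). core u i) (SIGMA u:{..<n}. {..<n - d u})"
    by (rule inj_onI) (auto simp: core_eq_iff)
  then have "card ((\<lambda>(u, i). core u i) ` (SIGMA u:{..<n}. {..<n - d u})) = (\<Sum>u<n. n - d u)"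
    by (simp add: card_image)
  moreover have "{..<n * n} \<inter> (\<lambda>(u, i). core u i) ` (SIGMA u:{..<n}. {..<n - d u}) = {}"
    by (auto simp: core_def)
  ultimately show ?thesis unfolding gadget_vertices_def gadget_order_def by (subst card_Un_disjoint) auto
qed

lemma gadget_ends_vertices:
  assumes "k \<in> gadget_edges"
  shows "gadget_ends k \<subseteq> gadget_vertices" and "card (gadget_ends k) = 2"
  using assms
  by (cases k rule: gadget_edge_cases;
      force simp: gadget_vertices_def port_less port_eq_iff core_neq_port port_neq_core)+

lemma card_Union_gadget_ends:
  assumes "gadget_matching M"
  shows "card (\<Union> (gadget_ends ` M)) = 2 * card M"
proof -
  have "card (\<Union> (gadget_ends ` M)) = (\<Sum>k\<in>M. card (gadget_ends k))"
    using assms finite_gadget_matching[OF assms]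
    by (intro card_UN_disjoint') (simp_all add: gadget_matching_def, simp add: gadget_ends_def)
  also have "\<dots> = (\<Sum>k\<in>M. 2)"
    using assms by (intro sum.cong) (auto simp: gadget_matching_def gadget_ends_vertices)
  finally show ?thesis by simp
qed

lemma Union_gadget_ends_subset: "gadget_matching M \<Longrightarrow> \<Union> (gadget_ends ` M) \<subseteq> gadget_vertices"
  using gadget_ends_vertices(1) unfolding gadget_matching_def by blast

lemma gadget_matching_card_le: "gadget_matching M \<Longrightarrow> 2 * card M \<le> gadget_order"
  using card_mono[OF finite_gadget_vertices Union_gadget_ends_subset] card_Union_gadget_ends card_gadget_vertices
  by metis

lemma perfect_gadget_matching_covers:
  assumes "gadget_matching M" "2 * card M = gadget_order"
  shows "\<Union> (gadget_ends ` M) = gadget_vertices"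
  using assms by (intro card_subset_eq finite_gadget_vertices Union_gadget_ends_subset)
    (simp_all add: card_Union_gadget_ends card_gadget_vertices)

lemma card_incident_eq_neighbours:
  assumes "F \<subseteq> pairs"
  shows "card (incident F u) = card (neighbours F u)"
proof -
  have ordered: "v < u'" if "(u', v) \<in> F" for u' v using assms that by (auto simp: pairs_def)
  let ?other = "\<lambda>p. if fst p = u then snd p else fst p"
  have "inj_on ?other (incident F u)"
    by (rule inj_onI) (fastforce simp: incident_def split: if_splits dest: ordered)
  moreover have "?other ` incident F u = neighbours F u"
  proof (intro equalityI subsetI)
    fix v assume "v \<in> neighbours F u"
    then consider "(u, v) \<in> F" | "(v, u) \<in> F" by (auto simp: neighbours_def)
    then show "v \<in> ?other ` incident F u"
    proof cases
      assume "(u, v) \<in> F"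
      then show ?thesis by (intro image_eqI[of _ _ "(u, v)"]) (auto simp: incident_def)
    next
      assume "(v, u) \<in> F"
      then show ?thesis
        using ordered[of v u] by (intro image_eqI[of _ _ "(v, u)"]) (auto simp: incident_def)
    qed
  qed (force simp: incident_def neighbours_def)
  ultimately show ?thesis using card_image by metis
qed

lemma neighbours_less: "F \<subseteq> pairs \<Longrightarrow> neighbours F u \<subseteq> {..<n}"
  by (auto simp: neighbours_def pairs_def)

lemma handshake:
  assumes "F \<subseteq> pairs"
  shows "(\<Sum>u<n. card (incident F u)) = 2 * card F"
proof -
  have "card (incident F u) = (\<Sum>p\<in>F. (if fst p = u then 1 else 0) + (if snd p = u then 1 else 0))" for u
  proof -
    have "card (incident F u) = (\<Sum>p\<in>F. if fst p = u \<or> snd p = u then 1 else 0)"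
      unfolding incident_def using finite_pairs_subset[OF assms] by (simp add: sum.inter_filter[symmetric])
    also have "\<dots> = (\<Sum>p\<in>F. (if fst p = u then 1 else 0) + (if snd p = u then 1 else 0))"
      by (rule sum.cong[OF refl]) (use assms in \<open>auto simp: pairs_def\<close>)
    finally show ?thesis .
  qed
  then have "(\<Sum>u<n. card (incident F u)) =
      (\<Sum>p\<in>F. \<Sum>u<n. (if fst p = u then 1 else 0) + (if snd p = u then 1 else 0))"
    by (simp only: sum.swap[of _ F])
  also have "\<dots> = (\<Sum>p\<in>F. 2)"
    by (rule sum.cong[OF refl]) (use assms in \<open>auto simp: sum.distrib pairs_def\<close>)
  finally show ?thesis by simp
qed

lemma place_0: "place 0 = 1"
  by (simp add: place_def)

lemma place_Suc: "place (Suc i) = (demand_cap i + 1) * place i"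
  by (simp add: place_def mult.commute)

lemma label_charge_tag:
  assumes "i < c"
  shows "label_charge (tag i) = class_charge i"
proof -
  have "{i'. i' < c \<and> tag i' = tag i} = {i}" using assms inj_tag by (auto simp: inj_on_def)
  then show ?thesis by (simp add: label_charge_def)
qed

lemma label_charge_untagged: "l \<notin> tag ` {..<c} \<Longrightarrow> label_charge l = 0"
  unfolding label_charge_def by (rule sum.neutral) auto

lemma sum_label_charge:
  assumes "finite A"
  shows "(\<Sum>p\<in>A. label_charge (f p)) = (\<Sum>i<c. card {p\<in>A. f p = tag i} * class_charge i)"
proof -
  have "(\<Sum>p\<in>A. label_charge (f p)) = (\<Sum>p\<in>A. \<Sum>i<c. if f p = tag i then class_charge i else 0)"
    by (rule sum.cong[OF refl]) (auto simp: label_charge_def sum.inter_filter[symmetric] intro!: sum.cong)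
  also have "\<dots> = (\<Sum>i<c. \<Sum>p\<in>A. if f p = tag i then class_charge i else 0)" by (rule sum.swap)
  also have "\<dots> = (\<Sum>i<c. card {p\<in>A. f p = tag i} * class_charge i)"
    using assms by (intro sum.cong[OF refl]) (simp add: sum.inter_filter[symmetric])
  finally show ?thesis .
qed

lemma sum_charge:
  assumes "finite M"
  shows "sum charge M = 2 * card M + (\<Sum>i<c. card (counted_edges M (tag i)) * class_charge i)"
proof -
  let ?M' = "{k \<in> M. snd (snd k) \<noteq> 0}"
  have "sum charge M = (\<Sum>k\<in>M. 2) + (\<Sum>k\<in>M. if snd (snd k) \<noteq> 0 then label_charge (gadget_label k) else 0)"
    unfolding charge_def by (rule sum.distrib)
  also have "\<dots> = 2 * card M + (\<Sum>k\<in>?M'. label_charge (gadget_label k))"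
    using assms by (simp add: sum.inter_filter)
  also have "(\<Sum>k\<in>?M'. label_charge (gadget_label k)) =
      (\<Sum>i<c. card (counted_edges M (tag i)) * class_charge i)"
    unfolding counted_edges_def using sum_label_charge[of ?M' gadget_label] assms by simp
  finally show ?thesis .
qed

lemma solutionD:
  assumes "solution F"
  shows "F \<subseteq> pairs" "u < n \<Longrightarrow> card (neighbours F u) = d u" "i < c \<Longrightarrow> dem i \<le> card (class_of F (tag i))"
  using assms card_incident_eq_neighbours[of F u] by (auto simp: solution_def)

lemma solution_degree_le:
  assumes "solution F" "u < n"
  shows "d u \<le> n"
  using card_mono[OF finite_lessThan neighbours_less[of F u, OF solutionD(1)[OF assms(1)]]]
    solutionD(2)[OF assms] by simp

lemma solution_gadget_order:
  assumes "solution F"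
  shows "2 * card F + 2 * (\<Sum>u<n. n - d u) = gadget_order"
proof -
  have "(\<Sum>u<n. d u) = 2 * card F"
    using handshake[of F] assms by (simp add: solution_def)
  moreover have "(\<Sum>u<n. n - d u) + (\<Sum>u<n. d u) = n * n"
    unfolding sum.distrib[symmetric] using solution_degree_le[OF assms] by simp
  ultimately show ?thesis by (simp add: gadget_order_def)
qed

lemma solution_sum_demands_le:
  assumes "solution F"
  shows "(\<Sum>i<c. dem i) \<le> card F"
proof -
  have fin: "finite F" using finite_pairs_subset[OF solutionD(1)[OF assms]] .
  have "(\<Sum>i<c. dem i) \<le> (\<Sum>i<c. card (class_of F (tag i)))"
    by (rule sum_mono) (use solutionD(3)[OF assms] in simp)
  also have "\<dots> = card (\<Union>i<c. class_of F (tag i))"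
    using fin inj_tag
    by (intro card_UN_disjoint[symmetric]) (auto simp: class_of_def inj_on_def)
  also have "\<dots> \<le> card F" using fin by (intro card_mono) (auto simp: class_of_def)
  finally show ?thesis .
qed

lemma solution_demand_cap:
  assumes "solution F" "i < c"
  shows "demand_cap i = dem i"
proof -
  have "dem i \<le> (\<Sum>i<c. dem i)" using assms(2) by (intro member_le_sum) auto
  then show ?thesis
    using solution_sum_demands_le[OF assms(1)] solution_gadget_order[OF assms(1)]
    by (simp add: demand_cap_def)
qed

subsection \<open>From factors to matchings of the gadget graph\<close>

definition factor_edges :: "(nat \<times> nat) set \<Rightarrow> (nat \<times> nat) set \<Rightarrow> (nat \<times> nat \<times> nat) set" where
  "factor_edges F L = (\<lambda>p. port_edge p (of_bool (p \<in> L))) ` F"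

definition filler_edges :: "(nat \<Rightarrow> nat \<Rightarrow> nat) \<Rightarrow> (nat \<times> nat \<times> nat) set" where
  "filler_edges g = (\<lambda>(u, i). core_edge u i (g u i)) ` (SIGMA u:{..<n}. {..<n - d u})"

lemma gadget_matching_factor_edges:
  assumes "F \<subseteq> pairs"
  shows "gadget_matching (factor_edges F L)"
  unfolding gadget_matching_def factor_edges_def
proof (intro conjI disjoint_family_on_imageI)
  show "(\<lambda>p. port_edge p (of_bool (p \<in> L))) ` F \<subseteq> gadget_edges"
    using assms by (fastforce simp: gadget_edges_def port_edges_def)
  fix p q assume p: "p \<in> F" "q \<in> F" "p \<noteq> q"
  obtain u v u' v' where "p = (u, v)" "q = (u', v')" by force
  moreover from this have "v < u" "u < n" "v' < u'" "u' < n"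
    using p assms by (auto simp: pairs_def)
  ultimately show
    "gadget_ends (port_edge p (of_bool (p \<in> L))) \<inter> gadget_ends (port_edge q (of_bool (q \<in> L))) = {}"
    using p(3) by (auto simp: port_eq_iff)
qed

lemma gadget_matching_filler_edges:
  assumes "\<And>u. u < n \<Longrightarrow> inj_on (g u) {..<n - d u}" "\<And>u i. u < n \<Longrightarrow> i < n - d u \<Longrightarrow> g u i < n"
  shows "gadget_matching (filler_edges g)"
  unfolding gadget_matching_def filler_edges_def
proof (intro conjI disjoint_family_on_imageI)
  show "(\<lambda>(u, i). core_edge u i (g u i)) ` (SIGMA u:{..<n}. {..<n - d u}) \<subseteq> gadget_edges"
    using assms(2) by (fastforce simp: gadget_edges_def core_edges_def)
  fix p q assume p: "p \<in> (SIGMA u:{..<n}. {..<n - d u})" "q \<in> (SIGMA u:{..<n}. {..<n - d u})" "p \<noteq> q"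
  obtain u i u' i' where pq: "p = (u, i)" "q = (u', i')" by force
  have bounds: "u < n" "i < n - d u" "i < n" "u' < n" "i' < n - d u'" "i' < n" using p pq by auto
  have "port u (g u i) \<noteq> port u' (g u' i')"
    using p(3) bounds assms(1)[of u] unfolding pq by (auto simp: port_eq_iff assms(2) inj_on_def)
  then show "gadget_ends (case p of (u, i) \<Rightarrow> core_edge u i (g u i)) \<inter>
      gadget_ends (case q of (u, i) \<Rightarrow> core_edge u i (g u i)) = {}"
    using p(3) bounds assms(2) unfolding pq by (auto simp: core_eq_iff core_neq_port port_neq_core)
qed

lemma factor_edges_disjoint_filler_edges:
  assumes "F \<subseteq> pairs" and free: "\<And>u i. u < n \<Longrightarrow> i < n - d u \<Longrightarrow> g u i < n \<and> g u i \<notin> neighbours F u"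
  shows "\<Union> (gadget_ends ` factor_edges F L) \<inter> \<Union> (gadget_ends ` filler_edges g) = {}"
proof -
  have "gadget_ends (port_edge (u, v) b) \<inter> gadget_ends (core_edge u' i (g u' i)) = {}"
    if "(u, v) \<in> F" "u' < n" "i < n - d u'" for u v b u' i
  proof -
    have "u < n" "v < n" using that(1) assms(1) by (auto simp: pairs_def)
    moreover have "g u' i < n" "(u', g u' i) \<notin> F" "(g u' i, u') \<notin> F"
      using free[OF that(2,3)] by (auto simp: neighbours_def)
    ultimately show ?thesis using that by (auto simp: port_eq_iff core_neq_port port_neq_core)
  qed
  then show ?thesis unfolding factor_edges_def filler_edges_def by fastforce
qed

lemma gadget_matching_Un:
  assumes "gadget_matching A" "gadget_matching B" "\<Union> (gadget_ends ` A) \<inter> \<Union> (gadget_ends ` B) = {}"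
  shows "gadget_matching (A \<union> B)" "A \<inter> B = {}"
proof -
  have cross: "gadget_ends k \<inter> gadget_ends l = {}" if "k \<in> A" "l \<in> B" for k l using assms(3) that by blast
  show "gadget_matching (A \<union> B)"
    using assms(1,2) cross unfolding gadget_matching_def disjoint_family_on_def
    by (metis Un_iff Un_least Int_commute)
  show "A \<inter> B = {}" using assms(3) by (auto simp: gadget_ends_def)
qed

lemma sum_charge_factor_edges:
  assumes "F \<subseteq> pairs" "L \<subseteq> F"
  shows "sum charge (factor_edges F L) = 2 * card F + (\<Sum>p\<in>L. label_charge (label (fst p) (snd p)))"
proof -
  have "inj_on (\<lambda>p. port_edge p (of_bool (p \<in> L))) F"
  proof (rule inj_onI)
    fix p q assume p: "p \<in> F" "q \<in> F" "port_edge p (of_bool (p \<in> L)) = port_edge q (of_bool (q \<in> L))"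
    then have "snd p < n" "snd q < n" using assms(1) pairs_less(3) by blast+
    then show "p = q" using p(3) by (simp add: port_edge_def port_eq_iff prod_eq_iff)
  qed
  then have "sum charge (factor_edges F L) = (\<Sum>p\<in>F. charge (port_edge p (of_bool (p \<in> L))))"
    by (simp add: factor_edges_def sum.reindex)
  also have "\<dots> = (\<Sum>p\<in>F. 2 + (if p \<in> L then label_charge (label (fst p) (snd p)) else 0))"
    using assms(1) by (intro sum.cong refl) (simp only: charge_port_edge[OF pairs_less(3)] subsetD, simp)
  also have "\<dots> = (\<Sum>p\<in>F. 2) + (\<Sum>p\<in>F. if p \<in> L then label_charge (label (fst p) (snd p)) else 0)"
    by (rule sum.distrib)
  also have "\<dots> = 2 * card F + (\<Sum>p\<in>F \<inter> L. label_charge (label (fst p) (snd p)))"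
    using finite_pairs_subset[OF assms(1)] by (simp add: sum.inter_restrict)
  also have "F \<inter> L = L" using assms(2) by blast
  finally show ?thesis .
qed

lemma sum_charge_filler_edges:
  assumes "\<And>u i. u < n \<Longrightarrow> i < n - d u \<Longrightarrow> g u i < n"
  shows "sum charge (filler_edges g) = 2 * (\<Sum>u<n. n - d u)"
proof -
  have "inj_on (\<lambda>(u, i). core_edge u i (g u i)) (SIGMA u:{..<n}. {..<n - d u})"
    by (rule inj_onI) (auto simp: core_edge_eq_iff assms)
  then have "sum charge (filler_edges g) = (\<Sum>p\<in>(SIGMA u:{..<n}. {..<n - d u}). 2)"
    by (simp add: filler_edges_def sum.reindex case_prod_unfold)
  then show ?thesis by simp
qed

lemma exists_counted_pairs:
  assumes "solution F"
  shows "\<exists>L\<subseteq>F. \<forall>i<c. card (class_of L (tag i)) = dem i"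
proof -
  have "\<exists>C. C \<subseteq> class_of F (tag i) \<and> card C = dem i" if "i < c" for i
    using obtain_subset_with_card_n[OF solutionD(3)[OF assms that]] by metis
  then obtain C where C: "\<And>i. i < c \<Longrightarrow> C i \<subseteq> class_of F (tag i) \<and> card (C i) = dem i" by metis
  have "class_of (\<Union>i<c. C i) (tag i) = C i" if "i < c" for i
  proof (intro equalityI subsetI)
    fix p assume "p \<in> class_of (\<Union>i<c. C i) (tag i)"
    then obtain j where "j < c" "p \<in> C j" "label (fst p) (snd p) = tag i" by (auto simp: class_of_def)
    moreover from this have "tag j = tag i" using C[of j] by (auto simp: class_of_def)
    ultimately show "p \<in> C i" using that inj_tag by (auto simp: inj_on_def)
  qed (use C[OF that] that in \<open>auto simp: class_of_def\<close>)
  then show ?thesis using C by (intro exI[of _ "\<Union>i<c. C i"]) (auto simp: class_of_def)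
qed

lemma exists_free_ports:
  assumes "solution F"
  shows "\<exists>g. \<forall>u<n. bij_betw (g u) {..<n - d u} ({..<n} - neighbours F u)"
proof -
  have "\<exists>f. bij_betw f {..<n - d u} ({..<n} - neighbours F u)" if u: "u < n" for u
  proof -
    have "neighbours F u \<subseteq> {..<n}" by (rule neighbours_less[OF solutionD(1)[OF assms]])
    then have "card ({..<n} - neighbours F u) = n - d u"
      using solutionD(2)[OF assms u] by (simp add: card_Diff_subset finite_subset)
    then show ?thesis
      using ex_bij_betw_nat_finite[of "{..<n} - neighbours F u"] by (simp add: atLeast0LessThan)
  qed
  then show ?thesis by metis
qed

theorem solution_imp_gadget_matching:
  assumes "solution F"
  shows "\<exists>M. gadget_matching M \<and> sum charge M = target_charge"
proof -
  have F: "F \<subseteq> pairs" by (rule solutionD(1)[OF assms])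
  obtain L where L: "L \<subseteq> F" "\<And>i. i < c \<Longrightarrow> card (class_of L (tag i)) = dem i"
    using exists_counted_pairs[OF assms] by blast
  obtain g where g: "\<And>u. u < n \<Longrightarrow> bij_betw (g u) {..<n - d u} ({..<n} - neighbours F u)"
    using exists_free_ports[OF assms] by blast
  then have free: "g u i < n \<and> g u i \<notin> neighbours F u" if "u < n" "i < n - d u" for u i
    using bij_betwE that by blast
  note factor = gadget_matching_factor_edges[OF F, of L]
  have filler: "gadget_matching (filler_edges g)"
    using bij_betw_imp_inj_on[OF g] free by (intro gadget_matching_filler_edges) auto
  note union = gadget_matching_Un[OF factor filler factor_edges_disjoint_filler_edges[OF F free]]
  have "(\<Sum>p\<in>L. label_charge (label (fst p) (snd p))) = (\<Sum>i<c. demand_cap i * class_charge i)"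
    using L finite_subset[OF L(1) finite_pairs_subset[OF F]]
    by (simp add: sum_label_charge class_of_def solution_demand_cap[OF assms])
  then have "sum charge (factor_edges F L \<union> filler_edges g) = target_charge"
    using union(2) factor filler free L(1) solution_gadget_order[OF assms]
    by (simp add: sum.union_disjoint finite_gadget_matching sum_charge_factor_edges[OF F] sum_charge_filler_edges
        target_charge_def)
  then show ?thesis using union(1) by blast
qed

subsection \<open>From matchings of the gadget graph to factors\<close>

lemma sum_class_charge:
  "(\<Sum>i<c. b i * class_charge i) =
     (gadget_order + 1) * ((\<Sum>i<c. b i) + (gadget_order + 1) * (\<Sum>i<c. b i * place i))"
proof -
  have "b i * class_charge i = (gadget_order + 1) * (b i + (gadget_order + 1) * (b i * place i))" for i
    by (simp add: class_charge_def algebra_simps)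
  then show ?thesis by (simp only: sum_distrib_left[symmetric] sum.distrib)
qed

lemma charge_determines_counts:
  assumes sol: "solution F" and x: "x \<le> gadget_order" and a: "(\<Sum>i<c. a i) \<le> gadget_order"
    and charge: "x + (\<Sum>i<c. a i * class_charge i) = target_charge"
  shows "x = gadget_order" and "i < c \<Longrightarrow> a i = dem i"
proof -
  let ?Q = "gadget_order + 1"
  have dem: "(\<Sum>i<c. dem i) \<le> gadget_order"
    using solution_sum_demands_le[OF sol] solution_gadget_order[OF sol] by simp
  define digits where "digits b = (\<Sum>i<c. b i) + ?Q * (\<Sum>i<c. b i * place i)" for b
  have "?Q * digits a + x = ?Q * digits dem + gadget_order"
    using charge sum_class_charge[of a] sum_class_charge[of dem] solution_demand_cap[OF sol]
    by (simp add: target_charge_def digits_def)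
  then have x_eq: "x = gadget_order" and "digits a = digits dem"
    using mult_add_eq_iff[of x ?Q gadget_order "digits a" "digits dem"] x by (simp_all add: mult.commute)
  then have "(\<Sum>i<c. a i * place i) * ?Q + (\<Sum>i<c. a i) = (\<Sum>i<c. dem i * place i) * ?Q + (\<Sum>i<c. dem i)"
    unfolding digits_def by (simp only: add.commute mult.commute)
  then have sums: "(\<Sum>i<c. a i * place i) = (\<Sum>i<c. dem i * place i)" "(\<Sum>i<c. a i) = (\<Sum>i<c. dem i)"
    using mult_add_eq_iff[of "\<Sum>i<c. a i" ?Q "\<Sum>i<c. dem i"] a dem by auto
  show "x = gadget_order" by (rule x_eq)
  have step: "place (Suc i) = (dem i + 1) * place i" if "i < c" for i
    using place_Suc[of i] solution_demand_cap[OF sol that] by simp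
  show "a i = dem i" if "i < c"
    using mixed_radix_max_digits_unique[OF dem_pos place_0 step _ sums(2) that]
      mixed_radix_max[OF place_0 step] sums(1) by simp
qed

lemma card_counted_edges_le:
  assumes "gadget_matching M"
  shows "card (counted_edges M l) \<le> card (class_of (chosen M) l)"
proof -
  have "counted_edges M l \<subseteq> (\<lambda>p. port_edge p 1) ` class_of (chosen M) l"
  proof
    fix k assume k: "k \<in> counted_edges M l"
    then have "k \<in> gadget_edges" using assms by (auto simp: counted_edges_def gadget_matching_def)
    then show "k \<in> (\<lambda>p. port_edge p 1) ` class_of (chosen M) l"
    proof (cases k rule: gadget_edge_cases)
      case (core u i v)
      then show ?thesis using k by (simp add: counted_edges_def core_edge_def)
    next
      case (port u v b)
      then have "b = 1" "label u v = l"
        using k by (simp_all add: counted_edges_def port_edge_def gadget_label_def port_div_mod)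
      then show ?thesis using port k by (auto simp: class_of_def chosen_def counted_edges_def)
    qed
  qed
  moreover have "finite (class_of (chosen M) l)"
    by (rule finite_subset[OF _ finite_pairs]) (auto simp: class_of_def chosen_def)
  ultimately show ?thesis by (meson card_image_le card_mono finite_imageI le_trans)
qed

lemma sum_card_counted_edges_le:
  assumes "finite M"
  shows "(\<Sum>i<c. card (counted_edges M (tag i))) \<le> card M"
proof -
  have "(\<Sum>i<c. card (counted_edges M (tag i))) = card (\<Union>i<c. counted_edges M (tag i))"
    using assms inj_tag by (intro card_UN_disjoint[symmetric]) (auto simp: counted_edges_def inj_on_def)
  also have "\<dots> \<le> card M" using assms by (intro card_mono) (auto simp: counted_edges_def)
  finally show ?thesis .
qed

lemma core_covered:
  assumes M: "gadget_matching M" "\<Union> (gadget_ends ` M) = gadget_vertices" and u: "u < n" "i < n - d u"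
  shows "\<exists>v<n. core_edge u i v \<in> M"
proof -
  have "core u i \<in> gadget_vertices" using u by (force simp: gadget_vertices_def)
  then obtain k where k: "k \<in> M" "core u i \<in> gadget_ends k" using M(2) by blast
  then have "k \<in> gadget_edges" using M(1) by (auto simp: gadget_matching_def)
  then show ?thesis
  proof (cases k rule: gadget_edge_cases)
    case (core u' i' v)
    then have "u = u'" "i = i'" using k(2) u by (auto simp: core_eq_iff core_neq_port)
    then show ?thesis using core k(1) by blast
  next
    case (port u' v b)
    then show ?thesis using k(2) by (auto simp: core_neq_port)
  qed
qed

lemma port_covered:
  assumes M: "gadget_matching M" "\<Union> (gadget_ends ` M) = gadget_vertices" and uv: "u < n" "v < n"
  shows "v \<in> neighbours (chosen M) u \<or> (\<exists>i<n - d u. core_edge u i v \<in> M)"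
proof -
  have "port u v \<in> gadget_vertices" using port_less[OF uv] by (simp add: gadget_vertices_def)
  then obtain k where k: "k \<in> M" "port u v \<in> gadget_ends k" using M(2) by blast
  then have "k \<in> gadget_edges" using M(1) by (auto simp: gadget_matching_def)
  then show ?thesis
  proof (cases k rule: gadget_edge_cases)
    case (core u' i v')
    then have "u = u'" "v = v'" using k(2) uv by (auto simp: port_eq_iff port_neq_core)
    then show ?thesis using core k(1) by blast
  next
    case (port u' v' b)
    then have "u = u' \<and> v = v' \<or> u = v' \<and> v = u'" using k(2) uv by (auto simp: port_eq_iff)
    then show ?thesis using port k(1) by (auto simp: neighbours_def chosen_def)
  qed
qed

lemma port_not_doubly_covered:
  assumes M: "gadget_matching M" and "u < n" "v < n" "core_edge u i v \<in> M"
  shows "v \<notin> neighbours (chosen M) u"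
proof
  assume "v \<in> neighbours (chosen M) u"
  then obtain b where "port_edge (u, v) b \<in> M \<or> port_edge (v, u) b \<in> M"
    by (auto simp: neighbours_def chosen_def)
  then obtain p where p: "port_edge p b \<in> M" "p = (u, v) \<or> p = (v, u)" by blast
  then have "port_edge p b = core_edge u i v"
    using assms by (intro gadget_matching_edge_unique[OF M, of _ _ "port u v"]) auto
  then show False using p(2) assms(2,3) by (auto simp: port_edge_def core_edge_def port_neq_core)
qed

lemma card_neighbours_chosen:
  assumes M: "gadget_matching M" "\<Union> (gadget_ends ` M) = gadget_vertices" and u: "u < n" "d u \<le> n"
  shows "card (neighbours (chosen M) u) = d u"
proof -
  obtain r where r: "\<And>i. i < n - d u \<Longrightarrow> r i < n \<and> core_edge u i (r i) \<in> M"
    using core_covered[OF M u(1)] by metis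
  have "inj_on r {..<n - d u}"
  proof (rule inj_onI)
    fix i j assume ij: "i \<in> {..<n - d u}" "j \<in> {..<n - d u}" "r i = r j"
    then have "core_edge u i (r i) = core_edge u j (r j)"
      using r[of i] r[of j] by (intro gadget_matching_edge_unique[OF M(1), of _ _ "port u (r i)"]) auto
    then show "i = j" using ij r[of i] r[of j] by (simp add: core_edge_eq_iff)
  qed
  moreover have "neighbours (chosen M) u = {..<n} - r ` {..<n - d u}"
  proof (intro equalityI subsetI)
    fix v assume "v \<in> neighbours (chosen M) u"
    moreover from this have "v < n" using neighbours_less[of "chosen M" u] by (auto simp: chosen_def)
    ultimately show "v \<in> {..<n} - r ` {..<n - d u}" using r port_not_doubly_covered[OF M(1) u(1)] by auto
  next
    fix v assume v: "v \<in> {..<n} - r ` {..<n - d u}"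
    have "v = r i" if "i < n - d u" "core_edge u i v \<in> M" for i
    proof -
      have "core_edge u i v = core_edge u i (r i)"
        using that r[of i] by (intro gadget_matching_edge_unique[OF M(1), of _ _ "core u i"]) auto
      then show ?thesis using that v r[of i] by (simp add: core_edge_eq_iff)
    qed
    then show "v \<in> neighbours (chosen M) u" using port_covered[OF M u(1)] v by blast
  qed
  ultimately show ?thesis
    using r u(2) by (subst \<open>neighbours (chosen M) u = _\<close>, subst card_Diff_subset) (auto simp: card_image)
qed

theorem gadget_matching_imp_solution:
  assumes sol: "solution F" and M: "gadget_matching M" "sum charge M = target_charge"
  shows "solution (chosen M)"
proof -
  let ?a = "\<lambda>i. card (counted_edges M (tag i))"
  have fin: "finite M" by (rule finite_gadget_matching[OF M(1)])
  have card_le: "2 * card M \<le> gadget_order" by (rule gadget_matching_card_le[OF M(1)])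
  have "(\<Sum>i<c. ?a i) \<le> gadget_order" using sum_card_counted_edges_le[OF fin] card_le by simp
  moreover have "2 * card M + (\<Sum>i<c. ?a i * class_charge i) = target_charge"
    using sum_charge[OF fin] M(2) by simp
  ultimately have perfect: "2 * card M = gadget_order" and counts: "\<And>i. i < c \<Longrightarrow> ?a i = dem i"
    using charge_determines_counts[OF sol card_le, of ?a] by blast+
  have sub: "chosen M \<subseteq> pairs" by (auto simp: chosen_def)
  have "card (incident (chosen M) u) = d u" if "u < n" for u
    using card_neighbours_chosen[OF M(1) perfect_gadget_matching_covers[OF M(1) perfect] that]
      solution_degree_le[OF sol that] card_incident_eq_neighbours[OF sub] by simp
  moreover have "dem i \<le> card (class_of (chosen M) (tag i))" if "i < c" for i
    using card_counted_edges_le[OF M(1), of "tag i"] counts[OF that] by simp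
  ultimately show ?thesis using sub by (simp add: solution_def)
qed

end

section \<open>Weakest preconditions with running time\<close>

notation Seq (infixr ";;" 60)

lemma upd_eq [simp]: "upd s x i v x = (s x)(i := v)"
  by (simp add: upd_def)

lemma upd_neq [simp]: "y \<noteq> x \<Longrightarrow> upd s x i v y = s y"
  by (simp add: upd_def)

fun writes :: "com \<Rightarrow> nat set" where
  "writes Skip = {}"
| "writes (Store x a b) = {x}"
| "writes (Flip x a) = {x}"
| "writes (c ;; d) = writes c \<union> writes d"
| "writes (Cond b c d) = writes c \<union> writes d"
| "writes (While b c) = writes c"

fun flip_free :: "com \<Rightarrow> bool" where
  "flip_free (Flip x a) = False"
| "flip_free (c ;; d) = (flip_free c \<and> flip_free d)"
| "flip_free (Cond b c d) = (flip_free c \<and> flip_free d)"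
| "flip_free (While b c) = flip_free c"
| "flip_free _ = True"

fun reads :: "aexp \<Rightarrow> nat set" where
  "reads (Const c) = {}"
| "reads (Fetch x a) = insert x (reads a)"
| "reads (Plus a b) = reads a \<union> reads b"
| "reads (Minus a b) = reads a \<union> reads b"

definition frame :: "com \<Rightarrow> mem \<Rightarrow> bool stream \<Rightarrow> mem \<Rightarrow> bool stream \<Rightarrow> bool" where
  "frame c s \<omega> s' \<omega>' \<longleftrightarrow> (\<forall>x. x \<notin> writes c \<longrightarrow> s' x = s x) \<and> (flip_free c \<longrightarrow> \<omega>' = \<omega>)"

definition supported_on :: "nat set \<Rightarrow> (mem \<Rightarrow> bool) \<Rightarrow> bool" where
  "supported_on X P \<longleftrightarrow> (\<forall>s s'. (\<forall>x\<in>X. s' x = s x) \<longrightarrow> P s \<longrightarrow> P s')"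

lemma frameD: "frame c s \<omega> s' \<omega>' \<Longrightarrow> x \<notin> writes c \<Longrightarrow> s' x = s x"
  by (simp add: frame_def)

lemma frame_tape: "frame c s \<omega> s' \<omega>' \<Longrightarrow> flip_free c \<Longrightarrow> \<omega>' = \<omega>"
  by (simp add: frame_def)

lemma frame_Seq: "frame c s \<omega> s' \<omega>' \<Longrightarrow> frame d s' \<omega>' s'' \<omega>'' \<Longrightarrow> frame (c ;; d) s \<omega> s'' \<omega>''"
  by (simp add: frame_def)

lemma frame_supported_on:
  "supported_on X P \<Longrightarrow> P s \<Longrightarrow> frame c s \<omega> s' \<omega>' \<Longrightarrow> X \<inter> writes c = {} \<Longrightarrow> P s'"
  unfolding supported_on_def frame_def by blast

lemma supported_on_upd:
  assumes "supported_on X P" "x \<notin> X"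
  shows "P (upd s x i v) \<longleftrightarrow> P s"
proof -
  have "upd s x i v y = s y" if "y \<in> X" for y using assms(2) that by (intro upd_neq) auto
  then show ?thesis using assms(1) unfolding supported_on_def by metis
qed

lemma exec_frame: "exec c s \<omega> t s' \<omega>' \<Longrightarrow> frame c s \<omega> s' \<omega>'"
  by (induction rule: exec.induct) (auto simp: frame_def)

lemma aval_cong: "(\<And>x. x \<in> reads a \<Longrightarrow> s x = s' x) \<Longrightarrow> aval a s = aval a s'"
  by (induction a) auto

fun cost :: "com \<Rightarrow> nat" where
  "cost Skip = 1"
| "cost (Store x a b) = 1"
| "cost (Flip x a) = 1"
| "cost (c ;; d) = cost c + cost d"
| "cost (Cond b c d) = cost c + cost d + 1"
| "cost (While b c) = cost c + 2"

fun depth :: "com \<Rightarrow> nat" where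
  "depth (c ;; d) = max (depth c) (depth d)"
| "depth (Cond b c d) = max (depth c) (depth d)"
| "depth (While b c) = Suc (depth c)"
| "depth _ = 0"

text \<open>\<open>B\<close> bounds the number of passes of every single execution of a loop; it enters through \<open>wp_For\<close>.\<close>

definition time_bound :: "nat \<Rightarrow> com \<Rightarrow> nat" where
  "time_bound B c = cost c * Suc B ^ depth c"

definition wp :: "nat \<Rightarrow> com \<Rightarrow> (mem \<Rightarrow> bool stream \<Rightarrow> bool) \<Rightarrow> mem \<Rightarrow> bool stream \<Rightarrow> bool" where
  "wp B c Q s \<omega> \<longleftrightarrow> (\<exists>t s' \<omega>'. exec c s \<omega> t s' \<omega>' \<and> t \<le> time_bound B c \<and> Q s' \<omega>')"

lemma wp_mono: "wp B c Q s \<omega> \<Longrightarrow> (\<And>s' \<omega>'. frame c s \<omega> s' \<omega>' \<Longrightarrow> Q s' \<omega>' \<Longrightarrow> Q' s' \<omega>') \<Longrightarrow> wp B c Q' s \<omega>"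
  unfolding wp_def using exec_frame by blast

lemma wp_Skip: "Q s \<omega> \<Longrightarrow> wp B Skip Q s \<omega>"
  unfolding wp_def time_bound_def using exec.Skip[of s \<omega>] by (intro exI conjI, assumption) auto

lemma wp_Store: "Q (upd s x (aval a s) (aval b s)) \<omega> \<Longrightarrow> wp B (Store x a b) Q s \<omega>"
  unfolding wp_def time_bound_def using exec.Store[of x a b s \<omega>] by (intro exI conjI, assumption) auto

lemma wp_Flip: "Q (upd s x (aval a s) (of_bool (shd \<omega>))) (stl \<omega>) \<Longrightarrow> wp B (Flip x a) Q s \<omega>"
  unfolding wp_def time_bound_def using exec.Flip[of x a s \<omega>] by (intro exI conjI, assumption) auto

lemma time_bound_le:
  assumes "depth c \<le> e"
  shows "time_bound B c \<le> cost c * Suc B ^ e"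
  unfolding time_bound_def using assms by (intro mult_le_mono2 power_increasing) simp_all

lemma wp_Seq:
  assumes "wp B c (wp B d Q) s \<omega>"
  shows "wp B (c ;; d) Q s \<omega>"
proof -
  obtain t s' \<omega>' t' s'' \<omega>'' where c: "exec c s \<omega> t s' \<omega>'" "t \<le> time_bound B c"
    and d: "exec d s' \<omega>' t' s'' \<omega>''" "t' \<le> time_bound B d" "Q s'' \<omega>''"
    using assms unfolding wp_def by blast
  have "t + t' \<le> time_bound B (c ;; d)"
    using order_trans[OF c(2) time_bound_le[of c "depth (c ;; d)"]]
      order_trans[OF d(2) time_bound_le[of d "depth (c ;; d)"]]
    by (simp add: time_bound_def distrib_right)
  then show ?thesis unfolding wp_def using exec.Seq[OF c(1) d(1)] d(3) by blast
qed

lemma wp_Seq_frame: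
  assumes "wp B c P s \<omega>" "\<And>s' \<omega>'. frame c s \<omega> s' \<omega>' \<Longrightarrow> P s' \<omega>' \<Longrightarrow> wp B d Q s' \<omega>'"
  shows "wp B (c ;; d) Q s \<omega>"
  using assms by (intro wp_Seq wp_mono[OF assms(1)])

lemma wp_Cond:
  assumes "bval b s \<Longrightarrow> wp B c Q s \<omega>" "\<not> bval b s \<Longrightarrow> wp B d Q s \<omega>"
  shows "wp B (Cond b c d) Q s \<omega>"
proof -
  let ?if = "Cond b c d"
  obtain e t s' \<omega>' where e: "e = (if bval b s then c else d)" and exec: "exec e s \<omega> t s' \<omega>'"
    and t: "t \<le> time_bound B e" and Q: "Q s' \<omega>'"
    using assms unfolding wp_def by (cases "bval b s") auto
  have "1 \<le> Suc B ^ depth ?if" by simp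
  moreover have "t \<le> cost e * Suc B ^ depth ?if"
    by (rule order_trans[OF t time_bound_le]) (simp add: e)
  ultimately have "t + 1 \<le> (cost e + 1) * Suc B ^ depth ?if" by (simp only: distrib_right)
  also have "\<dots> \<le> time_bound B ?if"
    unfolding time_bound_def by (intro mult_le_mono1) (simp add: e)
  finally have "t + 1 \<le> time_bound B ?if" .
  moreover have "exec ?if s \<omega> (t + 1) s' \<omega>'"
    using e exec exec.Cond_True[of b s c \<omega> t s' \<omega>' d] exec.Cond_False[of b s d \<omega> t s' \<omega>' c]
    by (cases "bval b s") simp_all
  ultimately show ?thesis unfolding wp_def using Q by blast
qed

abbreviation (input) var :: "nat \<Rightarrow> aexp" where "var x \<equiv> Fetch x (Const 0)"

abbreviation (input) assign :: "nat \<Rightarrow> aexp \<Rightarrow> com" (infix "::=" 61) where "x ::= a \<equiv> Store x (Const 0) a"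

definition For :: "nat \<Rightarrow> aexp \<Rightarrow> com \<Rightarrow> com" where
  "For i b c = i ::= Const 0 ;; While (Less (var i) b) (c ;; i ::= Plus (var i) (Const 1))"

lemma writes_For [simp]: "writes (For i b c) = insert i (writes c)"
  by (auto simp: For_def)

lemma flip_free_For [simp]: "flip_free (For i b c) = flip_free c"
  by (simp add: For_def)

lemma time_bound_For:
  assumes "n \<le> B"
  shows "n * (time_bound B c + 2) + 2 \<le> time_bound B (For i b c)"
proof -
  let ?P = "Suc B ^ depth c"
  have pass: "time_bound B c + 2 \<le> (cost c + 2) * ?P"
    unfolding time_bound_def distrib_right by (intro add_left_mono) simp
  have "n * (time_bound B c + 2) + 2 \<le> B * ((cost c + 2) * ?P) + (cost c + 2) * ?P"
    using mult_le_mono[OF assms pass] pass by simp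
  also have "\<dots> \<le> time_bound B (For i b c)"
    by (simp add: time_bound_def For_def algebra_simps)
  finally show ?thesis .
qed

lemma exec_For_loop:
  assumes i: "i \<notin> writes c"
    and bound: "\<And>s' \<omega>'. frame (For i b c) s \<omega> s' \<omega>' \<Longrightarrow> aval b s' = n"
    and step: "\<And>k s' \<omega>'. k < n \<Longrightarrow> frame (For i b c) s \<omega> s' \<omega>' \<Longrightarrow> s' i 0 = k \<Longrightarrow> I k s' \<omega>' \<Longrightarrow>
      wp B c (\<lambda>s'' \<omega>''. I (Suc k) (upd s'' i 0 (Suc k)) \<omega>'') s' \<omega>'"
    and "j + k = n" "frame (For i b c) s \<omega> s' \<omega>'" "s' i 0 = k" "I k s' \<omega>'"
  shows "\<exists>t s'' \<omega>''. exec (While (Less (var i) b) (c ;; i ::= Plus (var i) (Const 1))) s' \<omega>' t s'' \<omega>'' \<and>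
    t \<le> j * (time_bound B c + 2) + 1 \<and> frame (For i b c) s \<omega> s'' \<omega>'' \<and> s'' i 0 = n \<and> I n s'' \<omega>''"
  using assms(4-7)
proof (induction j arbitrary: k s' \<omega>')
  case 0
  then have "\<not> bval (Less (var i) b) s'" using bound by simp
  from exec.While_False[OF this] show ?case using 0 by (intro exI[of _ 1]) auto
next
  case (Suc j)
  let ?next = "i ::= Plus (var i) (Const 1)"
  have test: "bval (Less (var i) b) s'" using bound Suc.prems by simp
  have "wp B c (\<lambda>s'' \<omega>''. I (Suc k) (upd s'' i 0 (Suc k)) \<omega>'') s' \<omega>'"
    using Suc.prems by (intro step) auto
  then obtain t1 s1 \<omega>1 where body: "exec c s' \<omega>' t1 s1 \<omega>1" "t1 \<le> time_bound B c"
    and inv: "I (Suc k) (upd s1 i 0 (Suc k)) \<omega>1"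
    unfolding wp_def by blast
  have body_frame: "frame c s' \<omega>' s1 \<omega>1" by (rule exec_frame[OF body(1)])
  then have "s1 i = s' i" using i by (simp add: frame_def)
  then have "exec ?next s1 \<omega>1 1 (upd s1 i 0 (Suc k)) \<omega>1"
    using exec.Store[of i "Const 0" "Plus (var i) (Const 1)" s1 \<omega>1] Suc.prems(3) by simp
  note pass = exec.Seq[OF body(1) this]
  have "frame (For i b c) s \<omega> (upd s1 i 0 (Suc k)) \<omega>1"
    using body_frame Suc.prems(2) by (auto simp: frame_def)
  then obtain t2 s2 \<omega>2
    where rest: "exec (While (Less (var i) b) (c ;; ?next)) (upd s1 i 0 (Suc k)) \<omega>1 t2 s2 \<omega>2"
    and t2: "t2 \<le> j * (time_bound B c + 2) + 1"
    and final: "frame (For i b c) s \<omega> s2 \<omega>2" "s2 i 0 = n" "I n s2 \<omega>2"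
    using Suc.IH[of "Suc k" "upd s1 i 0 (Suc k)" \<omega>1] Suc.prems(1) inv by auto
  have "t1 + 1 + t2 + 1 \<le> Suc j * (time_bound B c + 2) + 1" using body(2) t2 by simp
  then show ?case using exec.While_True[OF test pass rest] final by blast
qed

text \<open>The bound is evaluated anew before each pass.\<close>

lemma wp_For:
  assumes init: "I 0 (upd s i 0 0) \<omega>"
    and step: "\<And>k s' \<omega>'. k < n \<Longrightarrow> frame (For i b c) s \<omega> s' \<omega>' \<Longrightarrow> s' i 0 = k \<Longrightarrow> I k s' \<omega>' \<Longrightarrow>
      wp B c (\<lambda>s'' \<omega>''. I (Suc k) (upd s'' i 0 (Suc k)) \<omega>'') s' \<omega>'"
    and exit: "\<And>s' \<omega>'. frame (For i b c) s \<omega> s' \<omega>' \<Longrightarrow> s' i 0 = n \<Longrightarrow> I n s' \<omega>' \<Longrightarrow> Q s' \<omega>'"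
    and i: "i \<notin> writes c" "reads b \<inter> insert i (writes c) = {}" and n: "aval b s = n" "n \<le> B"
  shows "wp B (For i b c) Q s \<omega>"
proof -
  have bound: "aval b s' = n" if "frame (For i b c) s \<omega> s' \<omega>'" for s' \<omega>'
  proof -
    have "aval b s' = aval b s"
      by (rule aval_cong) (use that i(2) in \<open>auto simp: frame_def\<close>)
    then show ?thesis using n(1) by simp
  qed
  have start: "exec (i ::= Const 0) s \<omega> 1 (upd s i 0 0) \<omega>"
    using exec.Store[of i "Const 0" "Const 0" s \<omega>] by simp
  have start_frame: "frame (For i b c) s \<omega> (upd s i 0 0) \<omega>" by (simp add: frame_def)
  let ?loop = "While (Less (var i) b) (c ;; i ::= Plus (var i) (Const 1))"
  have "\<exists>t s' \<omega>'. exec ?loop (upd s i 0 0) \<omega> t s' \<omega>' \<and> t \<le> n * (time_bound B c + 2) + 1 \<and>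
      frame (For i b c) s \<omega> s' \<omega>' \<and> s' i 0 = n \<and> I n s' \<omega>'"
    by (rule exec_For_loop[where I = I and k = 0, OF i(1) bound step _ start_frame _ init]) simp_all
  then obtain t s' \<omega>' where loop: "exec ?loop (upd s i 0 0) \<omega> t s' \<omega>'"
    and t: "t \<le> n * (time_bound B c + 2) + 1"
    and final: "frame (For i b c) s \<omega> s' \<omega>'" "s' i 0 = n" "I n s' \<omega>'"
    by blast
  have "1 + t \<le> time_bound B (For i b c)" using t time_bound_For[OF n(2), of c i b] by simp
  then show ?thesis
    unfolding wp_def using exec.Seq[OF start loop] exit[OF final] unfolding For_def by blast
qed

section \<open>The program\<close>

text \<open>As the machine cannot multiply, \<open>r_row\<close> and \<open>r_xrow\<close> hold the offsets of the rows of the input matrix and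
  of the walk table.\<close>

abbreviation (input) r_in :: nat where "r_in \<equiv> 0"
abbreviation (input) r_out :: nat where "r_out \<equiv> 1"
abbreviation (input) r_n :: nat where "r_n \<equiv> 2"
abbreviation (input) r_nsq :: nat where "r_nsq \<equiv> 3"
abbreviation (input) r_row :: nat where "r_row \<equiv> 4"
abbreviation (input) r_deg :: nat where "r_deg \<equiv> 5"
abbreviation (input) r_dptr :: nat where "r_dptr \<equiv> 6"
abbreviation (input) r_order :: nat where "r_order \<equiv> 7"
abbreviation (input) r_src :: nat where "r_src \<equiv> 8"
abbreviation (input) r_dst :: nat where "r_dst \<equiv> 9"
abbreviation (input) r_charge :: nat where "r_charge \<equiv> 10"
abbreviation (input) r_edges :: nat where "r_edges \<equiv> 11"
abbreviation (input) r_base :: nat where "r_base \<equiv> 12"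
abbreviation (input) r_place :: nat where "r_place \<equiv> 13"
abbreviation (input) r_target :: nat where "r_target \<equiv> 14"
abbreviation (input) r_lcharge :: nat where "r_lcharge \<equiv> 15"
abbreviation (input) r_bound :: nat where "r_bound \<equiv> 16"
abbreviation (input) r_range :: nat where "r_range \<equiv> 17"
abbreviation (input) r_bits :: nat where "r_bits \<equiv> 18"
abbreviation (input) r_modulus :: nat where "r_modulus \<equiv> 19"
abbreviation (input) r_weight :: nat where "r_weight \<equiv> 20"
abbreviation (input) r_low :: nat where "r_low \<equiv> 21"
abbreviation (input) r_max :: nat where "r_max \<equiv> 22"
abbreviation (input) r_xrow :: nat where "r_xrow \<equiv> 23"
abbreviation (input) r_verts :: nat where "r_verts \<equiv> 24"
abbreviation (input) r_total :: nat where "r_total \<equiv> 25"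
abbreviation (input) r_walk :: nat where "r_walk \<equiv> 26"
abbreviation (input) r_cdeg :: nat where "r_cdeg \<equiv> 27"
abbreviation (input) r_ccount :: nat where "r_ccount \<equiv> 28"
abbreviation (input) r_ok :: nat where "r_ok \<equiv> 29"
abbreviation (input) r_u :: nat where "r_u \<equiv> 30"
abbreviation (input) r_v :: nat where "r_v \<equiv> 31"
abbreviation (input) r_i :: nat where "r_i \<equiv> 32"
abbreviation (input) r_k :: nat where "r_k \<equiv> 33"
abbreviation (input) r_x :: nat where "r_x \<equiv> 34"
abbreviation (input) r_c :: nat where "r_c \<equiv> 35"
abbreviation (input) r_h :: nat where "r_h \<equiv> 36"
abbreviation (input) r_w :: nat where "r_w \<equiv> 37"
abbreviation (input) r_t :: nat where "r_t \<equiv> 38"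
abbreviation (input) r_label :: nat where "r_label \<equiv> 39"
abbreviation (input) r_acc :: nat where "r_acc \<equiv> 40"
abbreviation (input) r_skip :: nat where "r_skip \<equiv> 41"
abbreviation (input) r_prev :: nat where "r_prev \<equiv> 42"
abbreviation (input) r_coin :: nat where "r_coin \<equiv> 43"
abbreviation (input) r_step :: nat where "r_step \<equiv> 44"
abbreviation (input) r_cap :: nat where "r_cap \<equiv> 45"
abbreviation (input) r_old :: nat where "r_old \<equiv> 46"

abbreviation (input) demand_number :: aexp where
  "demand_number \<equiv> Fetch r_in (var r_dptr)"

abbreviation (input) demand_tag :: aexp where
  "demand_tag \<equiv> Plus (Fetch r_in (Plus (Plus (var r_dptr) (Const 1)) (Plus (var r_i) (var r_i)))) (Const 2)"

abbreviation (input) demand_value :: aexp where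
  "demand_value \<equiv> Fetch r_in (Plus (Plus (var r_dptr) (Const 2)) (Plus (var r_i) (var r_i)))"

abbreviation (input) pair_index :: aexp where
  "pair_index \<equiv> Plus (Fetch r_row (var r_u)) (var r_v)"

abbreviation (input) reversed_pair_index :: aexp where
  "reversed_pair_index \<equiv> Plus (Fetch r_row (var r_v)) (var r_u)"

definition read_size :: com where
  "read_size =
     r_n ::= Fetch r_in (Const 1) ;; r_nsq ::= Const 0 ;;
     For r_u (var r_n) (Store r_row (var r_u) (var r_nsq) ;; r_nsq ::= Plus (var r_nsq) (var r_n))"

definition read_degrees :: com where
  "read_degrees =
     For r_u (var r_n) (Cond (Equal (var r_in) (Const 0))
       (Store r_deg (var r_u) (Const 1))
       (Store r_deg (var r_u) (Fetch r_in (Plus (Plus (Const 2) (var r_nsq)) (var r_u))))) ;;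
     Cond (Equal (var r_in) (Const 0))
       (r_dptr ::= Plus (Const 2) (var r_nsq))
       (r_dptr ::= Plus (Plus (Const 2) (var r_nsq)) (var r_n))"

definition read_instance :: com where
  "read_instance = read_size ;; read_degrees"

definition push_edge :: "aexp \<Rightarrow> aexp \<Rightarrow> aexp \<Rightarrow> com" where
  "push_edge a b q =
     Store r_src (var r_edges) a ;; Store r_dst (var r_edges) b ;; Store r_charge (var r_edges) q ;;
     r_edges ::= Plus (var r_edges) (Const 1)"

definition push_core_star :: com where
  "push_core_star = For r_v (var r_n)
     (push_edge (Plus (var r_nsq) (Plus (Fetch r_row (var r_u)) (var r_i))) pair_index (Const 2))"

definition push_vertex_cores :: com where
  "push_vertex_cores = For r_i (Minus (var r_n) (Fetch r_deg (var r_u)))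
     (push_core_star ;; r_order ::= Plus (var r_order) (Const 1))"

definition push_core_edges :: com where
  "push_core_edges = r_edges ::= Const 0 ;; r_order ::= var r_nsq ;; For r_u (var r_n) push_vertex_cores"

definition charge_class :: com where
  "charge_class =
     r_step ::= Plus (var r_base) (var r_place) ;;
     r_cap ::= Minus demand_value (Minus demand_value (var r_order)) ;;
     Store r_lcharge demand_tag (var r_step) ;;
     r_old ::= var r_place ;;
     For r_t (var r_cap)
       (r_target ::= Plus (var r_target) (var r_step) ;; r_place ::= Plus (var r_place) (var r_old))"

definition charge_labels :: com where
  "charge_labels =
     r_base ::= Plus (var r_order) (Const 1) ;; r_place ::= Const 0 ;;
     For r_t (var r_base) (r_place ::= Plus (var r_place) (var r_base)) ;;
     r_target ::= var r_order ;;
     For r_i demand_number charge_class"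

definition push_port_pair :: com where
  "push_port_pair =
     r_label ::= Fetch r_in (Plus (Const 2) pair_index) ;;
     Cond (Equal (var r_label) (Const 0)) Skip
       (push_edge pair_index reversed_pair_index (Const 2) ;;
        push_edge pair_index reversed_pair_index (Plus (Const 2) (Fetch r_lcharge (var r_label))))"

definition push_vertex_ports :: com where
  "push_vertex_ports = For r_v (var r_u) push_port_pair"

definition push_port_edges :: com where
  "push_port_edges = For r_u (var r_n) push_vertex_ports"

definition build_gadget :: com where
  "build_gadget = push_core_edges ;; charge_labels ;; push_port_edges"

definition compute_bits :: com where
  "compute_bits =
     r_bound ::= Const 0 ;; For r_i (var r_n) (r_bound ::= Plus (var r_bound) (var r_edges)) ;;
     r_range ::= Const 1 ;; r_bits ::= Const 0 ;;
     For r_i (var r_bound) (Cond (Less (var r_range) (var r_bound))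
       (r_range ::= Plus (var r_range) (var r_range) ;; r_bits ::= Plus (var r_bits) (Const 1)) Skip)"

definition compute_modulus :: com where
  "compute_modulus =
     r_modulus ::= Const 1 ;; For r_i (var r_edges) (r_modulus ::= Plus (var r_modulus) (var r_range))"

definition choose_modulus :: com where
  "choose_modulus = compute_bits ;; compute_modulus"

definition draw_bits :: com where
  "draw_bits = r_acc ::= Const 0 ;;
     For r_i (var r_bits) (Flip r_coin (Const 0) ;;
       r_acc ::= Plus (Plus (var r_acc) (var r_acc)) (var r_coin))"

definition draw_weight :: com where
  "draw_weight =
     draw_bits ;; For r_t (Fetch r_charge (var r_k)) (r_acc ::= Plus (var r_acc) (var r_modulus)) ;;
     Store r_weight (var r_k) (var r_acc)"

definition draw_weights :: com where
  "draw_weights = For r_k (var r_edges) draw_weight"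

definition lay_out_tables :: com where
  "lay_out_tables =
     r_low ::= Const 0 ;; For r_t (var r_target) (r_low ::= Plus (var r_low) (var r_modulus)) ;;
     r_max ::= Plus (var r_low) (var r_modulus) ;; r_verts ::= Plus (var r_nsq) (var r_nsq) ;;
     r_acc ::= Const 0 ;;
     For r_x (var r_max) (Store r_xrow (var r_x) (var r_acc) ;; r_acc ::= Plus (var r_acc) (var r_verts))"

definition weigh_gadget :: com where
  "weigh_gadget = choose_modulus ;; draw_weights ;; lay_out_tables"

text \<open>For bits, \<open>(a - b) + (b - a)\<close> with truncated subtraction is the exclusive or.\<close>

definition xor_into :: "nat \<Rightarrow> aexp \<Rightarrow> aexp \<Rightarrow> com" where
  "xor_into x a e = Store x a (Plus (Minus (Fetch x a) e) (Minus e (Fetch x a)))"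

definition extend_walk :: "nat \<Rightarrow> nat \<Rightarrow> com" where
  "extend_walk a b = Cond (Less (Fetch b (var r_k)) (var r_h))
     (xor_into r_walk (Plus (Fetch r_xrow (var r_x)) (Fetch b (var r_k)))
       (Fetch r_walk (Plus (var r_prev) (Fetch a (var r_k))))) Skip"

definition extend_walks :: com where
  "extend_walks =
     Cond (Conj (Neg (Equal (Fetch r_src (var r_k)) (var r_skip))) (Neg (Less (var r_x) (Fetch r_weight (var r_k)))))
       (r_prev ::= Fetch r_xrow (Minus (var r_x) (Fetch r_weight (var r_k))) ;;
        extend_walk r_src r_dst ;; extend_walk r_dst r_src)
       Skip"

definition start_walk_row :: com where
  "start_walk_row =
     For r_c (var r_verts) (Store r_walk (Plus (Fetch r_xrow (var r_x)) (var r_c)) (Const 0)) ;;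
     Store r_walk (Plus (Fetch r_xrow (var r_x)) (var r_h)) (Fetch r_total (var r_x))"

definition fill_walk_row :: com where
  "fill_walk_row = For r_k (var r_edges) extend_walks"

definition walk_table :: com where
  "walk_table = For r_x (var r_max) start_walk_row ;; For r_x (var r_max) fill_walk_row"

definition add_walk_row :: com where
  "add_walk_row =
     For r_c (var r_h) (xor_into r_total (var r_x) (Fetch r_walk (Plus (Fetch r_xrow (var r_x)) (var r_c))))"

definition add_vertex :: com where
  "add_vertex = walk_table ;; For r_x (var r_max) add_walk_row"

definition parity_table :: com where
  "parity_table =
     For r_x (var r_max) (Store r_total (var r_x) (Const 0)) ;; Store r_total (Const 0) (Const 1) ;;
     For r_h (var r_verts) add_vertex"

definition collect_edge :: com where
  "collect_edge =
     Store r_out (Plus (Plus (Fetch r_out (Const 1)) (Fetch r_out (Const 1))) (Const 2)) (var r_u) ;;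
     Store r_out (Plus (Plus (Fetch r_out (Const 1)) (Fetch r_out (Const 1))) (Const 3)) (var r_v) ;;
     Store r_out (Const 1) (Plus (Fetch r_out (Const 1)) (Const 1)) ;;
     Store r_cdeg (var r_u) (Plus (Fetch r_cdeg (var r_u)) (Const 1)) ;;
     Store r_cdeg (var r_v) (Plus (Fetch r_cdeg (var r_v)) (Const 1)) ;;
     Store r_ccount (var r_label) (Plus (Fetch r_ccount (var r_label)) (Const 1))"

definition clear_candidate :: com where
  "clear_candidate =
     Store r_out (Const 1) (Const 0) ;; For r_u (var r_n) (Store r_cdeg (var r_u) (Const 0)) ;;
     For r_i demand_number (Store r_ccount demand_tag (Const 0))"

definition test_edge :: com where
  "test_edge =
     r_skip ::= pair_index ;; parity_table ;;
     Cond (Equal (Fetch r_total (Plus (var r_low) (var r_w))) (Const 0)) collect_edge Skip"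

definition test_pair :: com where
  "test_pair =
     r_label ::= Fetch r_in (Plus (Const 2) pair_index) ;;
     Cond (Equal (var r_label) (Const 0)) Skip test_edge"

definition test_row :: com where
  "test_row = For r_v (var r_u) test_pair"

definition find_candidate :: com where
  "find_candidate = clear_candidate ;; For r_u (var r_n) test_row"

definition check_degrees :: com where
  "check_degrees =
     For r_u (var r_n) (Cond (Equal (Fetch r_cdeg (var r_u)) (Fetch r_deg (var r_u))) Skip (r_ok ::= Const 0))"

definition check_demands :: com where
  "check_demands =
     For r_i demand_number (Cond (Less (Fetch r_ccount demand_tag) demand_value) (r_ok ::= Const 0) Skip)"

definition verify_candidate :: com where
  "verify_candidate = r_ok ::= Const 1 ;; check_degrees ;; check_demands ;; r_out ::= var r_ok"

definition try_weight :: com where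
  "try_weight = Cond (Equal (var r_out) (Const 0)) (find_candidate ;; verify_candidate) Skip"

definition search :: com where
  "search = For r_w (var r_modulus) try_weight"

definition factor_program :: com where
  "factor_program = read_instance ;; build_gadget ;; weigh_gadget ;; search"

lemma writes_setup [simp]:
  "writes read_size = {r_n, r_nsq, r_row, r_u}"
  "writes read_degrees = {r_deg, r_dptr, r_u}"
  "writes read_instance = {r_n, r_nsq, r_row, r_deg, r_dptr, r_u}"
  "writes (push_edge a b q) = {r_src, r_dst, r_charge, r_edges}"
  "writes push_core_star = {r_src, r_dst, r_charge, r_edges, r_v}"
  "writes push_vertex_cores = {r_src, r_dst, r_charge, r_edges, r_order, r_v, r_i}"
  "writes push_core_edges = {r_src, r_dst, r_charge, r_edges, r_order, r_u, r_v, r_i}"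
  "writes charge_class = {r_place, r_target, r_lcharge, r_step, r_cap, r_old, r_t}"
  "writes charge_labels = {r_base, r_place, r_target, r_lcharge, r_step, r_cap, r_old, r_t, r_i}"
  "writes push_port_pair = {r_src, r_dst, r_charge, r_edges, r_label}"
  "writes push_vertex_ports = {r_src, r_dst, r_charge, r_edges, r_label, r_v}"
  "writes push_port_edges = {r_src, r_dst, r_charge, r_edges, r_label, r_u, r_v}"
  "writes build_gadget = {r_src, r_dst, r_charge, r_edges, r_order, r_base, r_place, r_target, r_lcharge,
     r_step, r_cap, r_old, r_t, r_label, r_u, r_v, r_i}"
  "writes compute_bits = {r_bound, r_range, r_bits, r_i}"
  "writes compute_modulus = {r_modulus, r_i}"
  "writes choose_modulus = {r_bound, r_range, r_bits, r_modulus, r_i}"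
  "writes draw_bits = {r_acc, r_coin, r_i}"
  "writes draw_weight = {r_weight, r_acc, r_coin, r_i, r_t}"
  "writes draw_weights = {r_weight, r_acc, r_coin, r_i, r_t, r_k}"
  "writes lay_out_tables = {r_low, r_max, r_verts, r_xrow, r_acc, r_t, r_x}"
  "writes weigh_gadget = {r_bound, r_range, r_bits, r_modulus, r_weight, r_low, r_max, r_verts, r_xrow,
     r_acc, r_coin, r_i, r_t, r_k, r_x}"
  by (auto simp: read_size_def read_degrees_def read_instance_def push_edge_def push_core_star_def
      push_vertex_cores_def push_core_edges_def charge_class_def charge_labels_def push_port_pair_def
      push_vertex_ports_def push_port_edges_def build_gadget_def compute_bits_def compute_modulus_def
      choose_modulus_def draw_bits_def draw_weight_def draw_weights_def lay_out_tables_def weigh_gadget_def)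

lemma flip_free_setup [simp]:
  "flip_free read_instance" "flip_free build_gadget" "flip_free choose_modulus"
  by (simp_all add: read_size_def read_degrees_def read_instance_def push_edge_def push_core_star_def
      push_vertex_cores_def push_core_edges_def charge_class_def charge_labels_def push_port_pair_def
      push_vertex_ports_def push_port_edges_def build_gadget_def compute_bits_def compute_modulus_def
      choose_modulus_def)

lemma writes_search [simp]:
  "writes (xor_into x a e) = {x}"
  "writes (extend_walk y z) = {r_walk}"
  "writes extend_walks = {r_walk, r_prev}"
  "writes start_walk_row = {r_walk, r_c}"
  "writes fill_walk_row = {r_walk, r_prev, r_k}"
  "writes walk_table = {r_walk, r_prev, r_k, r_x, r_c}"
  "writes add_walk_row = {r_total, r_c}"
  "writes add_vertex = {r_total, r_walk, r_prev, r_k, r_x, r_c}"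
  "writes parity_table = {r_total, r_walk, r_prev, r_k, r_x, r_c, r_h}"
  "writes collect_edge = {r_out, r_cdeg, r_ccount}"
  "writes clear_candidate = {r_out, r_cdeg, r_ccount, r_u, r_i}"
  "writes test_edge = {r_out, r_cdeg, r_ccount, r_skip, r_total, r_walk, r_prev, r_k, r_x, r_c, r_h}"
  "writes test_pair = {r_out, r_cdeg, r_ccount, r_label, r_skip, r_total, r_walk, r_prev, r_k, r_x, r_c, r_h}"
  "writes test_row = {r_out, r_cdeg, r_ccount, r_label, r_skip, r_total, r_walk, r_prev, r_k, r_x, r_c, r_h, r_v}"
  "writes find_candidate = {r_out, r_cdeg, r_ccount, r_label, r_skip, r_total, r_walk, r_prev, r_k, r_x, r_c, r_h,
     r_u, r_v, r_i}"
  "writes check_degrees = {r_ok, r_u}"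
  "writes check_demands = {r_ok, r_i}"
  "writes verify_candidate = {r_out, r_ok, r_u, r_i}"
  "writes try_weight = {r_out, r_cdeg, r_ccount, r_label, r_skip, r_total, r_walk, r_prev, r_k, r_x, r_c, r_h,
     r_u, r_v, r_i, r_ok}"
  by (auto simp: xor_into_def extend_walk_def extend_walks_def start_walk_row_def fill_walk_row_def walk_table_def
      add_walk_row_def add_vertex_def parity_table_def collect_edge_def clear_candidate_def test_edge_def
      test_pair_def test_row_def find_candidate_def check_degrees_def check_demands_def
      verify_candidate_def try_weight_def)

section \<open>Correctness of the set-up\<close>

lemma ceillog2_le_self: "ceillog2 n \<le> n"
  using less_exp[of n] by (cases "n = 0") (simp_all add: ceillog2_le_iff less_imp_le)

context factor_instance
begin

definition demand_pos :: "mem \<Rightarrow> nat" where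
  "demand_pos s = 2 + n * n + (if s r_in 0 = 0 then 0 else n)"

definition holds_input :: "mem \<Rightarrow> bool" where
  "holds_input s \<longleftrightarrow> s r_in 1 = n \<and> (\<forall>u<n. \<forall>v<n. s r_in (2 + (u * n + v)) = label u v) \<and>
     (\<forall>u<n. d u = (if s r_in 0 = 0 then 1 else s r_in (2 + n * n + u))) \<and>
     s r_in (demand_pos s) = c \<and>
     (\<forall>i<c. s r_in (demand_pos s + 1 + (i + i)) + 2 = tag i \<and> s r_in (demand_pos s + 2 + (i + i)) = dem i)"

definition instance_read :: "mem \<Rightarrow> bool" where
  "instance_read s \<longleftrightarrow> holds_input s \<and> s r_n 0 = n \<and> s r_nsq 0 = n * n \<and> (\<forall>u<n. s r_row u = u * n) \<and>
     (\<forall>u<n. s r_deg u = d u) \<and> s r_dptr 0 = demand_pos s"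

lemma supported_on_holds_input: "supported_on {r_in} holds_input"
  by (simp add: supported_on_def holds_input_def demand_pos_def)

lemma supported_on_instance_read: "supported_on {r_in, r_n, r_nsq, r_row, r_deg, r_dptr} instance_read"
  by (simp add: supported_on_def instance_read_def holds_input_def demand_pos_def)

lemmas frame_instance_read = frame_supported_on[OF supported_on_instance_read]
lemmas instance_read_upd [simp] = supported_on_upd[OF supported_on_instance_read]

lemma instance_readD:
  assumes "instance_read s"
  shows "s r_n 0 = n" "s r_nsq 0 = n * n" "u < n \<Longrightarrow> s r_row u = u * n" "u < n \<Longrightarrow> s r_deg u = d u"
    and "u < n \<Longrightarrow> v < n \<Longrightarrow> s r_in (2 + (u * n + v)) = label u v"
  using assms by (auto simp: instance_read_def holds_input_def)

lemma aval_demand_number: "instance_read s \<Longrightarrow> aval demand_number s = c"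
  by (simp add: instance_read_def holds_input_def)

lemma aval_demand_tag: "instance_read s \<Longrightarrow> s r_i 0 = i \<Longrightarrow> i < c \<Longrightarrow> aval demand_tag s = tag i"
  by (simp add: instance_read_def holds_input_def)

lemma aval_demand_value: "instance_read s \<Longrightarrow> s r_i 0 = i \<Longrightarrow> i < c \<Longrightarrow> aval demand_value s = dem i"
  by (simp add: instance_read_def holds_input_def)

lemma wp_read_size:
  assumes "s r_in 1 = n" "n \<le> B"
  shows "wp B read_size (\<lambda>s' \<omega>'. s' r_n 0 = n \<and> s' r_nsq 0 = n * n \<and> (\<forall>u<n. s' r_row u = u * n)) s \<omega>"
  unfolding read_size_def
proof (intro wp_Seq wp_Store,
    rule wp_For[where n = n and I = "\<lambda>k s' \<omega>'. s' r_n 0 = n \<and> s' r_nsq 0 = k * n \<and>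
        (\<forall>u<k. s' r_row u = u * n)"],
    goal_cases init step exit)
  case (step k s' \<omega>')
  then show ?case by (intro wp_Seq wp_Store) (auto simp: less_Suc_eq)
qed (use assms in auto)

lemma wp_read_degrees:
  assumes "holds_input s" "s r_n 0 = n" "s r_nsq 0 = n * n" "n \<le> B"
  shows "wp B read_degrees (\<lambda>s' \<omega>'. (\<forall>u<n. s' r_deg u = d u) \<and> s' r_dptr 0 = demand_pos s) s \<omega>"
  unfolding read_degrees_def
proof (rule wp_Seq, rule wp_For[where n = n and I = "\<lambda>k s' \<omega>'. \<forall>u<k. s' r_deg u = d u"],
    goal_cases init step exit)
  case (step k s1 \<omega>1)
  have "s1 r_in = s r_in" "s1 r_nsq 0 = n * n" using frameD[OF step(2)] assms(3) by simp_all
  then show ?case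
    using step assms(1) by (intro wp_Cond wp_Store) (auto simp: holds_input_def less_Suc_eq)
next
  case (exit s1 \<omega>1)
  have "s1 r_in = s r_in" "s1 r_n 0 = n" "s1 r_nsq 0 = n * n"
    using frameD[OF exit(1)] assms(2,3) by simp_all
  then show ?case
    using exit(3) by (intro wp_Cond wp_Store) (simp_all add: demand_pos_def)
qed (use assms in simp_all)

lemma wp_read_instance:
  assumes "holds_input s" "n \<le> B"
  shows "wp B read_instance (\<lambda>s' \<omega>'. instance_read s') s \<omega>"
  unfolding read_instance_def
proof (rule wp_Seq_frame[OF wp_read_size])
  show "s r_in 1 = n" using assms(1) by (simp add: holds_input_def)
  fix s1 \<omega>1
  assume frame: "frame read_size s \<omega> s1 \<omega>1"
    and size: "s1 r_n 0 = n \<and> s1 r_nsq 0 = n * n \<and> (\<forall>u<n. s1 r_row u = u * n)"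
  have input: "holds_input s1" by (rule frame_supported_on[OF supported_on_holds_input assms(1) frame]) simp
  show "wp B read_degrees (\<lambda>s' \<omega>'. instance_read s') s1 \<omega>1"
  proof (rule wp_mono[OF wp_read_degrees[OF input _ _ assms(2)]])
    fix s2 \<omega>2
    assume frame: "frame read_degrees s1 \<omega>1 s2 \<omega>2"
      and degrees: "(\<forall>u<n. s2 r_deg u = d u) \<and> s2 r_dptr 0 = demand_pos s1"
    have "holds_input s2" by (rule frame_supported_on[OF supported_on_holds_input input frame]) simp
    then show "instance_read s2"
      using frame size degrees by (simp add: instance_read_def demand_pos_def frameD)
  qed (use size in auto)
qed (rule assms(2))

definition edges_at :: "(nat \<times> nat \<times> nat) list \<Rightarrow> mem \<Rightarrow> bool" where
  "edges_at ks s \<longleftrightarrow> s r_edges 0 = length ks \<and>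
     (\<forall>k<length ks. s r_src k = fst (ks ! k) \<and> s r_dst k = fst (snd (ks ! k)) \<and>
       s r_charge k = charge (ks ! k))"

lemma supported_on_edges_at: "supported_on {r_src, r_dst, r_charge, r_edges} (edges_at ks)"
  by (simp add: supported_on_def edges_at_def)

lemmas frame_edges_at = frame_supported_on[OF supported_on_edges_at]
lemmas edges_at_upd [simp] = supported_on_upd[OF supported_on_edges_at]

lemma wp_push_edge:
  assumes "edges_at ks s" "aval a s = fst k" "aval b s = fst (snd k)" "aval q s = charge k"
    and "reads b \<inter> {r_src, r_dst, r_charge, r_edges} = {}" "reads q \<inter> {r_src, r_dst, r_charge, r_edges} = {}"
  shows "wp B (push_edge a b q) (\<lambda>s' \<omega>'. edges_at (ks @ [k]) s') s \<omega>"
proof -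
  have "aval b (upd s r_src i v) = aval b s" for i v
    by (rule aval_cong) (use assms(5) in \<open>auto simp: upd_def\<close>)
  moreover have "aval q (upd (upd s r_src i v) r_dst i' v') = aval q s" for i v i' v'
    by (rule aval_cong) (use assms(6) in \<open>auto simp: upd_def\<close>)
  ultimately show ?thesis
    unfolding push_edge_def
    by (intro wp_Seq wp_Store) (use assms(1-4) in \<open>auto simp: edges_at_def nth_append less_Suc_eq\<close>)
qed

definition core_star_list :: "nat \<Rightarrow> nat \<Rightarrow> (nat \<times> nat \<times> nat) list" where
  "core_star_list u i = map (core_edge u i) [0..<n]"

definition vertex_core_list :: "nat \<Rightarrow> (nat \<times> nat \<times> nat) list" where
  "vertex_core_list u = concat (map (core_star_list u) [0..<n - d u])"

definition core_list :: "(nat \<times> nat \<times> nat) list" where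
  "core_list = concat (map vertex_core_list [0..<n])"

definition port_pair_list :: "nat \<Rightarrow> nat \<Rightarrow> (nat \<times> nat \<times> nat) list" where
  "port_pair_list u v = (if label u v = 0 then [] else [port_edge (u, v) 0, port_edge (u, v) 1])"

definition vertex_port_list :: "nat \<Rightarrow> (nat \<times> nat \<times> nat) list" where
  "vertex_port_list u = concat (map (port_pair_list u) [0..<u])"

definition port_list :: "(nat \<times> nat \<times> nat) list" where
  "port_list = concat (map vertex_port_list [0..<n])"

definition gadget_list :: "(nat \<times> nat \<times> nat) list" where
  "gadget_list = core_list @ port_list"

lemma wp_push_core_star:
  assumes read: "instance_read s" and ks: "edges_at ks s" and "s r_u 0 = u" "s r_i 0 = i" "u < n" "n \<le> B"
  shows "wp B push_core_star (\<lambda>s' \<omega>'. edges_at (ks @ core_star_list u i) s') s \<omega>"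
  unfolding push_core_star_def
proof (rule wp_For[where n = n and I = "\<lambda>v s' \<omega>'. edges_at (ks @ map (core_edge u i) [0..<v]) s'"],
    goal_cases init step exit)
  case (step v s1 \<omega>1)
  have "instance_read s1" by (rule frame_instance_read[OF read step(2)]) simp
  note read1 = instance_readD[OF this]
  have "s1 r_u 0 = u" "s1 r_i 0 = i" using assms frameD[OF step(2)] by simp_all
  then have "wp B (push_edge (Plus (var r_nsq) (Plus (Fetch r_row (var r_u)) (var r_i))) pair_index (Const 2))
      (\<lambda>s' \<omega>'. edges_at ((ks @ map (core_edge u i) [0..<v]) @ [core_edge u i v]) s') s1 \<omega>1"
    using step(3,4) assms(5) read1
    by (intro wp_push_edge) (simp_all add: core_edge_def[of u i v] core_def port_def charge_def)
  then show ?case by (rule wp_mono) simp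
qed (use assms instance_readD[OF read] in \<open>simp_all add: core_star_list_def\<close>)

lemma wp_push_vertex_cores:
  assumes read: "instance_read s" and ks: "edges_at ks s" and "s r_u 0 = u" "u < n" "n \<le> B"
  shows "wp B push_vertex_cores
    (\<lambda>s' \<omega>'. edges_at (ks @ vertex_core_list u) s' \<and> s' r_order 0 = s r_order 0 + (n - d u)) s \<omega>"
  unfolding push_vertex_cores_def
proof (rule wp_For[where n = "n - d u" and I = "\<lambda>i s' \<omega>'.
    edges_at (ks @ concat (map (core_star_list u) [0..<i])) s' \<and> s' r_order 0 = s r_order 0 + i"],
    goal_cases init step exit)
  case (step i s1 \<omega>1)
  have "instance_read s1" by (rule frame_instance_read[OF read step(2)]) simp
  moreover have "s1 r_u 0 = u" using assms frameD[OF step(2)] by simp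
  ultimately have "wp B push_core_star
      (\<lambda>s' \<omega>'. edges_at ((ks @ concat (map (core_star_list u) [0..<i])) @ core_star_list u i) s') s1 \<omega>1"
    using step assms by (intro wp_push_core_star) simp_all
  then show ?case
  proof (rule wp_Seq_frame)
    fix s2 \<omega>2
    assume "frame push_core_star s1 \<omega>1 s2 \<omega>2"
      and "edges_at ((ks @ concat (map (core_star_list u) [0..<i])) @ core_star_list u i) s2"
    then show "wp B (r_order ::= Plus (var r_order) (Const 1)) (\<lambda>s' \<omega>'.
        edges_at (ks @ concat (map (core_star_list u) [0..<Suc i])) (upd s' r_i 0 (Suc i)) \<and>
        upd s' r_i 0 (Suc i) r_order 0 = s r_order 0 + Suc i) s2 \<omega>2"
      using step(4) by (intro wp_Store) (simp add: frameD)
  qed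
qed (use assms instance_readD[OF read] in \<open>simp_all add: vertex_core_list_def\<close>)

lemma wp_push_core_edges:
  assumes read: "instance_read s" and "n \<le> B"
  shows "wp B push_core_edges (\<lambda>s' \<omega>'. edges_at core_list s' \<and> s' r_order 0 = gadget_order) s \<omega>"
  unfolding push_core_edges_def
proof (intro wp_Seq wp_Store, rule wp_For[where n = n and I = "\<lambda>u s' \<omega>'.
    edges_at (concat (map vertex_core_list [0..<u])) s' \<and> s' r_order 0 = n * n + (\<Sum>u<u. n - d u)"],
    goal_cases init step exit)
  case (step u s1 \<omega>1)
  have "instance_read s1" by (rule frame_instance_read[OF _ step(2)]) (use read in simp_all)
  then have "wp B push_vertex_cores
      (\<lambda>s' \<omega>'. edges_at (concat (map vertex_core_list [0..<u]) @ vertex_core_list u) s' \<and>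
      s' r_order 0 = s1 r_order 0 + (n - d u)) s1 \<omega>1"
    using step assms by (intro wp_push_vertex_cores) simp_all
  then show ?case by (rule wp_mono) (use step(4) in simp)
qed (use assms instance_readD[OF read] in \<open>simp_all add: edges_at_def core_list_def gadget_order_def\<close>)

definition label_charge_below :: "nat \<Rightarrow> nat \<Rightarrow> nat" where
  "label_charge_below k l = (\<Sum>i | i < k \<and> tag i = l. class_charge i)"

lemma label_charge_below_0: "label_charge_below 0 = (\<lambda>_. 0)"
  by (simp add: label_charge_below_def fun_eq_iff)

lemma label_charge_below_c: "label_charge_below c = label_charge"
  by (simp add: label_charge_below_def label_charge_def fun_eq_iff)

lemma label_charge_below_Suc:
  assumes "k < c"
  shows "label_charge_below (Suc k) = (label_charge_below k)(tag k := class_charge k)"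
proof
  fix l
  have "{i. i < Suc k \<and> tag i = tag k} = {k}"
    using inj_tag assms by (auto simp: inj_on_def less_Suc_eq)
  moreover have "{i. i < Suc k \<and> tag i = l} = {i. i < k \<and> tag i = l}" if "l \<noteq> tag k"
    using that by (auto simp: less_Suc_eq)
  ultimately show "label_charge_below (Suc k) l = ((label_charge_below k)(tag k := class_charge k)) l"
    by (simp add: label_charge_below_def)
qed

lemma wp_charge_class:
  assumes read: "instance_read s" and base: "s r_base 0 = gadget_order + 1" "s r_order 0 = gadget_order"
    and k: "s r_i 0 = k" "k < c"
      and place: "s r_place 0 = (gadget_order + 1) * (gadget_order + 1) * place k"
    and B: "gadget_order \<le> B"
  shows "wp B charge_class (\<lambda>s' \<omega>'. s' r_place 0 = (gadget_order + 1) * (gadget_order + 1) * place (Suc k) \<and>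
    s' r_target 0 = s r_target 0 + demand_cap k * class_charge k \<and>
    s' r_lcharge = (s r_lcharge)(tag k := class_charge k)) s \<omega>"
proof -
  let ?QQ = "(gadget_order + 1) * (gadget_order + 1)"
  note dem = aval_demand_tag[OF read k] aval_demand_value[OF read k]
  have step: "gadget_order + 1 + ?QQ * place k = class_charge k" by (simp add: class_charge_def)
  have cap: "dem k - (dem k - gadget_order) = demand_cap k" by (simp add: demand_cap_def)
  show ?thesis
    unfolding charge_class_def
  proof (intro wp_Seq wp_Store, rule wp_For[where n = "demand_cap k" and I = "\<lambda>t s' \<omega>'.
      s' r_place 0 = ?QQ * place k * (t + 1) \<and> s' r_target 0 = s r_target 0 + t * class_charge k"],
      goal_cases init pass exit writes reads count bound)
    case (pass t s1 \<omega>1)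
    have "s1 r_step 0 = class_charge k" "s1 r_old 0 = ?QQ * place k"
      using frameD[OF pass(2)] base place step by simp_all
    then show ?case using pass(4) by (intro wp_Seq wp_Store) (simp add: algebra_simps)
  next
    case (exit s1 \<omega>1)
    have "s1 r_lcharge = (s r_lcharge)(tag k := class_charge k)"
      using frameD[OF exit(1)] dem(1) base place step by (simp add: fun_upd_def)
    then show ?case using exit(3) by (simp add: place_Suc algebra_simps)
  next
    case count
    then show ?case using dem(2) base(2) cap by simp
  next
    case bound
    then show ?case using B by (simp add: demand_cap_def)
  qed (use place in auto)
qed

lemma wp_charge_labels:
  assumes read: "instance_read s" and order: "s r_order 0 = gadget_order" and init: "s r_lcharge = (\<lambda>_. 0)"
    and B: "gadget_order + 1 \<le> B" "c \<le> B"
  shows "wp B charge_labels (\<lambda>s' \<omega>'. s' r_lcharge = label_charge \<and> s' r_target 0 = target_charge) s \<omega>"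
  unfolding charge_labels_def
proof (intro wp_Seq wp_Store, rule wp_For[where n = "gadget_order + 1" and
    I = "\<lambda>t s' \<omega>'. s' r_place 0 = t * (gadget_order + 1)"], goal_cases init step exit)
  case (step t s1 \<omega>1)
  then show ?case using frameD[OF step(2)] order by (intro wp_Store) simp
next
  case (exit s1 \<omega>1)
  let ?QQ = "(gadget_order + 1) * (gadget_order + 1)"
  have read1: "instance_read s1" by (rule frame_instance_read[OF _ exit(1)]) (use read in simp_all)
  have s1: "s1 r_base 0 = gadget_order + 1" "s1 r_place 0 = ?QQ" "s1 r_order 0 = gadget_order"
      "s1 r_lcharge = (\<lambda>_. 0)"
    using frameD[OF exit(1)] exit(3) order init by simp_all
  show ?case
  proof (rule wp_Seq, rule wp_Store, rule wp_For[where n = c and I = "\<lambda>k s' \<omega>'. s' r_place 0 = ?QQ * place k \<and>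
      s' r_target 0 = gadget_order + (\<Sum>i<k. demand_cap i * class_charge i) \<and>
        s' r_lcharge = label_charge_below k"],
      goal_cases init step exit)
    case (step k s2 \<omega>2)
    have "instance_read s2" by (rule frame_instance_read[OF _ step(2)]) (use read1 in simp_all)
    moreover have "s2 r_base 0 = gadget_order + 1" "s2 r_order 0 = gadget_order"
      using frameD[OF step(2)] s1 by simp_all
    ultimately show ?case
      by (intro wp_mono[OF wp_charge_class[of s2 k]])
        (use step B in \<open>simp_all add: label_charge_below_Suc fun_upd_def\<close>)
  qed (use s1 B aval_demand_number[OF read1] in
      \<open>simp_all add: place_0 target_charge_def label_charge_below_0 label_charge_below_c\<close>)
qed (use order B in auto)

lemma wp_push_port_pair:
  assumes read: "instance_read s" and ks: "edges_at ks s" and charges: "s r_lcharge = label_charge"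
    and uv: "s r_u 0 = u" "s r_v 0 = v" "v < u" "u < n"
  shows "wp B push_port_pair (\<lambda>s' \<omega>'. edges_at (ks @ port_pair_list u v) s') s \<omega>"
  unfolding push_port_pair_def
proof (intro wp_Seq[of B "_ ::= _"] wp_Store wp_Cond, goal_cases no_edge edge)
  case no_edge
  then show ?case using ks instance_readD[OF read] uv by (intro wp_Skip) (simp add: port_pair_list_def)
next
  case edge
  let ?s = "upd s r_label (aval (Const 0) s) (aval (Fetch r_in (Plus (Const 2) pair_index)) s)"
  have read1: "instance_read ?s" using read by simp
  have label: "?s r_label 0 = label u v" "label u v \<noteq> 0" using edge uv instance_readD[OF read] by simp_all
  have "wp B (push_edge pair_index reversed_pair_index (Const 2))
      (\<lambda>s' \<omega>'. edges_at (ks @ [port_edge (u, v) 0]) s') ?s \<omega>"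
    using ks uv instance_readD[OF read]
    by (intro wp_push_edge) (simp_all add: port_edge_def port_def charge_def)
  then show ?case
  proof (rule wp_Seq_frame)
    fix s1 \<omega>1
    assume frame: "frame (push_edge pair_index reversed_pair_index (Const 2)) ?s \<omega> s1 \<omega>1"
      and ks1: "edges_at (ks @ [port_edge (u, v) 0]) s1"
    have "instance_read s1" by (rule frame_instance_read[OF read1 frame]) simp
    moreover have "s1 r_u 0 = u" "s1 r_v 0 = v" "s1 r_label 0 = label u v" "s1 r_lcharge = label_charge"
      using frameD[OF frame] uv label charges by simp_all
    ultimately have "wp B
        (push_edge pair_index reversed_pair_index (Plus (Const 2) (Fetch r_lcharge (var r_label))))
        (\<lambda>s' \<omega>'. edges_at ((ks @ [port_edge (u, v) 0]) @ [port_edge (u, v) 1]) s') s1 \<omega>1"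
      using ks1 uv instance_readD
      by (intro wp_push_edge) (simp_all add: charge_port_edge, simp_all add: port_edge_def port_def)
    then show "wp B (push_edge pair_index reversed_pair_index (Plus (Const 2) (Fetch r_lcharge (var r_label))))
        (\<lambda>s' \<omega>'. edges_at (ks @ port_pair_list u v) s') s1 \<omega>1"
      by (rule wp_mono) (use label(2) in \<open>simp add: port_pair_list_def\<close>)
  qed
qed

lemma wp_push_vertex_ports:
  assumes read: "instance_read s" and ks: "edges_at ks s" and charges: "s r_lcharge = label_charge"
    and u: "s r_u 0 = u" "u < n" and B: "n \<le> B"
  shows "wp B push_vertex_ports (\<lambda>s' \<omega>'. edges_at (ks @ vertex_port_list u) s') s \<omega>"
  unfolding push_vertex_ports_def
proof (rule wp_For[where n = u and I = "\<lambda>v s' \<omega>'. edges_at (ks @ concat (map (port_pair_list u) [0..<v])) s'"],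
    goal_cases init step exit)
  case (step v s1 \<omega>1)
  have "instance_read s1" by (rule frame_instance_read[OF read step(2)]) simp
  moreover have "s1 r_lcharge = label_charge" "s1 r_u 0 = u" using frameD[OF step(2)] charges u by simp_all
  ultimately have "wp B push_port_pair
      (\<lambda>s' \<omega>'. edges_at ((ks @ concat (map (port_pair_list u) [0..<v])) @ port_pair_list u v) s') s1 \<omega>1"
    using step u by (intro wp_push_port_pair) simp_all
  then show ?case by (rule wp_mono) simp
qed (use ks u B in \<open>simp_all add: vertex_port_list_def\<close>)

lemma wp_push_port_edges:
  assumes read: "instance_read s" and charges: "s r_lcharge = label_charge" and ks: "edges_at core_list s"
    and B: "n \<le> B"
  shows "wp B push_port_edges (\<lambda>s' \<omega>'. edges_at gadget_list s') s \<omega>"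
  unfolding push_port_edges_def
proof (rule wp_For[where n = n and
    I = "\<lambda>u s' \<omega>'. edges_at (core_list @ concat (map vertex_port_list [0..<u])) s'"],
    goal_cases init step exit)
  case (step u s1 \<omega>1)
  have "instance_read s1" by (rule frame_instance_read[OF read step(2)]) simp
  moreover have "s1 r_lcharge = label_charge" using frameD[OF step(2)] charges by simp
  ultimately have "wp B push_vertex_ports
      (\<lambda>s' \<omega>'. edges_at ((core_list @ concat (map vertex_port_list [0..<u])) @ vertex_port_list u) s') s1 \<omega>1"
    using step B by (intro wp_push_vertex_ports) simp_all
  then show ?case by (rule wp_mono) simp
qed (use ks B instance_readD[OF read] in \<open>simp_all add: gadget_list_def port_list_def\<close>)

lemma wp_build_gadget:
  assumes read: "instance_read s" and "s r_lcharge = (\<lambda>_. 0)" and B: "n \<le> B" "gadget_order + 1 \<le> B" "c \<le> B"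
  shows "wp B build_gadget (\<lambda>s' \<omega>'. edges_at gadget_list s' \<and> s' r_target 0 = target_charge) s \<omega>"
  unfolding build_gadget_def
proof (rule wp_Seq_frame[OF wp_push_core_edges[OF read B(1)]])
  fix s1 \<omega>1
  assume frame: "frame push_core_edges s \<omega> s1 \<omega>1"
    and core: "edges_at core_list s1 \<and> s1 r_order 0 = gadget_order"
  have read1: "instance_read s1" by (rule frame_instance_read[OF read frame]) simp
  have "s1 r_lcharge = (\<lambda>_. 0)" using frameD[OF frame] assms(2) by simp
  then have "wp B charge_labels (\<lambda>s' \<omega>'. s' r_lcharge = label_charge \<and> s' r_target 0 = target_charge) s1 \<omega>1"
    using core B by (intro wp_charge_labels[OF read1]) simp_all
  then show "wp B (charge_labels ;; push_port_edges)
      (\<lambda>s' \<omega>'. edges_at gadget_list s' \<and> s' r_target 0 = target_charge) s1 \<omega>1"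
  proof (rule wp_Seq_frame)
    fix s2 \<omega>2
    assume frame: "frame charge_labels s1 \<omega>1 s2 \<omega>2"
      and charges: "s2 r_lcharge = label_charge \<and> s2 r_target 0 = target_charge"
    have "instance_read s2" by (rule frame_instance_read[OF read1 frame]) simp
    moreover have "edges_at core_list s2" by (rule frame_edges_at[OF _ frame]) (use core in simp_all)
    ultimately have "wp B push_port_edges (\<lambda>s' \<omega>'. edges_at gadget_list s') s2 \<omega>2"
      using charges B by (intro wp_push_port_edges) simp_all
    then show "wp B push_port_edges (\<lambda>s' \<omega>'. edges_at gadget_list s' \<and> s' r_target 0 = target_charge) s2 \<omega>2"
      by (rule wp_mono) (use charges in \<open>simp add: frameD\<close>)
  qed
qed

definition nbits :: nat where
  "nbits = ceillog2 (n * length gadget_list)"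

definition modulus :: nat where
  "modulus = length gadget_list * 2 ^ nbits + 1"

lemma wp_compute_bits:
  assumes s: "s r_n 0 = n" "s r_edges 0 = length gadget_list" and B: "n \<le> B" "n * length gadget_list \<le> B"
  shows "wp B compute_bits (\<lambda>s' \<omega>'. s' r_bits 0 = nbits \<and> s' r_range 0 = 2 ^ nbits) s \<omega>"
  unfolding compute_bits_def
proof (rule wp_Seq, rule wp_Store, rule wp_Seq,
    rule wp_For[where n = n and I = "\<lambda>i s' \<omega>'. s' r_bound 0 = i * length gadget_list"],
    goal_cases init step exit)
  case (step i s1 \<omega>1)
  then show ?case using frameD[OF step(2)] s by (intro wp_Store) simp
next
  case (exit s1 \<omega>1)
  let ?L = "n * length gadget_list"
  show ?case
  proof (intro wp_Seq wp_Store, rule wp_For[where n = ?L and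
      I = "\<lambda>i s' \<omega>'. s' r_bits 0 = min i (ceillog2 ?L) \<and> s' r_range 0 = 2 ^ min i (ceillog2 ?L)"],
      goal_cases init step exit)
    case (step i s2 \<omega>2)
    have "s2 r_bound 0 = ?L" using frameD[OF step(2)] exit(3) by simp
    moreover have "ceillog2 ?L \<le> i \<longleftrightarrow> ?L \<le> 2 ^ i" by (rule ceillog2_le_iff[OF le_less_trans[OF le0 step(1)]])
    moreover have "?L \<le> 2 ^ ceillog2 ?L" by (rule le_two_power_ceillog2)
    ultimately show ?case
      using step(4) by (intro wp_Cond wp_Seq wp_Store wp_Skip) (auto simp: min_def not_le split: if_splits)
  next
    case (exit s2 \<omega>2)
    then show ?case using ceillog2_le_self[of ?L] by (simp add: nbits_def min_absorb2)
  qed (use exit(3) B in auto)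
qed (use s B in auto)

lemma wp_compute_modulus:
  assumes "s r_edges 0 = length gadget_list" "s r_range 0 = 2 ^ nbits" "length gadget_list \<le> B"
  shows "wp B compute_modulus (\<lambda>s' \<omega>'. s' r_modulus 0 = modulus) s \<omega>"
  unfolding compute_modulus_def
proof (rule wp_Seq, rule wp_Store, rule wp_For[where n = "length gadget_list" and
    I = "\<lambda>i s' \<omega>'. s' r_modulus 0 = i * 2 ^ nbits + 1"], goal_cases init step exit)
  case (step k s1 \<omega>1)
  then show ?case using frameD[OF step(2)] assms(2) by (intro wp_Store) simp
qed (use assms in \<open>auto simp: modulus_def\<close>)

lemma wp_choose_modulus:
  assumes "s r_n 0 = n" "s r_edges 0 = length gadget_list"
    and B: "n \<le> B" "n * length gadget_list \<le> B" "length gadget_list \<le> B"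
  shows "wp B choose_modulus (\<lambda>s' \<omega>'. s' r_bits 0 = nbits \<and> s' r_modulus 0 = modulus) s \<omega>"
  unfolding choose_modulus_def
proof (rule wp_Seq_frame)
  show "wp B compute_bits (\<lambda>s' \<omega>'. s' r_bits 0 = nbits \<and> s' r_range 0 = 2 ^ nbits) s \<omega>"
    using assms by (intro wp_compute_bits)
  fix s1 \<omega>1
  assume frame: "frame compute_bits s \<omega> s1 \<omega>1" and bits: "s1 r_bits 0 = nbits \<and> s1 r_range 0 = 2 ^ nbits"
  have "wp B compute_modulus (\<lambda>s' \<omega>'. s' r_modulus 0 = modulus) s1 \<omega>1"
    using frameD[OF frame] assms bits by (intro wp_compute_modulus) simp_all
  then show "wp B compute_modulus (\<lambda>s' \<omega>'. s' r_bits 0 = nbits \<and> s' r_modulus 0 = modulus) s1 \<omega>1"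
    by (rule wp_mono) (use bits in \<open>simp add: frameD\<close>)
qed

definition random_weight :: "bool list \<Rightarrow> nat \<Rightarrow> nat" where
  "random_weight bs k = bits_value (block nbits k bs)"

definition weight :: "bool list \<Rightarrow> nat \<Rightarrow> nat" where
  "weight bs k = random_weight bs k + modulus * charge (gadget_list ! k)"

definition tape_prefix :: "bool stream \<Rightarrow> bool list" where
  "tape_prefix \<omega> = stake (length gadget_list * nbits) \<omega>"

lemma random_weight_tape_prefix:
  "k < length gadget_list \<Longrightarrow> random_weight (tape_prefix \<omega>) k = bits_value (stake nbits (sdrop (k * nbits) \<omega>))"
  by (simp add: random_weight_def tape_prefix_def block_stake)

lemma wp_draw_bits:
  assumes "s r_bits 0 = m" "m \<le> B"
  shows "wp B draw_bits (\<lambda>s' \<omega>'. \<omega>' = sdrop m \<omega> \<and> s' r_acc 0 = bits_value (stake m \<omega>)) s \<omega>"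
  unfolding draw_bits_def
proof (rule wp_Seq, rule wp_Store, rule wp_For[where n = m and
    I = "\<lambda>i s' \<omega>'. \<omega>' = sdrop i \<omega> \<and> s' r_acc 0 = bits_value (stake i \<omega>)"], goal_cases init step exit)
  case (step i s1 \<omega>1)
  then show ?case by (intro wp_Seq wp_Flip wp_Store) (simp add: sdrop_simps stake_Suc del: stake.simps)
qed (use assms in auto)

lemma wp_draw_weight:
  assumes s: "s r_k 0 = k" "k < length gadget_list" "s r_charge k = charge (gadget_list ! k)" "s r_bits 0 = nbits"
      "s r_modulus 0 = modulus" and \<omega>': "\<omega>' = sdrop (k * nbits) \<omega>"
    and B: "nbits \<le> B" "charge (gadget_list ! k) \<le> B"
  shows "wp B draw_weight (\<lambda>s' \<omega>'. \<omega>' = sdrop (Suc k * nbits) \<omega> \<and>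
    s' r_weight = (s r_weight)(k := weight (tape_prefix \<omega>) k)) s \<omega>'"
  unfolding draw_weight_def
proof (rule wp_Seq_frame[OF wp_draw_bits[where s = s, OF s(4) B(1)]])
  fix s1 \<omega>1
  assume frame: "frame draw_bits s \<omega>' s1 \<omega>1"
    and bits: "\<omega>1 = sdrop nbits \<omega>' \<and> s1 r_acc 0 = bits_value (stake nbits \<omega>')"
  have s1: "s1 r_k 0 = k" "s1 r_charge = s r_charge" "s1 r_modulus 0 = modulus" "s1 r_weight = s r_weight"
    using frameD[OF frame] s by simp_all
  show "wp B (For r_t (Fetch r_charge (var r_k)) (r_acc ::= Plus (var r_acc) (var r_modulus)) ;;
      Store r_weight (var r_k) (var r_acc))
    (\<lambda>s' \<omega>'. \<omega>' = sdrop (Suc k * nbits) \<omega> \<and>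
      s' r_weight = (s r_weight)(k := weight (tape_prefix \<omega>) k)) s1 \<omega>1"
  proof (rule wp_Seq, rule wp_For[where n = "charge (gadget_list ! k)" and
      I = "\<lambda>t s' \<omega>'. s' r_acc 0 = random_weight (tape_prefix \<omega>) k + modulus * t"],
      goal_cases init step exit)
    case (step t s2 \<omega>2)
    then show ?case using frameD[OF step(2)] s1 by (intro wp_Store) simp
  next
    case (exit s2 \<omega>2)
    have "s2 r_k 0 = k" "s2 r_weight = s r_weight" using frameD[OF exit(1)] s1 by simp_all
    moreover have "\<omega>2 = sdrop (Suc k * nbits) \<omega>"
      using frame_tape[OF exit(1)] bits \<omega>' by (simp add: add.commute)
    ultimately show ?case using exit(3) by (intro wp_Store) (simp add: weight_def)
  qed (use s s1 B bits \<omega>' in \<open>auto simp: random_weight_tape_prefix\<close>)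
qed

lemma wp_draw_weights:
  assumes ks: "edges_at gadget_list s" and s: "s r_bits 0 = nbits" "s r_modulus 0 = modulus"
    and B: "length gadget_list \<le> B" "nbits \<le> B" "\<And>k. k < length gadget_list \<Longrightarrow> charge (gadget_list ! k) \<le> B"
  shows "wp B draw_weights (\<lambda>s' \<omega>'. \<forall>k<length gadget_list. s' r_weight k = weight (tape_prefix \<omega>) k) s \<omega>"
  unfolding draw_weights_def
proof (rule wp_For[where n = "length gadget_list" and I = "\<lambda>k s' \<omega>'. \<omega>' = sdrop (k * nbits) \<omega> \<and>
    (\<forall>k'<k. s' r_weight k' = weight (tape_prefix \<omega>) k')"], goal_cases init step exit)
  case (step k s1 \<omega>1)
  have "s1 r_charge k = charge (gadget_list ! k)" "s1 r_bits 0 = nbits" "s1 r_modulus 0 = modulus"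
    using frameD[OF step(2)] step(1) ks s by (simp_all add: edges_at_def)
  then have "wp B draw_weight (\<lambda>s' \<omega>'. \<omega>' = sdrop (Suc k * nbits) \<omega> \<and>
      s' r_weight = (s1 r_weight)(k := weight (tape_prefix \<omega>) k)) s1 \<omega>1"
    using step B by (intro wp_draw_weight) simp_all
  then show ?case by (rule wp_mono) (use step(4) in \<open>auto simp: less_Suc_eq\<close>)
qed (use ks B in \<open>auto simp: edges_at_def\<close>)

definition tables_laid_out :: "mem \<Rightarrow> bool" where
  "tables_laid_out s \<longleftrightarrow> s r_low 0 = modulus * target_charge \<and> s r_max 0 = modulus * (target_charge + 1) \<and>
     s r_verts 0 = 2 * (n * n) \<and> (\<forall>x<modulus * (target_charge + 1). s r_xrow x = x * (2 * (n * n)))"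

lemma wp_lay_out_tables:
  assumes s: "s r_target 0 = target_charge" "s r_modulus 0 = modulus" "s r_nsq 0 = n * n"
    and B: "target_charge \<le> B" "modulus * (target_charge + 1) \<le> B"
  shows "wp B lay_out_tables (\<lambda>s' \<omega>'. tables_laid_out s') s \<omega>"
  unfolding lay_out_tables_def
proof (rule wp_Seq, rule wp_Store, rule wp_Seq,
    rule wp_For[where n = target_charge and I = "\<lambda>t s' \<omega>'. s' r_low 0 = modulus * t"],
    goal_cases init step exit)
  case (step t s1 \<omega>1)
  then show ?case using frameD[OF step(2)] s by (intro wp_Store) simp
next
  case (exit s1 \<omega>1)
  have s1: "s1 r_modulus 0 = modulus" "s1 r_low 0 = modulus * target_charge" "s1 r_nsq 0 = n * n"
    using frameD[OF exit(1)] s exit(3) by simp_all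
  show ?case
  proof (intro wp_Seq wp_Store, rule wp_For[where n = "modulus * (target_charge + 1)" and I = "\<lambda>k s' \<omega>'.
      s' r_acc 0 = k * (2 * (n * n)) \<and> (\<forall>x<k. s' r_xrow x = x * (2 * (n * n)))"], goal_cases init step exit)
    case (step k s2 \<omega>2)
    then show ?case using frameD[OF step(2)] s1 by (intro wp_Seq wp_Store) (auto simp: less_Suc_eq)
  next
    case (exit s2 \<omega>2)
    then show ?case using frameD[OF exit(1)] s1 by (simp add: tables_laid_out_def)
  qed (use s1 B in auto)
qed (use s B in auto)

definition ready :: "bool list \<Rightarrow> mem \<Rightarrow> bool" where
  "ready bs s \<longleftrightarrow> instance_read s \<and> edges_at gadget_list s \<and> s r_modulus 0 = modulus \<and> tables_laid_out s \<and>
     (\<forall>k<length gadget_list. s r_weight k = weight bs k)"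

lemma wp_lay_out_tables_ready:
  assumes read: "instance_read s" and ks: "edges_at gadget_list s"
    and s: "s r_target 0 = target_charge" "s r_modulus 0 = modulus"
    and weights: "\<forall>k<length gadget_list. s r_weight k = weight bs k"
    and B: "target_charge \<le> B" "modulus * (target_charge + 1) \<le> B"
  shows "wp B lay_out_tables (\<lambda>s' \<omega>'. ready bs s') s \<omega>"
proof (rule wp_mono)
  show "wp B lay_out_tables (\<lambda>s' \<omega>'. tables_laid_out s') s \<omega>"
    using s instance_readD(2)[OF read] B by (intro wp_lay_out_tables) simp_all
next
  fix s' \<omega>'
  assume frame: "frame lay_out_tables s \<omega> s' \<omega>'" and "tables_laid_out s'"
  moreover have "instance_read s'" "edges_at gadget_list s'"
    by (rule frame_instance_read[OF read frame] frame_edges_at[OF ks frame], simp)+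
  ultimately show "ready bs s'" using s(2) weights by (simp add: ready_def frameD)
qed

lemma wp_weigh_gadget:
  assumes read: "instance_read s" and ks: "edges_at gadget_list s"
    and target: "s r_target 0 = target_charge"
    and B: "n \<le> B" "n * length gadget_list \<le> B" "length gadget_list \<le> B" "nbits \<le> B"
      "\<And>k. k < length gadget_list \<Longrightarrow> charge (gadget_list ! k) \<le> B"
      "target_charge \<le> B" "modulus * (target_charge + 1) \<le> B"
  shows "wp B weigh_gadget (\<lambda>s' \<omega>'. ready (tape_prefix \<omega>) s') s \<omega>"
proof -
  have "wp B choose_modulus (\<lambda>s' \<omega>'. s' r_bits 0 = nbits \<and> s' r_modulus 0 = modulus) s \<omega>"
    using instance_readD(1)[OF read] ks B(1-3) by (intro wp_choose_modulus) (simp_all add: edges_at_def)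
  then show ?thesis
    unfolding weigh_gadget_def
  proof (rule wp_Seq_frame)
    fix s1 \<omega>1
    assume frame1: "frame choose_modulus s \<omega> s1 \<omega>1"
      and bits: "s1 r_bits 0 = nbits \<and> s1 r_modulus 0 = modulus"
    have tape: "\<omega>1 = \<omega>" using frame_tape[OF frame1] by simp
    have "edges_at gadget_list s1" by (rule frame_edges_at[OF ks frame1]) simp
    then have "wp B draw_weights
        (\<lambda>s' \<omega>'. \<forall>k<length gadget_list. s' r_weight k = weight (tape_prefix \<omega>1) k) s1 \<omega>1"
      using bits B(3-5) by (intro wp_draw_weights) simp_all
    then show "wp B (draw_weights ;; lay_out_tables) (\<lambda>s' \<omega>'. ready (tape_prefix \<omega>) s') s1 \<omega>1"
      unfolding tape
    proof (rule wp_Seq_frame)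
      fix s2 \<omega>2
      assume "frame draw_weights s1 \<omega> s2 \<omega>2"
        and weights: "\<forall>k<length gadget_list. s2 r_weight k = weight (tape_prefix \<omega>) k"
      then have frame: "frame (choose_modulus ;; draw_weights) s \<omega> s2 \<omega>2"
        and modulus: "s2 r_modulus 0 = modulus"
        using frame_Seq[OF frame1] bits by (simp_all add: tape frameD)
      have "instance_read s2" "edges_at gadget_list s2"
        by (rule frame_instance_read[OF read frame] frame_edges_at[OF ks frame], simp)+
      then show "wp B lay_out_tables (\<lambda>s' \<omega>'. ready (tape_prefix \<omega>) s') s2 \<omega>2"
        using frameD[OF frame] target modulus weights B(6,7)
        by (intro wp_lay_out_tables_ready) simp_all
    qed
  qed
qed

end

section \<open>Correctness of the parity tables\<close>

lemma truncated_xor: "(a :: nat) < 2 \<Longrightarrow> b < 2 \<Longrightarrow> (a - b) + (b - a) = (a + b) mod 2"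
  by (auto simp: less_2_cases_iff)

locale walk_tables =
  fixes m V X q :: nat and sr ds wt :: "nat \<Rightarrow> nat"
  assumes sr_less: "k < m \<Longrightarrow> sr k < V" and ds_less: "k < m \<Longrightarrow> ds k < V"
    and sr_neq_ds: "k < m \<Longrightarrow> sr k \<noteq> ds k" and wt_pos: "k < m \<Longrightarrow> 0 < wt k"
begin

definition kept :: "nat set" where
  "kept = {k. k < m \<and> sr k \<noteq> q}"

sublocale weighted_multigraph kept sr ds wt
  by unfold_locales (auto simp: kept_def sr_neq_ds wt_pos)

abbreviation walks :: "nat \<Rightarrow> nat \<Rightarrow> nat \<Rightarrow> nat" where
  "walks h \<equiv> walk_count (matching_count h) h"

definition loaded :: "mem \<Rightarrow> bool" where
  "loaded s \<longleftrightarrow> s r_edges 0 = m \<and> s r_max 0 = X \<and> s r_verts 0 = V \<and> s r_skip 0 = q \<and>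
     (\<forall>x<X. s r_xrow x = x * V) \<and> (\<forall>k<m. s r_src k = sr k \<and> s r_dst k = ds k \<and> s r_weight k = wt k)"

lemma supported_on_loaded:
  "supported_on {r_edges, r_max, r_verts, r_skip, r_xrow, r_src, r_dst, r_weight} loaded"
  by (simp add: supported_on_def loaded_def)

lemmas frame_loaded = frame_supported_on[OF supported_on_loaded]
lemmas loaded_upd [simp] = supported_on_upd[OF supported_on_loaded]

definition holds_rows :: "(nat \<Rightarrow> nat \<Rightarrow> nat) \<Rightarrow> nat \<Rightarrow> mem \<Rightarrow> bool" where
  "holds_rows T k s \<longleftrightarrow> (\<forall>x<k. \<forall>a<V. s r_walk (x * V + a) = T x a mod 2)"

lemma supported_on_holds_rows: "supported_on {r_walk} (holds_rows T k)"
  by (simp add: supported_on_def holds_rows_def)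

lemmas frame_holds_rows = frame_supported_on[OF supported_on_holds_rows]
lemmas holds_rows_upd [simp] = supported_on_upd[OF supported_on_holds_rows]

lemma holds_rows_cong:
  "(\<And>x a. x < k \<Longrightarrow> T x a = T' x a) \<Longrightarrow> holds_rows T k s \<longleftrightarrow> holds_rows T' k s"
  by (simp add: holds_rows_def)

lemma wp_extend_walk:
  assumes T: "holds_rows T X s" and "s r_k 0 = j" "s r_x 0 = x" "s r_h 0 = h" "s r_xrow x = x * V"
    and "s r_prev 0 = y * V" "s p j = a" "s p' j = b" and bounds: "a < V" "b < V" "x < X" "y < X"
  shows "wp B (extend_walk p p')
    (\<lambda>s' \<omega>'. holds_rows (if b < h then T(x := (T x)(b := T x b + T y a)) else T) X s') s \<omega>"
proof (cases "b < h")
  case True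
  let ?T = "T(x := (T x)(b := T x b + T y a))"
  let ?s = "upd s r_walk (x * V + b) ((T x b + T y a) mod 2)"
  have cell: "s r_walk (x' * V + a') = T x' a' mod 2" if "x' < X" "a' < V" for x' a'
    using T that by (simp add: holds_rows_def)
  have "holds_rows ?T X ?s"
    using bounds by (simp add: holds_rows_def cell mult_add_eq_iff)
  moreover have "T x b mod 2 - T y a mod 2 + (T y a mod 2 - T x b mod 2) = (T x b + T y a) mod 2"
    by (subst truncated_xor) (simp_all add: mod_add_eq)
  ultimately show ?thesis
    unfolding extend_walk_def xor_into_def using assms True
    by (intro wp_Cond wp_Store wp_Skip) (simp_all add: cell)
next
  case False
  then show ?thesis
    unfolding extend_walk_def using assms by (intro wp_Cond wp_Skip) simp_all
qed

definition contribution :: "nat \<Rightarrow> nat \<Rightarrow> nat \<Rightarrow> nat \<Rightarrow> nat" where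
  "contribution h x k a = (if a < h \<and> wt k \<le> x then
     (if ds k = a then walks h (x - wt k) (sr k) else 0) +
     (if sr k = a then walks h (x - wt k) (ds k) else 0) else 0)"

definition partial_walks :: "nat \<Rightarrow> nat \<Rightarrow> nat \<Rightarrow> nat \<Rightarrow> nat" where
  "partial_walks h x j a =
     (if a = h then matching_count h x else 0) + (\<Sum>k | k < j \<and> sr k \<noteq> q. contribution h x k a)"

definition row_table :: "nat \<Rightarrow> nat \<Rightarrow> nat \<Rightarrow> nat \<Rightarrow> nat \<Rightarrow> nat" where
  "row_table h x j y a = (if y < x then walks h y a else if y = x then partial_walks h x j a
     else if a = h then matching_count h y else 0)"

lemma partial_walks_0: "partial_walks h x 0 a = (if a = h then matching_count h x else 0)"
  by (simp add: partial_walks_def)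

lemma partial_walks_Suc:
  "partial_walks h x (Suc j) a = partial_walks h x j a + (if sr j \<noteq> q then contribution h x j a else 0)"
proof -
  have "{k. k < Suc j \<and> sr k \<noteq> q} =
      (if sr j \<noteq> q then insert j {k. k < j \<and> sr k \<noteq> q} else {k. k < j \<and> sr k \<noteq> q})"
    by (auto simp: less_Suc_eq)
  then show ?thesis by (simp add: partial_walks_def)
qed

lemma partial_walks_all: "partial_walks h x m a = walks h x a"
  unfolding partial_walks_def contribution_def kept_def[symmetric] walk_count.simps[of _ h x a] ..

lemma row_table_start: "row_table h 0 0 y a = (if a = h then matching_count h y else 0)"
  by (simp add: row_table_def partial_walks_0)

lemma row_table_next: "row_table h x m = row_table h (Suc x) 0"
  by (auto simp: row_table_def fun_eq_iff less_Suc_eq partial_walks_0 partial_walks_all)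

lemma row_table_skip:
  assumes "\<not> (sr j \<noteq> q \<and> wt j \<le> x)"
  shows "row_table h x (Suc j) = row_table h x j"
  using assms by (auto simp: row_table_def fun_eq_iff partial_walks_Suc contribution_def)

lemma row_table_extend:
  fixes h x j :: nat
  assumes j: "j < m" "sr j \<noteq> q" "wt j \<le> x"
  defines "T \<equiv> row_table h x j" and "y \<equiv> x - wt j"
  defines "T' \<equiv> if ds j < h then T(x := (T x)(ds j := T x (ds j) + T y (sr j))) else T"
  shows "(if sr j < h then T'(x := (T' x)(sr j := T' x (sr j) + T' y (ds j))) else T')
    = row_table h x (Suc j)"
proof -
  have "y < x" using wt_pos[OF j(1)] j(3) by (simp add: y_def)
  then have T_y: "T y = walks h y" and T'_y: "T' y = walks h y"
    by (auto simp: T'_def T_def row_table_def fun_eq_iff)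
  have T_x: "T x = partial_walks h x j" by (simp add: T_def row_table_def fun_eq_iff)
  have other_rows: "row_table h x (Suc j) z = T z" if "z \<noteq> x" for z
    using that by (simp add: T_def row_table_def fun_eq_iff)
  have row_x: "row_table h x (Suc j) x a = T x a +
      (if a < h
       then (if ds j = a then walks h y (sr j) else 0) + (if sr j = a then walks h y (ds j) else 0)
       else 0)" for a
    using j by (simp add: T_x row_table_def partial_walks_Suc contribution_def y_def)
  show ?thesis (is "?T'' = _")
  proof (intro ext)
    fix z a
    show "?T'' z a = row_table h x (Suc j) z a"
      using row_x[of a] other_rows[of z] T_y T'_y sr_neq_ds[OF j(1)] by (cases "z = x") (auto simp: T'_def)
  qed
qed

lemma wp_extend_walks:
  assumes l: "loaded s" and rows: "holds_rows (row_table h x j) X s" and j: "j < m" "x < X"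
    and s: "s r_k 0 = j" "s r_x 0 = x" "s r_h 0 = h"
  shows "wp B extend_walks (\<lambda>s' \<omega>'. holds_rows (row_table h x (Suc j)) X s') s \<omega>"
proof (cases "sr j \<noteq> q \<and> wt j \<le> x")
  case False
  then show ?thesis
    unfolding extend_walks_def using l rows j s row_table_skip[OF False, of h]
    by (intro wp_Cond wp_Skip) (auto simp: loaded_def)
next
  case True
  have "wp B (r_prev ::= Fetch r_xrow (Minus (var r_x) (Fetch r_weight (var r_k))) ;;
      extend_walk r_src r_dst ;; extend_walk r_dst r_src)
      (\<lambda>s' \<omega>'. holds_rows (row_table h x (Suc j)) X s') s \<omega>"
  proof (rule wp_Seq, rule wp_Store)
    let ?y = "x - wt j" and ?T = "row_table h x j"
    let ?T' = "if ds j < h then ?T(x := (?T x)(ds j := ?T x (ds j) + ?T ?y (sr j))) else ?T"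
    let ?s = "upd s r_prev (aval (Const 0) s) (aval (Fetch r_xrow (Minus (var r_x) (Fetch r_weight (var r_k)))) s)"
    have prev: "?s r_prev 0 = ?y * V" using l j s by (simp add: loaded_def)
    have "wp B (extend_walk r_src r_dst) (\<lambda>s' \<omega>'. holds_rows ?T' X s') ?s \<omega>"
      by (rule wp_extend_walk[where j = j])
        (use l rows j s prev sr_less ds_less in \<open>auto simp: loaded_def\<close>)
    then show "wp B (extend_walk r_src r_dst ;; extend_walk r_dst r_src)
        (\<lambda>s' \<omega>'. holds_rows (row_table h x (Suc j)) X s') ?s \<omega>"
    proof (rule wp_Seq_frame)
      fix s1 \<omega>1
      assume frame: "frame (extend_walk r_src r_dst) ?s \<omega> s1 \<omega>1" and rows1: "holds_rows ?T' X s1"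
      have l1: "loaded s1" by (rule frame_loaded[OF _ frame]) (use l in simp_all)
      have s1: "s1 r_k 0 = j" "s1 r_x 0 = x" "s1 r_h 0 = h" "s1 r_prev 0 = ?y * V"
        using frameD[OF frame] s prev by simp_all
      show "wp B (extend_walk r_dst r_src) (\<lambda>s' \<omega>'. holds_rows (row_table h x (Suc j)) X s') s1 \<omega>1"
        unfolding row_table_extend[OF j(1) conjunct1[OF True] conjunct2[OF True], of h, symmetric]
        by (rule wp_extend_walk[OF rows1, where j = j])
          (use l1 j s1 sr_less ds_less in \<open>auto simp: loaded_def\<close>)
    qed
  qed
  then show ?thesis
    unfolding extend_walks_def using l j s True by (intro wp_Cond wp_Skip) (auto simp: loaded_def)
qed

lemma wp_start_walk_row:
  assumes l: "loaded s" and rows: "holds_rows (row_table h 0 0) x s" and x: "s r_x 0 = x" "x < X"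
    and h: "s r_h 0 = h" "h < V" and total: "s r_total x = matching_count h x mod 2" and B: "V \<le> B"
  shows "wp B start_walk_row (\<lambda>s' \<omega>'. holds_rows (row_table h 0 0) (Suc x) s') s \<omega>"
  unfolding start_walk_row_def
proof (rule wp_Seq, rule wp_For[where n = V and I = "\<lambda>j s' \<omega>'. holds_rows (row_table h 0 0) x s' \<and>
    (\<forall>a<j. s' r_walk (x * V + a) = 0)"], goal_cases init step exit)
  case (step j s1 \<omega>1)
  have "s1 r_x 0 = x" "s1 r_xrow x = x * V"
    using frameD[OF step(2)] x l by (simp_all add: loaded_def)
  then show ?case
    using step by (intro wp_Store) (auto simp: holds_rows_def mult_add_eq_iff less_Suc_eq)
next
  case (exit s1 \<omega>1)
  have "s1 r_x 0 = x" "s1 r_xrow x = x * V" "s1 r_total x = matching_count h x mod 2" "s1 r_h 0 = h"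
    using frameD[OF exit(1)] x h total l by (simp_all add: loaded_def)
  then show ?case
    using exit(3) h(2)
    by (intro wp_Store) (auto simp: holds_rows_def mult_add_eq_iff less_Suc_eq row_table_start)
qed (use rows l B in \<open>auto simp: loaded_def\<close>)

lemma wp_fill_walk_row:
  assumes l: "loaded s" and rows: "holds_rows (row_table h x 0) X s" and x: "s r_x 0 = x" "x < X"
    and h: "s r_h 0 = h" and B: "m \<le> B"
  shows "wp B fill_walk_row (\<lambda>s' \<omega>'. holds_rows (row_table h (Suc x) 0) X s') s \<omega>"
  unfolding fill_walk_row_def
proof (rule wp_For[where n = m and I = "\<lambda>j s' \<omega>'. holds_rows (row_table h x j) X s'"],
    goal_cases init step exit)
  case (step j s1 \<omega>1)
  have "loaded s1" by (rule frame_loaded[OF l step(2)]) simp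
  moreover have "s1 r_x 0 = x" "s1 r_h 0 = h" using frameD[OF step(2)] x h by simp_all
  ultimately have "wp B extend_walks (\<lambda>s' \<omega>'. holds_rows (row_table h x (Suc j)) X s') s1 \<omega>1"
    using step x by (intro wp_extend_walks) simp_all
  then show ?case by (rule wp_mono) simp
qed (use rows l B in \<open>auto simp: loaded_def row_table_next\<close>)

lemma wp_walk_table:
  assumes l: "loaded s" and total: "\<And>x. x < X \<Longrightarrow> s r_total x = matching_count h x mod 2"
    and h: "s r_h 0 = h" "h < V" and B: "X \<le> B" "V \<le> B" "m \<le> B"
  shows "wp B walk_table (\<lambda>s' \<omega>'. holds_rows (walks h) X s') s \<omega>"
  unfolding walk_table_def
proof (rule wp_Seq, rule wp_For[where n = X and I = "\<lambda>x s' \<omega>'. holds_rows (row_table h 0 0) x s'"],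
    goal_cases init step exit)
  case (step x s1 \<omega>1)
  have "loaded s1" by (rule frame_loaded[OF l step(2)]) simp
  moreover have "s1 r_h 0 = h" "s1 r_total x = matching_count h x mod 2"
    using frameD[OF step(2)] h total step(1) by simp_all
  ultimately have "wp B start_walk_row (\<lambda>s' \<omega>'. holds_rows (row_table h 0 0) (Suc x) s') s1 \<omega>1"
    using step h B by (intro wp_start_walk_row) simp_all
  then show ?case by (rule wp_mono) simp
next
  case (exit s1 \<omega>1)
  have l1: "loaded s1" by (rule frame_loaded[OF l exit(1)]) simp
  have h1: "s1 r_h 0 = h" using frameD[OF exit(1)] h by simp
  show ?case
  proof (rule wp_For[where n = X and I = "\<lambda>x s' \<omega>'. holds_rows (row_table h x 0) X s'"],
      goal_cases init step exit)
    case init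
    then show ?case using exit by simp
  next
    case (step x s2 \<omega>2)
    have "loaded s2" by (rule frame_loaded[OF l1 step(2)]) simp
    moreover have "s2 r_h 0 = h" using frameD[OF step(2)] h1 by simp
    ultimately have "wp B fill_walk_row (\<lambda>s' \<omega>'. holds_rows (row_table h (Suc x) 0) X s') s2 \<omega>2"
      using step B by (intro wp_fill_walk_row) simp_all
    then show ?case by (rule wp_mono) simp
  next
    case (exit s2 \<omega>2)
    then show ?case using holds_rows_cong[of X "row_table h X 0" "walks h" s2] by (simp add: row_table_def)
  qed (use l1 B in \<open>auto simp: loaded_def\<close>)
qed (use l B in \<open>auto simp: loaded_def holds_rows_def\<close>)

lemma wp_add_walk_row:
  assumes l: "loaded s" and rows: "holds_rows (walks h) X s" and x: "s r_x 0 = x" "x < X"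
    and h: "s r_h 0 = h" "h < V" and total: "s r_total x = matching_count h x mod 2" and B: "V \<le> B"
  shows "wp B add_walk_row (\<lambda>s' \<omega>'. s' r_total = (s r_total)(x := matching_count (Suc h) x mod 2)) s \<omega>"
  unfolding add_walk_row_def
proof (rule wp_For[where n = h and I = "\<lambda>j s' \<omega>'.
    s' r_total = (s r_total)(x := (matching_count h x + (\<Sum>a<j. walks h x a)) mod 2)"],
    goal_cases init step exit)
  case (step j s1 \<omega>1)
  have regs: "s1 r_x 0 = x" "s1 r_xrow x = x * V" "s1 r_walk (x * V + j) = walks h x j mod 2"
    using frameD[OF step(2)] x l rows step(1) h(2) by (simp_all add: loaded_def holds_rows_def xor_into_def)
  let ?t = "matching_count h x + (\<Sum>a<j. walks h x a)"
  have "?t mod 2 - walks h x j mod 2 + (walks h x j mod 2 - ?t mod 2) = (?t + walks h x j) mod 2"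
    by (subst truncated_xor) (simp_all add: mod_add_eq)
  then show ?case
    unfolding xor_into_def using step(3,4) regs by (intro wp_Store) (simp add: add.assoc fun_eq_iff)
qed (use total h B in \<open>auto simp: xor_into_def fun_eq_iff\<close>)

lemma wp_add_vertex:
  assumes l: "loaded s" and total: "\<And>x. x < X \<Longrightarrow> s r_total x = matching_count h x mod 2"
    and h: "s r_h 0 = h" "h < V" and B: "X \<le> B" "V \<le> B" "m \<le> B"
  shows "wp B add_vertex (\<lambda>s' \<omega>'. \<forall>x<X. s' r_total x = matching_count (Suc h) x mod 2) s \<omega>"
  unfolding add_vertex_def
proof (rule wp_Seq_frame[OF wp_walk_table[OF l total h B]], assumption)
  fix s1 \<omega>1
  assume frame: "frame walk_table s \<omega> s1 \<omega>1" and rows: "holds_rows (walks h) X s1"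
  have l1: "loaded s1" by (rule frame_loaded[OF l frame]) simp
  have h1: "s1 r_h 0 = h" and total1: "s1 r_total = s r_total" using frameD[OF frame] h by simp_all
  show "wp B (For r_x (var r_max) add_walk_row)
      (\<lambda>s' \<omega>'. \<forall>x<X. s' r_total x = matching_count (Suc h) x mod 2) s1 \<omega>1"
  proof (rule wp_For[where n = X and I = "\<lambda>k s' \<omega>'. \<forall>x<X.
      s' r_total x = matching_count (if x < k then Suc h else h) x mod 2"], goal_cases init step exit)
    case (step k s2 \<omega>2)
    have "loaded s2" by (rule frame_loaded[OF l1 step(2)]) simp
    moreover have "holds_rows (walks h) X s2" by (rule frame_holds_rows[OF rows step(2)]) simp
    moreover have "s2 r_h 0 = h" using frameD[OF step(2)] h1 by simp
    ultimately have "wp B add_walk_row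
        (\<lambda>s' \<omega>'. s' r_total = (s2 r_total)(k := matching_count (Suc h) k mod 2)) s2 \<omega>2"
      using step h B by (intro wp_add_walk_row) simp_all
    then show ?case
      by (rule wp_mono) (use step(4) in \<open>auto simp: less_Suc_eq simp del: matching_count.simps\<close>)
  qed (use l1 total total1 B in \<open>auto simp: loaded_def\<close>)
qed

lemma wp_parity_table:
  assumes l: "loaded s" and B: "X \<le> B" "V \<le> B" "m \<le> B"
  shows "wp B parity_table (\<lambda>s' \<omega>'. \<forall>x<X. s' r_total x = matching_count V x mod 2) s \<omega>"
  unfolding parity_table_def
proof (rule wp_Seq, rule wp_For[where n = X and I = "\<lambda>k s' \<omega>'. \<forall>x<k. s' r_total x = 0"],
    goal_cases init step exit)
  case (step k s1 \<omega>1)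
  then show ?case by (intro wp_Store) (auto simp: less_Suc_eq)
next
  case (exit s1 \<omega>1)
  have l1: "loaded s1" by (rule frame_loaded[OF l exit(1)]) simp
  show ?case
  proof (rule wp_Seq, rule wp_Store, rule wp_For[where n = V and
      I = "\<lambda>h s' \<omega>'. \<forall>x<X. s' r_total x = matching_count h x mod 2"], goal_cases init step exit)
    case init
    then show ?case using exit(3) by simp
  next
    case (step h s2 \<omega>2)
    have "loaded s2" by (rule frame_loaded[OF _ step(2)]) (use l1 in simp_all)
    then have "wp B add_vertex (\<lambda>s' \<omega>'. \<forall>x<X. s' r_total x = matching_count (Suc h) x mod 2) s2 \<omega>2"
      using step B by (intro wp_add_vertex) simp_all
    then show ?case by (rule wp_mono) simp
  qed (use l1 B in \<open>auto simp: loaded_def\<close>)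
qed (use l B in \<open>auto simp: loaded_def\<close>)

end

section \<open>Correctness of the search\<close>

definition undirected :: "nat \<times> nat \<Rightarrow> nat set" where
  "undirected p = {fst p, snd p}"

definition lists_pairs :: "(nat \<Rightarrow> nat) \<Rightarrow> (nat \<times> nat) list \<Rightarrow> bool" where
  "lists_pairs A ps \<longleftrightarrow> A 1 = length ps \<and>
     (\<forall>i<length ps. A (2 * i + 2) = fst (ps ! i) \<and> A (2 * i + 3) = snd (ps ! i))"

lemma lists_pairs_snoc:
  assumes "lists_pairs A ps"
  defines "l \<equiv> length ps"
  shows "lists_pairs (A(l + l + 2 := u, l + l + 3 := v, 1 := l + 1)) (ps @ [(u, v)])"
proof -
  have "2 * i + 2 \<noteq> l + l + 3" "2 * i + 3 \<noteq> l + l + 2" for i :: nat by presburger+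
  then show ?thesis
    using assms(1) by (auto simp: lists_pairs_def nth_append l_def less_Suc_eq)
qed

lemma lists_pairs_imp_out_edges:
  assumes "lists_pairs (s r_out) ps" "s r_out 0 \<noteq> 0"
  shows "out_edges s = Some (undirected ` set ps)"
proof -
  have len: "s r_out 1 = length ps" using assms(1) by (simp add: lists_pairs_def)
  have "{{s r_out (2 * i + 2), s r_out (2 * i + 3)} | i. i < s r_out 1} =
      (\<lambda>i. {s r_out (2 * i + 2), s r_out (2 * i + 3)}) ` {..<length ps}"
    unfolding len by blast
  also have "\<dots> = (\<lambda>i. undirected (ps ! i)) ` {..<length ps}"
    using assms(1) by (intro image_cong) (simp_all add: lists_pairs_def undirected_def)
  also have "\<dots> = undirected ` set ps"
    unfolding set_conv_nth by auto
  finally show ?thesis using assms(2) by (simp add: out_edges_def)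
qed

lemma distinct_concat_map_upt:
  assumes "\<And>i. i < m \<Longrightarrow> distinct (f i)" "\<And>i j x. i < m \<Longrightarrow> j < m \<Longrightarrow> x \<in> set (f i) \<Longrightarrow> x \<in> set (f j) \<Longrightarrow> i = j"
  shows "distinct (concat (map f [0..<m]))"
  using assms
proof (induction m)
  case (Suc m)
  have "distinct (concat (map f [0..<m]))" using Suc.prems by (intro Suc.IH) (auto intro: less_SucI)
  moreover have "x \<notin> set (f m)" if "x \<in> set (f i)" "i < m" for x i
    using Suc.prems(2)[of i m x] that by auto
  ultimately show ?case using Suc.prems(1) by auto
qed simp

context factor_instance
begin

lemma set_gadget_list: "set gadget_list = gadget_edges"
proof -
  have "set core_list = core_edges"
    unfolding core_list_def vertex_core_list_def core_star_list_def core_edges_def by force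
  moreover have "set port_list = port_edges"
  proof (intro equalityI subsetI)
    fix k assume "k \<in> set port_list"
    then show "k \<in> port_edges"
      unfolding port_list_def vertex_port_list_def port_pair_list_def port_edges_def pairs_def
      by (force split: if_splits)
  next
    fix k assume "k \<in> port_edges"
    then obtain u v b where k: "k = port_edge (u, v) b" "v < u" "u < n" "label u v \<noteq> 0" "b < 2"
      unfolding port_edges_def pairs_def by blast
    then have "k \<in> set (port_pair_list u v)" by (auto simp: port_pair_list_def less_2_cases_iff)
    then have "k \<in> set (vertex_port_list u)" using k(2) by (force simp: vertex_port_list_def)
    then show "k \<in> set port_list" using k(3) by (force simp: port_list_def)
  qed
  ultimately show ?thesis by (simp add: gadget_list_def gadget_edges_def)
qed

lemma distinct_core_list: "distinct core_list"
proof -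
  have "distinct (core_star_list u i)" for u i
    unfolding core_star_list_def by (auto simp: distinct_map inj_on_def core_edge_def port_def)
  then have "distinct (vertex_core_list u)" for u
    unfolding vertex_core_list_def
    by (rule distinct_concat_map_upt) (auto simp: core_star_list_def core_edge_eq_iff)
  then show ?thesis
    unfolding core_list_def
    by (rule distinct_concat_map_upt) (auto simp: vertex_core_list_def core_star_list_def core_edge_eq_iff)
qed

lemma distinct_port_list: "distinct port_list"
proof -
  have "distinct (port_pair_list u v)" for u v by (simp add: port_pair_list_def port_edge_def)
  then have "distinct (vertex_port_list u)" for u
    unfolding vertex_port_list_def
    by (rule distinct_concat_map_upt) (auto simp: port_pair_list_def port_edge_def port_def split: if_splits)
  then show ?thesis
    unfolding port_list_def
    by (rule distinct_concat_map_upt)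
      (auto simp: vertex_port_list_def port_pair_list_def port_edge_def port_eq_iff split: if_splits)
qed

lemma distinct_gadget_list: "distinct gadget_list"
proof -
  have "port_edge (u', v') b \<noteq> core_edge u i v" if "u' < n" "v' < n" for u i v u' v' b
    using port_neq_core[OF that] by (simp add: core_edge_def port_edge_def)
  then have "set core_list \<inter> set port_list = {}"
    unfolding core_list_def vertex_core_list_def core_star_list_def port_list_def vertex_port_list_def
      port_pair_list_def by (auto split: if_splits)
  then show ?thesis by (simp add: gadget_list_def distinct_core_list distinct_port_list)
qed

abbreviation source :: "nat \<Rightarrow> nat" where "source k \<equiv> fst (gadget_list ! k)"
abbreviation sink :: "nat \<Rightarrow> nat" where "sink k \<equiv> fst (snd (gadget_list ! k))"

lemma gadget_edge_nth: "k < length gadget_list \<Longrightarrow> gadget_list ! k \<in> gadget_edges"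
  using set_gadget_list nth_mem by blast

lemma gadget_edge_bounds:
  assumes "k \<in> gadget_edges"
  shows "fst k < 2 * (n * n)" "fst (snd k) < 2 * (n * n)" "fst k \<noteq> fst (snd k)"
proof -
  have "gadget_vertices \<subseteq> {..<2 * (n * n)}"
    using port_less by (fastforce simp: gadget_vertices_def core_def)
  then show "fst k < 2 * (n * n)" "fst (snd k) < 2 * (n * n)"
    using gadget_ends_vertices(1)[OF assms] by (auto simp: gadget_ends_def)
  show "fst k \<noteq> fst (snd k)"
    using gadget_ends_vertices(2)[OF assms] by (auto simp: gadget_ends_def)
qed

lemma weight_pos: "0 < weight bs k"
  by (simp add: weight_def modulus_def charge_def)

lemma walk_tables_gadget:
  "walk_tables (length gadget_list) (2 * (n * n)) source sink (weight bs)"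
  by unfold_locales (auto simp: gadget_edge_bounds gadget_edge_nth weight_pos modulus_def)

text \<open>Both copies of a port edge have the same source, so that leaving out a source excludes the pair.\<close>

definition avoiding_edges :: "nat \<times> nat \<Rightarrow> nat set" where
  "avoiding_edges p = {k. k < length gadget_list \<and> source k \<noteq> port (fst p) (snd p)}"

definition avoiding_count :: "bool list \<Rightarrow> nat \<Rightarrow> nat \<times> nat \<Rightarrow> nat" where
  "avoiding_count bs w p = weighted_multigraph.matching_count (avoiding_edges p) source sink (weight bs)
     (2 * (n * n)) (modulus * target_charge + w)"

definition candidate :: "bool list \<Rightarrow> nat \<Rightarrow> (nat \<times> nat) set" where
  "candidate bs w = {p \<in> pairs. even (avoiding_count bs w p)}"

definition candidate_below :: "bool list \<Rightarrow> nat \<Rightarrow> nat \<Rightarrow> nat \<Rightarrow> (nat \<times> nat) set" where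
  "candidate_below bs w u v = {p \<in> candidate bs w. fst p < u \<or> fst p = u \<and> snd p < v}"

lemma candidate_pairs: "candidate bs w \<subseteq> pairs"
  by (auto simp: candidate_def)

lemma finite_candidate_below: "finite (candidate_below bs w u v)"
  by (rule finite_subset[OF _ finite_pairs]) (auto simp: candidate_below_def candidate_def)

lemma candidate_below_0: "candidate_below bs w 0 0 = {}"
  by (simp add: candidate_below_def)

lemma candidate_below_Suc:
  "candidate_below bs w u (Suc v) =
     (if (u, v) \<in> candidate bs w then insert (u, v) (candidate_below bs w u v)
       else candidate_below bs w u v)"
  by (auto simp: candidate_below_def less_Suc_eq)

lemma candidate_below_next: "candidate_below bs w u u = candidate_below bs w (Suc u) 0"
  using candidate_pairs pairs_less(1) by (fastforce simp: candidate_below_def less_Suc_eq)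

lemma candidate_below_n: "candidate_below bs w n 0 = candidate bs w"
  using candidate_pairs pairs_less(2) by (fastforce simp: candidate_below_def)

lemma supported_on_ready:
  "supported_on {r_in, r_n, r_nsq, r_row, r_deg, r_dptr, r_src, r_dst, r_charge, r_edges, r_modulus, r_weight,
     r_low, r_max, r_verts, r_xrow} (ready bs)"
  by (simp add: supported_on_def ready_def instance_read_def holds_input_def demand_pos_def edges_at_def
      tables_laid_out_def)

lemmas frame_ready = frame_supported_on[OF supported_on_ready]
lemmas ready_upd [simp] = supported_on_upd[OF supported_on_ready]

lemma ready_imp_instance_read: "ready bs s \<Longrightarrow> instance_read s"
  by (simp add: ready_def)

definition collected :: "(nat \<times> nat) set \<Rightarrow> mem \<Rightarrow> bool" where
  "collected S s \<longleftrightarrow> (\<exists>ps. set ps = S \<and> lists_pairs (s r_out) ps) \<and>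
     (\<forall>u<n. s r_cdeg u = card (incident S u)) \<and> (\<forall>i<c. s r_ccount (tag i) = card (class_of S (tag i)))"

lemma supported_on_collected: "supported_on {r_out, r_cdeg, r_ccount} (collected S)"
  by (simp add: supported_on_def collected_def)

lemmas frame_collected = frame_supported_on[OF supported_on_collected]
lemmas collected_upd [simp] = supported_on_upd[OF supported_on_collected]

lemma card_incident_insert:
  assumes "finite S" "(u, v) \<notin> S" "u \<noteq> v"
  shows "card (incident (insert (u, v) S) x) = card (incident S x) + of_bool (x = u \<or> x = v)"
proof -
  have "incident (insert (u, v) S) x =
      (if x = u \<or> x = v then insert (u, v) (incident S x) else incident S x)"
    by (auto simp: incident_def)
  then show ?thesis using assms by (simp add: incident_def)
qed

lemma card_class_of_insert:
  assumes "finite S" "(u, v) \<notin> S"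
  shows "card (class_of (insert (u, v) S) l) = card (class_of S l) + of_bool (l = label u v)"
proof -
  have "class_of (insert (u, v) S) l =
      (if l = label u v then insert (u, v) (class_of S l) else class_of S l)"
    by (auto simp: class_of_def)
  then show ?thesis using assms by (simp add: class_of_def)
qed

lemma wp_collect_edge:
  assumes col: "collected S s" and fin: "finite S" and uv: "(u, v) \<notin> S" "v < u" "u < n"
    and s: "s r_u 0 = u" "s r_v 0 = v" "s r_label 0 = label u v"
  shows "wp B collect_edge (\<lambda>s' \<omega>'. collected (insert (u, v) S) s' \<and> s' r_out 0 = s r_out 0) s \<omega>"
proof -
  obtain ps where ps: "set ps = S" "lists_pairs (s r_out) ps" using col unfolding collected_def by blast
  define l where "l = length ps"
  have l: "s r_out 1 = l" using ps(2) by (simp add: lists_pairs_def l_def)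
  have "collected (insert (u, v) S) s'"
    if "s' r_out = (s r_out)(l + l + 2 := u, l + l + 3 := v, 1 := l + 1)"
      "s' r_cdeg = (s r_cdeg)(u := s r_cdeg u + 1, v := s r_cdeg v + 1)"
      "s' r_ccount = (s r_ccount)(label u v := s r_ccount (label u v) + 1)" for s'
    unfolding collected_def that
  proof (intro conjI)
    show "\<exists>qs. set qs = insert (u, v) S \<and>
        lists_pairs ((s r_out)(l + l + 2 := u, l + l + 3 := v, 1 := l + 1)) qs"
      using lists_pairs_snoc[OF ps(2), of u v] ps(1) unfolding l_def
      by (intro exI[of _ "ps @ [(u, v)]"]) simp
  qed (use col fin uv in \<open>auto simp: collected_def card_incident_insert card_class_of_insert\<close>)
  then show ?thesis
    unfolding collect_edge_def using s l uv
    by (intro wp_Seq wp_Store conjI) (simp_all add: fun_upd_def)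
qed

lemma wp_parity_table_gadget:
  assumes r: "ready bs s" and skip: "s r_skip 0 = port u v" and w: "w < modulus"
    and B: "length gadget_list \<le> B" "modulus * (target_charge + 1) \<le> B" "2 * (n * n) \<le> B"
  shows "wp B parity_table
    (\<lambda>s' \<omega>'. s' r_total (modulus * target_charge + w) = avoiding_count bs w (u, v) mod 2) s \<omega>"
proof -
  interpret walk_tables "length gadget_list" "2 * (n * n)" "modulus * (target_charge + 1)" "port u v"
      source sink "weight bs"
    by (rule walk_tables_gadget)
  have "loaded s" using r skip unfolding loaded_def ready_def edges_at_def tables_laid_out_def by blast
  then have "wp B parity_table
      (\<lambda>s' \<omega>'. \<forall>x<modulus * (target_charge + 1). s' r_total x = matching_count (2 * (n * n)) x mod 2) s \<omega>"
    using B by (intro wp_parity_table) simp_all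
  moreover have "kept = avoiding_edges (u, v)" by (simp add: kept_def avoiding_edges_def)
  ultimately show ?thesis using w by (elim wp_mono) (simp add: avoiding_count_def)
qed

lemma wp_test_edge:
  assumes r: "ready bs s" and col: "collected S s" and fin: "finite S" and uv: "(u, v) \<notin> S" "v < u" "u < n"
    and s: "s r_u 0 = u" "s r_v 0 = v" "s r_label 0 = label u v" "s r_w 0 = w" and w: "w < modulus"
    and B: "length gadget_list \<le> B" "modulus * (target_charge + 1) \<le> B" "2 * (n * n) \<le> B"
  shows "wp B test_edge
    (\<lambda>s' \<omega>'. collected (if even (avoiding_count bs w (u, v)) then insert (u, v) S else S) s' \<and>
      s' r_out 0 = s r_out 0) s \<omega>"
  unfolding test_edge_def
proof (rule wp_Seq, rule wp_Store)
  let ?s = "upd s r_skip (aval (Const 0) s) (aval pair_index s)"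
  let ?test = "Equal (Fetch r_total (Plus (var r_low) (var r_w))) (Const 0)"
  let ?post = "\<lambda>s' \<omega>'. collected (if even (avoiding_count bs w (u, v)) then insert (u, v) S else S) s' \<and>
    s' r_out 0 = s r_out 0"
  have "?s r_skip 0 = port u v"
    using s uv instance_readD[OF ready_imp_instance_read[OF r]] by (simp add: port_def)
  then have "wp B parity_table
      (\<lambda>s' \<omega>'. s' r_total (modulus * target_charge + w) = avoiding_count bs w (u, v) mod 2) ?s \<omega>"
    using r w B by (intro wp_parity_table_gadget) simp_all
  then show "wp B (parity_table ;; Cond ?test collect_edge Skip) ?post ?s \<omega>"
  proof (rule wp_Seq_frame)
    fix s1 \<omega>1
    assume frame: "frame parity_table ?s \<omega> s1 \<omega>1"
      and "s1 r_total (modulus * target_charge + w) = avoiding_count bs w (u, v) mod 2"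
    moreover have "s1 r_low 0 = modulus * target_charge" "s1 r_w 0 = w"
      using frameD[OF frame] r s by (simp_all add: ready_def tables_laid_out_def)
    ultimately have test: "bval ?test s1 \<longleftrightarrow> even (avoiding_count bs w (u, v))"
      by (simp add: even_iff_mod_2_eq_zero)
    have col1: "collected S s1" by (rule frame_collected[OF _ frame]) (use col in simp_all)
    have s1: "s1 r_u 0 = u" "s1 r_v 0 = v" "s1 r_label 0 = label u v" "s1 r_out 0 = s r_out 0"
      using frameD[OF frame] s by simp_all
    show "wp B (Cond ?test collect_edge Skip) ?post s1 \<omega>1"
    proof (rule wp_Cond; unfold test)
      assume "even (avoiding_count bs w (u, v))"
      then show "wp B collect_edge ?post s1 \<omega>1" using wp_collect_edge[OF col1 fin uv s1(1-3)] s1(4) by simp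
    qed (rule wp_Skip, use col1 s1(4) in simp)
  qed
qed

lemma wp_test_pair:
  assumes r: "ready bs s" and col: "collected S s" and "finite S" and uv: "(u, v) \<notin> S" "v < u" "u < n"
    and s: "s r_u 0 = u" "s r_v 0 = v" "s r_w 0 = w" and w: "w < modulus"
    and B: "length gadget_list \<le> B" "modulus * (target_charge + 1) \<le> B" "2 * (n * n) \<le> B"
  shows "wp B test_pair (\<lambda>s' \<omega>'. collected (if (u, v) \<in> candidate bs w then insert (u, v) S else S) s' \<and>
    s' r_out 0 = s r_out 0) s \<omega>"
  unfolding test_pair_def
proof (rule wp_Seq, rule wp_Store, rule wp_Cond)
  let ?s = "upd s r_label (aval (Const 0) s) (aval (Fetch r_in (Plus (Const 2) pair_index)) s)"
  let ?post = "\<lambda>s' \<omega>'. collected (if (u, v) \<in> candidate bs w then insert (u, v) S else S) s' \<and>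
      s' r_out 0 = s r_out 0"
  have label: "?s r_label 0 = label u v"
    using s uv instance_readD[OF ready_imp_instance_read[OF r]] by simp
  show "wp B Skip ?post ?s \<omega>" if "bval (Equal (var r_label) (Const 0)) ?s"
  proof -
    have "(u, v) \<notin> candidate bs w" using that label by (simp add: candidate_def pairs_def)
    then show ?thesis using col by (intro wp_Skip) simp
  qed
  show "wp B test_edge ?post ?s \<omega>" if "\<not> bval (Equal (var r_label) (Const 0)) ?s"
  proof -
    have "(u, v) \<in> candidate bs w \<longleftrightarrow> even (avoiding_count bs w (u, v))"
      using that label uv by (simp add: candidate_def pairs_def)
    then show ?thesis
      using wp_test_edge[of bs ?s S u v w B \<omega>] label assms by simp
  qed
qed

lemma wp_clear_candidate:
  assumes read: "instance_read s" and B: "n \<le> B" "c \<le> B"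
  shows "wp B clear_candidate (\<lambda>s' \<omega>'. collected {} s' \<and> s' r_out 0 = s r_out 0) s \<omega>"
  unfolding clear_candidate_def
proof (rule wp_Seq, rule wp_Store, rule wp_Seq, rule wp_For[where n = n and I = "\<lambda>k s' \<omega>'. \<forall>u<k. s' r_cdeg u = 0"],
    goal_cases init step exit)
  case (step k s1 \<omega>1)
  then show ?case by (intro wp_Store) (auto simp: less_Suc_eq)
next
  case (exit s1 \<omega>1)
  have read1: "instance_read s1" by (rule frame_instance_read[OF _ exit(1)]) (use read in simp_all)
  have out: "s1 r_out 1 = 0" "s1 r_out 0 = s r_out 0" using frameD[OF exit(1)] by simp_all
  show ?case
  proof (rule wp_For[where n = c and I = "\<lambda>k s' \<omega>'. \<forall>i<k. s' r_ccount (tag i) = 0"],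
    goal_cases init step exit)
    case (step k s2 \<omega>2)
    have "instance_read s2" by (rule frame_instance_read[OF read1 step(2)]) simp
    from aval_demand_tag[OF this step(3,1)] show ?case
      using step by (intro wp_Store) (auto simp: less_Suc_eq)
  next
    case (exit s2 \<omega>2)
    have "s2 r_out = s1 r_out" "s2 r_cdeg = s1 r_cdeg" using frameD[OF exit(1)] by simp_all
    moreover have "lists_pairs (s1 r_out) []" using out by (simp add: lists_pairs_def)
    ultimately show ?case
      using exit(3) \<open>\<forall>u<n. s1 r_cdeg u = 0\<close> out by (auto simp: collected_def incident_def class_of_def)
  qed (use aval_demand_number[OF read1] B in auto)
qed (use instance_readD[OF read] B in auto)

lemma wp_test_row:
  assumes r: "ready bs s" and col: "collected (candidate_below bs w u 0) s" and u: "s r_u 0 = u" "u < n"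
    and w: "s r_w 0 = w" "w < modulus"
    and B: "n \<le> B" "length gadget_list \<le> B" "modulus * (target_charge + 1) \<le> B" "2 * (n * n) \<le> B"
  shows "wp B test_row (\<lambda>s' \<omega>'. collected (candidate_below bs w (Suc u) 0) s' \<and> s' r_out 0 = s r_out 0) s \<omega>"
  unfolding test_row_def
proof (rule wp_For[where n = u and I = "\<lambda>v s' \<omega>'. collected (candidate_below bs w u v) s' \<and>
    s' r_out 0 = s r_out 0"],
    goal_cases init step exit)
  case (step v s1 \<omega>1)
  have "ready bs s1" by (rule frame_ready[OF r step(2)]) simp
  moreover have "s1 r_u 0 = u" "s1 r_w 0 = w" using frameD[OF step(2)] u w by simp_all
  moreover have "(u, v) \<notin> candidate_below bs w u v" by (simp add: candidate_below_def)
  ultimately have "wp B test_pair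
      (\<lambda>s' \<omega>'. collected (candidate_below bs w u (Suc v)) s' \<and> s' r_out 0 = s1 r_out 0) s1 \<omega>1"
    unfolding candidate_below_Suc using step u w B by (intro wp_test_pair finite_candidate_below) simp_all
  then show ?case by (rule wp_mono) (use step(4) in simp)
qed (use col u B in \<open>simp_all add: candidate_below_next\<close>)

lemma wp_find_candidate:
  assumes r: "ready bs s" and w: "s r_w 0 = w" "w < modulus"
    and B: "n \<le> B" "c \<le> B" "length gadget_list \<le> B" "modulus * (target_charge + 1) \<le> B" "2 * (n * n) \<le> B"
  shows "wp B find_candidate (\<lambda>s' \<omega>'. collected (candidate bs w) s' \<and> s' r_out 0 = s r_out 0) s \<omega>"
  unfolding find_candidate_def
proof (rule wp_Seq_frame[OF wp_clear_candidate[OF ready_imp_instance_read[OF r] B(1,2)]])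
  fix s1 \<omega>1
  assume frame: "frame clear_candidate s \<omega> s1 \<omega>1" and cleared: "collected {} s1 \<and> s1 r_out 0 = s r_out 0"
  have r1: "ready bs s1" by (rule frame_ready[OF r frame]) simp
  show "wp B (For r_u (var r_n) test_row)
      (\<lambda>s' \<omega>'. collected (candidate bs w) s' \<and> s' r_out 0 = s r_out 0) s1 \<omega>1"
  proof (rule wp_For[where n = n and
      I = "\<lambda>u s' \<omega>'. collected (candidate_below bs w u 0) s' \<and> s' r_out 0 = s r_out 0"],
    goal_cases init step exit)
    case (step u s2 \<omega>2)
    have "ready bs s2" by (rule frame_ready[OF r1 step(2)]) simp
    moreover have "s2 r_w 0 = w" using frameD[OF step(2)] frameD[OF frame] w by simp
    ultimately have "wp B test_row
        (\<lambda>s' \<omega>'. collected (candidate_below bs w (Suc u) 0) s' \<and> s' r_out 0 = s2 r_out 0) s2 \<omega>2"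
      using step w B by (intro wp_test_row) simp_all
    then show ?case by (rule wp_mono) (use step(4) in simp)
  qed (use cleared instance_readD[OF ready_imp_instance_read[OF r1]] B in
      \<open>simp_all add: candidate_below_0 candidate_below_n\<close>)
qed

lemma wp_check_degrees:
  assumes read: "instance_read s" and col: "collected S s" and ok: "s r_ok 0 = 1" and B: "n \<le> B"
  shows "wp B check_degrees (\<lambda>s' \<omega>'. s' r_ok 0 = of_bool (\<forall>u<n. card (incident S u) = d u)) s \<omega>"
  unfolding check_degrees_def
proof (rule wp_For[where n = n and I = "\<lambda>k s' \<omega>'. s' r_ok 0 = of_bool (\<forall>u<k. card (incident S u) = d u)"],
    goal_cases init step exit)
  case (step k s1 \<omega>1)
  have "s1 r_cdeg k = card (incident S k)" "s1 r_deg k = d k"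
    using frameD[OF step(2)] col read step(1) by (simp_all add: collected_def instance_read_def)
  then show ?case using step(3,4) by (intro wp_Cond wp_Skip wp_Store) (auto simp: less_Suc_eq)
qed (use instance_readD[OF read] ok B in auto)

lemma wp_check_demands:
  assumes read: "instance_read s" and col: "collected S s" and ok: "s r_ok 0 = of_bool b" and B: "c \<le> B"
  shows "wp B check_demands
    (\<lambda>s' \<omega>'. s' r_ok 0 = of_bool (b \<and> (\<forall>i<c. dem i \<le> card (class_of S (tag i))))) s \<omega>"
  unfolding check_demands_def
proof (rule wp_For[where n = c and
      I = "\<lambda>k s' \<omega>'. s' r_ok 0 = of_bool (b \<and> (\<forall>i<k. dem i \<le> card (class_of S (tag i))))"],
    goal_cases init step exit)
  case (step k s1 \<omega>1)
  have "instance_read s1" by (rule frame_instance_read[OF read step(2)]) simp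
  note dem = aval_demand_tag[OF this step(3,1)] aval_demand_value[OF this step(3,1)]
  have "s1 r_ccount (tag k) = card (class_of S (tag k))"
    using frameD[OF step(2)] col step(1) by (simp add: collected_def)
  then have "bval (Less (Fetch r_ccount demand_tag) demand_value) s1 \<longleftrightarrow> card (class_of S (tag k)) < dem k"
    using dem by simp
  then show ?case
    using step(4) by (intro wp_Cond wp_Skip wp_Store) (auto simp del: bval.simps simp: less_Suc_eq)
qed (use aval_demand_number[OF read] ok B in auto)

lemma wp_verify_candidate:
  assumes read: "instance_read s" and col: "collected S s" and S: "S \<subseteq> pairs" and B: "n \<le> B" "c \<le> B"
  shows "wp B verify_candidate (\<lambda>s' \<omega>'. s' r_out = (s r_out)(0 := of_bool (solution S))) s \<omega>"
  unfolding verify_candidate_def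
proof (rule wp_Seq, rule wp_Store)
  let ?s = "upd s r_ok (aval (Const 0) s) (aval (Const 1) s)"
  have "wp B check_degrees (\<lambda>s' \<omega>'. s' r_ok 0 = of_bool (\<forall>u<n. card (incident S u) = d u)) ?s \<omega>"
    using read col B by (intro wp_check_degrees) simp_all
  then show "wp B (check_degrees ;; check_demands ;; r_out ::= var r_ok)
      (\<lambda>s' \<omega>'. s' r_out = (s r_out)(0 := of_bool (solution S))) ?s \<omega>"
  proof (rule wp_Seq_frame)
    fix s1 \<omega>1
    assume frame1: "frame check_degrees ?s \<omega> s1 \<omega>1"
      and degrees: "s1 r_ok 0 = of_bool (\<forall>u<n. card (incident S u) = d u)"
    have read1: "instance_read s1" by (rule frame_instance_read[OF _ frame1]) (use read in simp_all)
    have col1: "collected S s1" by (rule frame_collected[OF _ frame1]) (use col in simp_all)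
    show "wp B (check_demands ;; r_out ::= var r_ok)
        (\<lambda>s' \<omega>'. s' r_out = (s r_out)(0 := of_bool (solution S))) s1 \<omega>1"
    proof (rule wp_Seq_frame[OF wp_check_demands[OF read1 col1 degrees B(2)]])
      fix s2 \<omega>2
      assume frame2: "frame check_demands s1 \<omega>1 s2 \<omega>2" and ok: "s2 r_ok 0 = of_bool
        ((\<forall>u<n. card (incident S u) = d u) \<and> (\<forall>i<c. dem i \<le> card (class_of S (tag i))))"
      have "s2 r_out = s r_out" using frameD[OF frame2] frameD[OF frame1] by simp
      then show "wp B (r_out ::= var r_ok) (\<lambda>s' \<omega>'. s' r_out = (s r_out)(0 := of_bool (solution S))) s2 \<omega>2"
        using ok S by (intro wp_Store) (simp add: solution_def)
    qed
  qed
qed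

definition search_state :: "bool list \<Rightarrow> nat \<Rightarrow> mem \<Rightarrow> bool" where
  "search_state bs w s \<longleftrightarrow> s r_out 0 = 0 \<and> (\<forall>w'<w. \<not> solution (candidate bs w')) \<or>
     s r_out 0 \<noteq> 0 \<and>
       (\<exists>w<modulus. solution (candidate bs w) \<and> out_edges s = Some (undirected ` candidate bs w))"

lemma supported_on_search_state: "supported_on {r_out} (search_state bs w)"
  by (simp add: supported_on_def search_state_def out_edges_def)

lemmas search_state_upd [simp] = supported_on_upd[OF supported_on_search_state]

lemma search_stateI:
  assumes "w < modulus" "collected (candidate bs w) s" "\<forall>w'<w. \<not> solution (candidate bs w')"
    and out: "s' r_out = (s r_out)(0 := of_bool (solution (candidate bs w)))"
  shows "search_state bs (Suc w) s'"
proof (cases "solution (candidate bs w)")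
  case True
  obtain ps where "set ps = candidate bs w" "lists_pairs (s' r_out) ps"
    using assms(2) unfolding out by (auto simp: collected_def lists_pairs_def)
  then have "out_edges s' = Some (undirected ` candidate bs w)"
    using lists_pairs_imp_out_edges[of s' ps] True out by simp
  then show ?thesis using True out assms(1) by (auto simp: search_state_def)
next
  case False
  then show ?thesis using assms(3) out by (simp add: search_state_def less_Suc_eq)
qed

lemma wp_try_weight:
  assumes r: "ready bs s" and w: "s r_w 0 = w" "w < modulus" and state: "search_state bs w s"
    and B: "n \<le> B" "c \<le> B" "length gadget_list \<le> B" "modulus * (target_charge + 1) \<le> B" "2 * (n * n) \<le> B"
  shows "wp B try_weight (\<lambda>s' \<omega>'. search_state bs (Suc w) s') s \<omega>"
  unfolding try_weight_def
proof (rule wp_Cond)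
  assume "\<not> bval (Equal (var r_out) (Const 0)) s"
  then show "wp B Skip (\<lambda>s' \<omega>'. search_state bs (Suc w) s') s \<omega>"
    using state by (intro wp_Skip) (simp add: search_state_def)
next
  assume "bval (Equal (var r_out) (Const 0)) s"
  then have none: "\<forall>w'<w. \<not> solution (candidate bs w')" using state by (simp add: search_state_def)
  show "wp B (find_candidate ;; verify_candidate) (\<lambda>s' \<omega>'. search_state bs (Suc w) s') s \<omega>"
  proof (rule wp_Seq_frame[OF wp_find_candidate[OF r w B]])
    fix s1 \<omega>1
    assume frame: "frame find_candidate s \<omega> s1 \<omega>1"
      and col: "collected (candidate bs w) s1 \<and> s1 r_out 0 = s r_out 0"
    have "instance_read s1" by (rule frame_instance_read[OF ready_imp_instance_read[OF r] frame]) simp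
    then have "wp B verify_candidate
        (\<lambda>s' \<omega>'. s' r_out = (s1 r_out)(0 := of_bool (solution (candidate bs w)))) s1 \<omega>1"
      using col B candidate_pairs by (intro wp_verify_candidate) simp_all
    then show "wp B verify_candidate (\<lambda>s' \<omega>'. search_state bs (Suc w) s') s1 \<omega>1"
      by (rule wp_mono) (use col none w(2) in \<open>blast intro: search_stateI\<close>)
  qed
qed

definition outcome :: "bool list \<Rightarrow> mem \<Rightarrow> bool" where
  "outcome bs s \<longleftrightarrow> (case out_edges s of None \<Rightarrow> \<forall>w<modulus. \<not> solution (candidate bs w)
     | Some F \<Rightarrow> \<exists>w<modulus. solution (candidate bs w) \<and> F = undirected ` candidate bs w)"

lemma wp_search:
  assumes r: "ready bs s" and out: "s r_out 0 = 0"
    and B: "n \<le> B" "c \<le> B" "length gadget_list \<le> B" "modulus * (target_charge + 1) \<le> B"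
      "2 * (n * n) \<le> B" "modulus \<le> B"
  shows "wp B search (\<lambda>s' \<omega>'. outcome bs s') s \<omega>"
  unfolding search_def
proof (rule wp_For[where n = modulus and I = "\<lambda>w s' \<omega>'. search_state bs w s'"], goal_cases init step exit)
  case (step w s1 \<omega>1)
  have "ready bs s1" by (rule frame_ready[OF r step(2)]) simp
  then have "wp B try_weight (\<lambda>s' \<omega>'. search_state bs (Suc w) s') s1 \<omega>1"
    using step B by (intro wp_try_weight) simp_all
  then show ?case by (rule wp_mono) simp
next
  case (exit s1 \<omega>1)
  then show ?case by (auto simp: search_state_def outcome_def out_edges_def)
qed (use r out B in \<open>auto simp: ready_def search_state_def\<close>)

definition loop_bound :: "nat \<Rightarrow> bool" where
  "loop_bound B \<longleftrightarrow> n \<le> B \<and> 2 * (n * n) \<le> B \<and> c \<le> B \<and> gadget_order + 1 \<le> B \<and>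
     length gadget_list \<le> B \<and> n * length gadget_list \<le> B \<and> nbits \<le> B \<and> modulus \<le> B \<and>
     (\<forall>k. charge k \<le> B) \<and> target_charge \<le> B \<and> modulus * (target_charge + 1) \<le> B"

theorem wp_factor_program:
  assumes input: "holds_input s" and init: "s r_out 0 = 0" "s r_lcharge = (\<lambda>_. 0)" and B: "loop_bound B"
  shows "wp B factor_program (\<lambda>s' \<omega>'. outcome (tape_prefix \<omega>) s') s \<omega>"
proof -
  note bounds = B[unfolded loop_bound_def]
  have "wp B read_instance (\<lambda>s' \<omega>'. instance_read s') s \<omega>"
    using input bounds by (intro wp_read_instance) simp_all
  then show ?thesis
    unfolding factor_program_def
  proof (rule wp_Seq_frame)
    fix s1 \<omega>1
    assume frame1: "frame read_instance s \<omega> s1 \<omega>1" and read1: "instance_read s1"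
    have "wp B build_gadget (\<lambda>s' \<omega>'. edges_at gadget_list s' \<and> s' r_target 0 = target_charge) s1 \<omega>1"
      using frameD[OF frame1] init bounds by (intro wp_build_gadget[OF read1]) simp_all
    then show "wp B (build_gadget ;; weigh_gadget ;; search) (\<lambda>s' \<omega>'. outcome (tape_prefix \<omega>) s') s1 \<omega>1"
    proof (rule wp_Seq_frame)
      fix s2 \<omega>2
      assume frame2: "frame build_gadget s1 \<omega>1 s2 \<omega>2"
        and built: "edges_at gadget_list s2 \<and> s2 r_target 0 = target_charge"
      have "instance_read s2" by (rule frame_instance_read[OF read1 frame2]) simp
      then have "wp B weigh_gadget (\<lambda>s' \<omega>'. ready (tape_prefix \<omega>2) s') s2 \<omega>2"
        using built bounds by (intro wp_weigh_gadget) (simp_all del: split_paired_All)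
      then show "wp B (weigh_gadget ;; search) (\<lambda>s' \<omega>'. outcome (tape_prefix \<omega>) s') s2 \<omega>2"
      proof (rule wp_Seq_frame)
        fix s3 \<omega>3
        assume frame3: "frame weigh_gadget s2 \<omega>2 s3 \<omega>3" and ready3: "ready (tape_prefix \<omega>2) s3"
        have "\<omega>2 = \<omega>" using frame_tape[OF frame1] frame_tape[OF frame2] by simp
        moreover have "s3 r_out 0 = 0"
          using frameD[OF frame1] frameD[OF frame2] frameD[OF frame3] init by simp
        ultimately show "wp B search (\<lambda>s' \<omega>'. outcome (tape_prefix \<omega>) s') s3 \<omega>3"
          using ready3 bounds by (intro wp_search) simp_all
      qed
    qed
  qed
qed

section \<open>Isolated matchings are found\<close>

definition target_matchings :: "nat set set" where
  "target_matchings = {M. M \<subseteq> {..<length gadget_list} \<and> gadget_matching ((!) gadget_list ` M) \<and>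
     (\<Sum>k\<in>M. charge (gadget_list ! k)) = target_charge}"

lemma inj_on_gadget_list: "M \<subseteq> {..<length gadget_list} \<Longrightarrow> inj_on ((!) gadget_list) M"
  by (rule inj_on_nth[OF distinct_gadget_list]) auto

lemma gadget_matching_image_iff:
  assumes "M \<subseteq> {..<length gadget_list}"
  shows "gadget_matching ((!) gadget_list ` M) \<longleftrightarrow> disjoint_family_on (\<lambda>k. gadget_ends (gadget_list ! k)) M"
proof -
  have "(!) gadget_list ` M \<subseteq> gadget_edges" using assms gadget_edge_nth by blast
  then show ?thesis
    unfolding gadget_matching_def using disjoint_family_on_image_iff[OF inj_on_gadget_list[OF assms]]
    by blast
qed

lemma target_matchings_nonempty:
  assumes "solution F"
  shows "target_matchings \<noteq> {}"
proof -
  obtain M where M: "gadget_matching M" "sum charge M = target_charge"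
    using solution_imp_gadget_matching[OF assms] by blast
  define I where "I = {k. k < length gadget_list \<and> gadget_list ! k \<in> M}"
  have I: "I \<subseteq> {..<length gadget_list}" by (auto simp: I_def)
  have "M \<subseteq> set gadget_list" using M(1) set_gadget_list by (simp add: gadget_matching_def)
  then have image: "(!) gadget_list ` I = M" by (force simp: I_def in_set_conv_nth)
  have "(\<Sum>k\<in>I. charge (gadget_list ! k)) = target_charge"
    using M(2) sum.reindex[OF inj_on_gadget_list[OF I], of charge] image by (simp add: comp_def)
  then have "I \<in> target_matchings" using I M(1) image by (simp add: target_matchings_def)
  then show ?thesis by blast
qed

lemma random_weight_sum_less:
  assumes "M \<subseteq> {..<length gadget_list}"
  shows "sum (random_weight bs) M < modulus"
proof -
  have "random_weight bs k \<le> 2 ^ nbits" for k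
  proof -
    have "random_weight bs k < 2 ^ length (block nbits k bs)"
      unfolding random_weight_def by (rule bits_value_less)
    also have "\<dots> \<le> 2 ^ nbits" by (intro power_increasing length_block_le) simp
    finally show ?thesis by simp
  qed
  then have "sum (random_weight bs) M \<le> card M * 2 ^ nbits"
    using sum_bounded_above[of M "random_weight bs" "2 ^ nbits"] by simp
  also have "\<dots> \<le> length gadget_list * 2 ^ nbits" using card_mono[OF _ assms] by (intro mult_le_mono1) simp
  finally show ?thesis by (simp add: modulus_def)
qed

lemma sum_weight_eq_iff:
  assumes "M \<subseteq> {..<length gadget_list}" "w < modulus"
  shows "sum (weight bs) M = modulus * target_charge + w \<longleftrightarrow>
    (\<Sum>k\<in>M. charge (gadget_list ! k)) = target_charge \<and> sum (random_weight bs) M = w"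
proof -
  have split: "sum (weight bs) M = (\<Sum>k\<in>M. charge (gadget_list ! k)) * modulus + sum (random_weight bs) M"
    by (simp add: weight_def sum.distrib sum_distrib_left[symmetric])
  show ?thesis
    unfolding split mult.commute[of modulus]
    by (rule mult_add_eq_iff[OF random_weight_sum_less[OF assms(1)] assms(2)])
qed

lemma even_avoiding_count_iff:
  assumes M: "M \<in> target_matchings" and w: "sum (random_weight bs) M = w"
    and unique: "\<And>M'. M' \<in> target_matchings \<Longrightarrow> sum (random_weight bs) M' = w \<Longrightarrow> M' = M"
  shows "even (avoiding_count bs w p) \<longleftrightarrow> \<not> M \<subseteq> avoiding_edges p"
proof -
  interpret weighted_multigraph "avoiding_edges p" source sink "weight bs"
    by unfold_locales (auto simp: avoiding_edges_def gadget_edge_bounds gadget_edge_nth weight_pos)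
  have w_less: "w < modulus" using random_weight_sum_less M w by (auto simp: target_matchings_def)
  have ends: "ends k = gadget_ends (gadget_list ! k)" for k by (simp add: ends_def gadget_ends_def)
  have below: "ends k \<subseteq> {..<2 * (n * n)}" if "k < length gadget_list" for k
    using gadget_edge_bounds[OF gadget_edge_nth[OF that]] by (simp add: ends_def)
  have iff: "M' \<in> matchings {..<2 * (n * n)} \<and> sum (weight bs) M' = modulus * target_charge + w \<longleftrightarrow>
      M' \<in> target_matchings \<and> M' \<subseteq> avoiding_edges p \<and> sum (random_weight bs) M' = w" for M'
  proof (cases "M' \<subseteq> avoiding_edges p")
    case True
    then have sub: "M' \<subseteq> {..<length gadget_list}" by (auto simp: avoiding_edges_def)
    then have "\<Union> (ends ` M') \<subseteq> {..<2 * (n * n)}" using below by blast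
    then show ?thesis
      using True sub
      by (auto simp: matchings_def target_matchings_def sum_weight_eq_iff[OF sub w_less]
          gadget_matching_image_iff[OF sub] ends[abs_def])
  qed (simp add: matchings_def)
  have "{M' \<in> matchings {..<2 * (n * n)}. sum (weight bs) M' = modulus * target_charge + w} =
      {M' \<in> target_matchings. M' \<subseteq> avoiding_edges p \<and> sum (random_weight bs) M' = w}"
    unfolding iff ..
  also have "\<dots> = {M'. M' = M \<and> M' \<subseteq> avoiding_edges p}" using M w unique by blast
  also have "\<dots> = (if M \<subseteq> avoiding_edges p then {M} else {})" by auto
  finally show ?thesis
    unfolding avoiding_count_def matching_count_parity by simp
qed

lemma port_edge_if_source:
  assumes k: "k \<in> gadget_edges" "fst k = port (fst p) (snd p)" and p: "p \<in> pairs"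
  shows "\<exists>b. k = port_edge p b"
  using k(1)
proof (cases k rule: gadget_edge_cases)
  case (core u i v)
  then show ?thesis
    using k(2) core_neq_port[OF pairs_less(2,3)[OF p]] by (simp add: core_edge_def)
next
  case (port u v b)
  then have "p = (u, v)"
    using k(2) pairs_less(3)[OF p] by (simp add: port_edge_def port_eq_iff prod_eq_iff)
  then show ?thesis using port by blast
qed

lemma chosen_iff_not_avoiding:
  assumes "M \<subseteq> {..<length gadget_list}" "p \<in> pairs"
  shows "p \<in> chosen ((!) gadget_list ` M) \<longleftrightarrow> \<not> M \<subseteq> avoiding_edges p"
proof
  assume "p \<in> chosen ((!) gadget_list ` M)"
  then obtain k b where k: "k \<in> M" "port_edge p b = gadget_list ! k" by (auto simp: chosen_def)
  then have "k \<notin> avoiding_edges p" by (simp add: avoiding_edges_def port_edge_def k(2)[symmetric])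
  then show "\<not> M \<subseteq> avoiding_edges p" using k(1) by blast
next
  assume "\<not> M \<subseteq> avoiding_edges p"
  then obtain k where k: "k \<in> M" "source k = port (fst p) (snd p)"
    using assms(1) by (auto simp: avoiding_edges_def)
  then obtain b where "gadget_list ! k = port_edge p b"
    using port_edge_if_source[of "gadget_list ! k" p] gadget_edge_nth assms by blast
  then have "port_edge p b \<in> (!) gadget_list ` M" using k(1) by (metis imageI)
  then show "p \<in> chosen ((!) gadget_list ` M)" using assms(2) by (auto simp: chosen_def)
qed

theorem isolating_imp_candidate_solution:
  assumes sol: "solution F" and iso: "isolating target_matchings (random_weight bs)"
  shows "\<exists>w<modulus. solution (candidate bs w)"
proof -
  obtain M where M: "M \<in> target_matchings"
    and least: "\<And>M'. M' \<in> target_matchings \<Longrightarrow> M' \<noteq> M \<Longrightarrow> sum (random_weight bs) M < sum (random_weight bs) M'"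
    using iso unfolding isolating_def by blast
  define w where "w = sum (random_weight bs) M"
  have sub: "M \<subseteq> {..<length gadget_list}" and matching: "gadget_matching ((!) gadget_list ` M)"
    using M by (auto simp: target_matchings_def)
  have "M' = M" if "M' \<in> target_matchings" "sum (random_weight bs) M' = w" for M'
    using least[of M'] that by (cases "M' = M") (auto simp: w_def)
  then have parity: "even (avoiding_count bs w p) \<longleftrightarrow> \<not> M \<subseteq> avoiding_edges p" for p
    using even_avoiding_count_iff[OF M w_def[symmetric]] by blast
  have "p \<in> candidate bs w \<longleftrightarrow> p \<in> chosen ((!) gadget_list ` M)" for p
    by (cases "p \<in> pairs")
      (simp add: candidate_def parity chosen_iff_not_avoiding[OF sub], simp add: candidate_def chosen_def)
  then have "candidate bs w = chosen ((!) gadget_list ` M)" by blast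
  moreover have "sum charge ((!) gadget_list ` M) = target_charge"
    using M by (simp add: sum.reindex[OF inj_on_gadget_list[OF sub]] target_matchings_def)
  ultimately have "solution (candidate bs w)" using gadget_matching_imp_solution[OF sol matching] by simp
  moreover have "w < modulus" unfolding w_def by (rule random_weight_sum_less[OF sub])
  ultimately show ?thesis by blast
qed

lemma prob_isolating_target_matchings:
  assumes "solution F" "0 < n"
  shows "measure coin_tape {\<omega>. isolating target_matchings (random_weight (tape_prefix \<omega>))} \<ge> 1 - 1 / real n"
proof -
  have "real (n * length gadget_list) \<le> real (2 ^ nbits)"
    unfolding nbits_def by (rule of_nat_mono[OF le_two_power_ceillog2])
  then have "real (length gadget_list) / 2 ^ nbits \<le> 1 / real n" using assms(2) by (simp add: field_simps)
  moreover have "target_matchings \<subseteq> Pow {..<length gadget_list}" by (auto simp: target_matchings_def)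
  ultimately show ?thesis
    using prob_isolating_blocks[OF target_matchings_nonempty[OF assms(1)], of "length gadget_list" nbits]
    unfolding random_weight_def tape_prefix_def by linarith
qed

end

section \<open>Bounds on the running time\<close>

lemma power_le_powerI: "a \<le> y ^ j \<Longrightarrow> j \<le> k \<Longrightarrow> 1 \<le> y \<Longrightarrow> a \<le> y ^ k" for a y :: nat
  by (erule order_trans) (rule power_increasing)

lemma mult_le_powerI: "a \<le> y ^ j \<Longrightarrow> b \<le> y ^ k \<Longrightarrow> j + k = l \<Longrightarrow> a * b \<le> y ^ l" for a b y :: nat
  using mult_le_mono[of a "y ^ j" b "y ^ k"] by (auto simp: power_add)

lemma add_le_powerI:
  fixes a b y :: nat
  assumes "a \<le> y ^ k" "b \<le> y ^ k" "2 \<le> y" "Suc k = l"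
  shows "a + b \<le> y ^ l"
proof -
  have "a + b \<le> 2 * y ^ k" using assms by simp
  also have "\<dots> \<le> y * y ^ k" using assms by (intro mult_le_mono1)
  finally show ?thesis using assms(4) by auto
qed

context factor_instance
begin

lemma gadget_order_le: "gadget_order \<le> 2 * (n * n)"
proof -
  have "(\<Sum>u<n. n - d u) \<le> (\<Sum>u<n. n)" by (rule sum_mono) simp
  then show ?thesis by (simp add: gadget_order_def)
qed

lemma length_gadget_list_le: "length gadget_list \<le> (n + 2) * (n * n)"
proof -
  have "card core_edges \<le> card ((\<lambda>(u, i, v). core_edge u i v) ` ({..<n} \<times> {..<n} \<times> {..<n}))"
    by (rule card_mono) (force simp: core_edges_def)+
  also have "\<dots> \<le> card ({..<n} \<times> {..<n} \<times> {..<n})" by (rule card_image_le) simp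
  finally have "card core_edges \<le> n * n * n" by simp
  moreover have "card port_edges \<le> card ((\<lambda>(p, b). port_edge p b) ` (({..<n} \<times> {..<n}) \<times> {..<2}))"
    by (rule card_mono) (force simp: port_edges_def pairs_def)+
  then have "card port_edges \<le> card (({..<n} \<times> {..<n}) \<times> {..<2 :: nat})"
    using card_image_le[of "({..<n} \<times> {..<n}) \<times> {..<2 :: nat}" "\<lambda>(p, b). port_edge p b"] by simp
  then have "card port_edges \<le> 2 * (n * n)" by simp
  moreover have "length gadget_list = card (core_edges \<union> port_edges)"
    using distinct_card[OF distinct_gadget_list] set_gadget_list by (simp add: gadget_edges_def)
  moreover have "card (core_edges \<union> port_edges) \<le> card core_edges + card port_edges" by (rule card_Un_le)
  ultimately show ?thesis by (simp add: algebra_simps)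
qed

lemma place_mono: "i \<le> j \<Longrightarrow> place i \<le> place j"
  by (rule lift_Suc_mono_le[of place]) (simp_all add: place_Suc)

context
  fixes y :: nat
  assumes y: "n + c + place c + 2 \<le> y"
begin

lemma one_le_y: "1 \<le> y" and two_le_y: "2 \<le> y"
  using y by simp_all

lemma n_le_power: "n \<le> y ^ 1" and n_plus_2_le_power: "n + 2 \<le> y ^ 1" and c_le_power: "c \<le> y ^ 1"
  and two_le_power: "2 \<le> y ^ 1" and one_le_power: "1 \<le> y ^ k"
  using y by simp_all

lemma n_square_le_power: "n * n \<le> y ^ 2"
  by (rule mult_le_powerI[OF n_le_power n_le_power]) simp

lemma double_n_square_le_power: "2 * (n * n) \<le> y ^ 3"
  by (rule mult_le_powerI[OF two_le_power n_square_le_power]) simp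

lemma gadget_order_le_power: "gadget_order + 1 \<le> y ^ 4"
  by (rule add_le_powerI[OF order_trans[OF gadget_order_le double_n_square_le_power] one_le_power two_le_y]) simp

lemma length_gadget_list_le_power: "length gadget_list \<le> y ^ 3"
proof (rule order_trans[OF length_gadget_list_le])
  show "(n + 2) * (n * n) \<le> y ^ 3" by (rule mult_le_powerI[OF n_plus_2_le_power n_square_le_power]) simp
qed

lemma n_mult_length_gadget_list_le_power: "n * length gadget_list \<le> y ^ 4"
  by (rule mult_le_powerI[OF n_le_power length_gadget_list_le_power]) simp

lemma nbits_le_power: "nbits \<le> y ^ 4"
  unfolding nbits_def by (rule order_trans[OF ceillog2_le_self n_mult_length_gadget_list_le_power])

lemma two_power_nbits_le_power: "2 ^ nbits \<le> y ^ 5"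
proof -
  let ?L = "n * length gadget_list"
  have "2 ^ nbits \<le> 2 * ?L \<or> 2 ^ nbits = (1 :: nat)"
    using two_power_ceillog2_gt[of ?L] by (cases "?L = 0") (auto simp: nbits_def)
  moreover have "2 * ?L \<le> y ^ 5"
    by (rule mult_le_powerI[OF two_le_power n_mult_length_gadget_list_le_power]) simp
  ultimately show ?thesis using one_le_power[of 5] by linarith
qed

lemma modulus_le_power: "modulus \<le> y ^ 9"
  unfolding modulus_def
proof (rule add_le_powerI[OF _ one_le_power two_le_y])
  show "length gadget_list * 2 ^ nbits \<le> y ^ 8"
    by (rule mult_le_powerI[OF length_gadget_list_le_power two_power_nbits_le_power]) simp
qed simp

lemma class_charge_le_power:
  assumes "i < c"
  shows "class_charge i \<le> y ^ 10"
  unfolding class_charge_def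
proof (rule add_le_powerI[of _ _ 9])
  have "(gadget_order + 1) * (gadget_order + 1) \<le> y ^ 8"
    by (rule mult_le_powerI[OF gadget_order_le_power gadget_order_le_power]) simp
  moreover have "place i \<le> y ^ 1" using place_mono[of i c] assms y by simp
  ultimately show "(gadget_order + 1) * (gadget_order + 1) * place i \<le> y ^ 9" by (rule mult_le_powerI) simp
  show "gadget_order + 1 \<le> y ^ 9" by (rule power_le_powerI[OF gadget_order_le_power _ one_le_y]) simp
qed (simp_all add: two_le_y)

lemma charge_le_power: "charge k \<le> y ^ 11"
  unfolding charge_def
proof (rule add_le_powerI[of _ _ 10])
  have "label_charge l \<le> y ^ 10" for l
    using class_charge_le_power
    by (cases "l \<in> tag ` {..<c}") (auto simp: label_charge_tag label_charge_untagged)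
  then show "(if snd (snd k) \<noteq> 0 then label_charge (gadget_label k) else 0) \<le> y ^ 10" by simp
  show "2 \<le> y ^ 10" by (rule power_le_powerI[OF two_le_power _ one_le_y]) simp
qed (simp_all add: two_le_y)

lemma target_charge_le_power: "target_charge \<le> y ^ 16"
  unfolding target_charge_def
proof (rule add_le_powerI[of _ _ 15])
  have cap: "gadget_order \<le> y ^ 4" using gadget_order_le_power by simp
  then show "gadget_order \<le> y ^ 15" by (rule power_le_powerI[OF _ _ one_le_y]) simp
  have "demand_cap i * class_charge i \<le> y ^ 14" if "i < c" for i
    by (rule mult_le_powerI[OF order_trans[OF _ cap] class_charge_le_power[OF that]])
      (simp_all add: demand_cap_def)
  then have "(\<Sum>i<c. demand_cap i * class_charge i) \<le> c * y ^ 14"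
    using sum_bounded_above[of "{..<c}" "\<lambda>i. demand_cap i * class_charge i" "y ^ 14"] by simp
  also have "\<dots> \<le> y ^ 15" by (rule mult_le_powerI[OF c_le_power order_refl]) simp
  finally show "(\<Sum>i<c. demand_cap i * class_charge i) \<le> y ^ 15" .
qed (simp_all add: two_le_y)

lemma loop_bound_power: "loop_bound (y ^ 26)"
proof -
  have "target_charge + 1 \<le> y ^ 17"
    by (rule add_le_powerI[OF target_charge_le_power one_le_power two_le_y]) simp
  then have "modulus * (target_charge + 1) \<le> y ^ 26" by (rule mult_le_powerI[OF modulus_le_power]) simp
  moreover note bounds = n_le_power c_le_power double_n_square_le_power gadget_order_le_power
    length_gadget_list_le_power n_mult_length_gadget_list_le_power nbits_le_power modulus_le_power
    charge_le_power target_charge_le_power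
  ultimately show ?thesis
    unfolding loop_bound_def
    by (intro conjI allI bounds[THEN power_le_powerI[of _ y _ 26, OF _ _ one_le_y]]) simp_all
qed

end

end

section \<open>Encoded instances\<close>

lemma length_concat_map_upt:
  "(\<And>i. i < m \<Longrightarrow> length (f i) = l) \<Longrightarrow> length (concat (map f [0..<m])) = m * l"
  by (induction m) auto

lemma nth_concat_map_upt:
  assumes "\<And>i. i < m \<Longrightarrow> length (f i) = l" "i < m" "j < l"
  shows "concat (map f [0..<m]) ! (i * l + j) = f i ! j"
  using assms
proof (induction m)
  case (Suc m)
  have len: "length (concat (map f [0..<m])) = m * l"
    by (rule length_concat_map_upt) (use Suc.prems(1) in simp)
  show ?case
  proof (cases "i < m")
    case True
    then have "(i + 1) * l \<le> m * l" by (intro mult_le_mono1) simp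
    then have "i * l + j < m * l" using Suc.prems(3) by simp
    then show ?thesis using Suc True len by (simp add: nth_append)
  next
    case False
    then have "i = m" using Suc.prems(2) by simp
    then show ?thesis using len by (simp add: nth_append)
  qed
qed simp

fun problem_degree :: "problem \<Rightarrow> nat \<Rightarrow> nat" where
  "problem_degree (Dominating_Matching G) u = 1"
| "problem_degree (Dominating_F_Factor G d) u = d ! u"

fun problem_kind :: "problem \<Rightarrow> nat" where
  "problem_kind (Dominating_Matching G) = 0"
| "problem_kind (Dominating_F_Factor G d) = 1"

fun degree_list :: "problem \<Rightarrow> nat list" where
  "degree_list (Dominating_Matching G) = []"
| "degree_list (Dominating_F_Factor G d) = d"

definition active :: "dom_graph \<Rightarrow> nat list" where
  "active G = filter (\<lambda>j. demand G j \<noteq> 0) [0..<nsets G]"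

definition active_label :: "dom_graph \<Rightarrow> nat \<Rightarrow> nat" where
  "active_label G i = active G ! i + 2"

definition active_demand :: "dom_graph \<Rightarrow> nat \<Rightarrow> nat" where
  "active_demand G i = demand G (active G ! i)"

lemma distinct_active: "distinct (active G)"
  by (simp add: active_def)

lemma set_active: "set (active G) = {j. j < nsets G \<and> demand G j \<noteq> 0}"
  by (auto simp: active_def)

lemma active_nth: "i < length (active G) \<Longrightarrow> active G ! i < nsets G \<and> demand G (active G ! i) \<noteq> 0"
  using nth_mem[of i "active G"] by (simp add: set_active)

lemma length_active_le: "length (active G) \<le> nsets G"
  unfolding active_def by (rule order_trans[OF length_filter_le]) simp

lemma prod_active_demand: "(\<Prod>i<length (active G). active_demand G i + 1) = demand_product G"
proof -
  have "(\<Prod>i<length (active G). active_demand G i + 1) = (\<Prod>j\<in>set (active G). demand G j + 1)"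
    unfolding active_demand_def by (rule prod.reindex_bij_betw) (simp add: bij_betw_nth distinct_active)
  also have "\<dots> = (\<Prod>j<nsets G. demand G j + 1)"
    by (rule prod.mono_neutral_left) (auto simp: set_active)
  finally show ?thesis by (simp add: demand_product_def)
qed

lemma length_active_le_demand_product: "length (active G) \<le> demand_product G"
proof -
  have "length (active G) \<le> 2 ^ length (active G)" by (rule less_imp_le[OF less_exp])
  also have "\<dots> = (\<Prod>i<length (active G). 2)" by simp
  also have "\<dots> \<le> demand_product G"
    unfolding prod_active_demand[symmetric]
  proof (rule prod_mono)
    fix i assume "i \<in> {..<length (active G)}"
    then show "0 \<le> (2 :: nat) \<and> 2 \<le> active_demand G i + 1"
      using active_nth[of i G] by (simp add: active_demand_def)
  qed
  finally show ?thesis .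
qed

lemma length_encode_matrix: "length (encode_matrix G) = nverts G * nverts G"
  unfolding encode_matrix_def by (rule length_concat_map_upt) simp

lemma nth_encode_matrix:
  "u < nverts G \<Longrightarrow> v < nverts G \<Longrightarrow> encode_matrix G ! (u * nverts G + v) = edge_label G u v"
  unfolding encode_matrix_def by (subst nth_concat_map_upt) simp_all

lemma encode_demands_eq:
  "encode_demands G =
     length (active G) # concat (map (\<lambda>i. [active G ! i, active_demand G i]) [0..<length (active G)])"
proof -
  have "map (\<lambda>j. [j, demand G j]) (active G) =
      map (\<lambda>i. [active G ! i, active_demand G i]) [0..<length (active G)]"
    by (rule nth_equalityI) (simp_all add: active_demand_def)
  then show ?thesis unfolding encode_demands_def active_def[symmetric] Let_def by (rule arg_cong)
qed

lemma length_encode_demands: "length (encode_demands G) = 1 + length (active G) * 2"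
  unfolding encode_demands_eq
  using length_concat_map_upt[of "length (active G)" "\<lambda>i. [active G ! i, active_demand G i]" 2] by simp

lemma nth_encode_demands:
  assumes "i < length (active G)"
  shows "encode_demands G ! (1 + (i + i)) = active G ! i" "encode_demands G ! (2 + (i + i)) = active_demand G i"
proof -
  let ?entry = "\<lambda>i. [active G ! i, active_demand G i]"
  have "concat (map ?entry [0..<length (active G)]) ! (i * 2 + j) = ?entry i ! j" if "j < 2" for j
    using assms that by (intro nth_concat_map_upt) simp_all
  from this[of 0] this[of 1]
  show "encode_demands G ! (1 + (i + i)) = active G ! i" "encode_demands G ! (2 + (i + i)) = active_demand G i"
    unfolding encode_demands_eq by (simp_all add: mult_2_right)
qed

lemma encode_eq:
  "encode P =
     [problem_kind P, nverts (graph P)] @ encode_matrix (graph P) @ degree_list P @ encode_demands (graph P)"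
  by (cases P) simp_all

lemma problem_degree_eq: "problem_degree P u = (if problem_kind P = 0 then 1 else degree_list P ! u)"
  by (cases P) simp_all

locale wf_instance =
  fixes P :: problem
  assumes wf: "wf_problem P"
begin

abbreviation G :: dom_graph where
  "G \<equiv> graph P"

lemma wf_graph: "wf_dom_graph G"
  using wf by (cases P) auto

sublocale factor_instance "nverts G" "edge_label G" "problem_degree P" "length (active G)"
  "active_label G" "active_demand G"
proof
  show "inj_on (active_label G) {..<length (active G)}"
    using distinct_active[of G] by (auto simp: inj_on_def nth_eq_iff_index_eq active_label_def)
  show "1 \<le> active_demand G i" if "i < length (active G)" for i
    using active_nth[OF that] by (simp add: active_demand_def)
qed

lemma prescribed_subset: "j < nsets G \<Longrightarrow> prescribed G j \<subseteq> edges G"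
  using wf_graph by (simp add: wf_dom_graph_def)

lemma edge_cases:
  assumes "e \<in> edges G"
  obtains u v where "e = undirected (u, v)" "v < u" "u < nverts G"
proof -
  have "e \<in> {{u, v} | u v. u < nverts G \<and> v < nverts G \<and> u \<noteq> v}"
    using assms wf_graph unfolding wf_dom_graph_def by blast
  then obtain u v where "e = {u, v}" "u < nverts G" "v < nverts G" "u \<noteq> v" by blast
  then show ?thesis
    using that[of u v] that[of v u] by (cases "v < u") (auto simp: undirected_def insert_commute)
qed

lemma edge_label_eq_0_iff: "edge_label G u v = 0 \<longleftrightarrow> {u, v} \<notin> edges G"
  by (simp add: edge_label_def)

lemma edge_label_prescribed:
  assumes "j < nsets G" "{u, v} \<in> prescribed G j"
  shows "edge_label G u v = j + 2"
proof -
  have "i = j" if "i < nsets G" "{u, v} \<in> prescribed G i" for i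
    using wf_graph assms that unfolding wf_dom_graph_def by blast
  then have "(THE i. i < nsets G \<and> {u, v} \<in> prescribed G i) = j"
    using assms by (intro the_equality conjI) blast+
  moreover have "{u, v} \<in> edges G" using assms prescribed_subset by blast
  moreover have "\<exists>i<nsets G. {u, v} \<in> prescribed G i" using assms by blast
  ultimately show ?thesis by (simp add: edge_label_def)
qed

lemma edge_label_iff:
  assumes "j < nsets G"
  shows "edge_label G u v = j + 2 \<longleftrightarrow> {u, v} \<in> prescribed G j"
proof
  assume label: "edge_label G u v = j + 2"
  then obtain i where "i < nsets G" "{u, v} \<in> prescribed G i"
    by (auto simp: edge_label_def split: if_splits)
  then show "{u, v} \<in> prescribed G j" using edge_label_prescribed[of i u v] label by simp
qed (rule edge_label_prescribed[OF assms])

lemma inj_on_undirected: "S \<subseteq> pairs \<Longrightarrow> inj_on undirected S"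
proof (rule inj_onI)
  fix p p' assume "S \<subseteq> pairs" "p \<in> S" "p' \<in> S" and eq: "undirected p = undirected p'"
  then have "snd p < fst p" "snd p' < fst p'" using pairs_less(1) by blast+
  then show "p = p'" using eq by (auto simp: undirected_def doubleton_eq_iff prod_eq_iff)
qed

lemma undirected_pairs: "undirected ` pairs = edges G"
proof (intro equalityI subsetI)
  fix e assume "e \<in> undirected ` pairs"
  then show "e \<in> edges G" by (auto simp: pairs_def undirected_def edge_label_eq_0_iff)
next
  fix e assume e: "e \<in> edges G"
  then obtain u v where "e = undirected (u, v)" "v < u" "u < nverts G" by (rule edge_cases)
  then have "(u, v) \<in> pairs" using e by (simp add: pairs_def undirected_def edge_label_eq_0_iff)
  then show "e \<in> undirected ` pairs" using \<open>e = undirected (u, v)\<close> by blast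
qed

lemma vdegree_undirected:
  assumes "S \<subseteq> pairs"
  shows "vdegree (undirected ` S) u = card (incident S u)"
proof -
  have "{e \<in> undirected ` S. u \<in> e} = undirected ` incident S u" by (auto simp: incident_def undirected_def)
  moreover have "inj_on undirected (incident S u)"
    by (rule inj_on_subset[OF inj_on_undirected[OF assms]]) (auto simp: incident_def)
  ultimately show ?thesis by (simp add: vdegree_def card_image)
qed

lemma card_undirected_prescribed:
  assumes S: "S \<subseteq> pairs" and j: "j < nsets G"
  shows "card (undirected ` S \<inter> prescribed G j) = card (class_of S (j + 2))"
proof -
  have "undirected ` S \<inter> prescribed G j = undirected ` class_of S (j + 2)"
    unfolding class_of_def edge_label_iff[OF j] by (auto simp: undirected_def)
  moreover have "inj_on undirected (class_of S (j + 2))"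
    by (rule inj_on_subset[OF inj_on_undirected[OF S]]) (auto simp: class_of_def)
  ultimately show ?thesis by (simp add: card_image)
qed

lemma dominating_undirected:
  assumes S: "S \<subseteq> pairs"
  shows "dominating G (undirected ` S) \<longleftrightarrow>
    (\<forall>i<length (active G). active_demand G i \<le> card (class_of S (active_label G i)))"
  unfolding active_demand_def active_label_def
proof
  assume "dominating G (undirected ` S)"
  then show "\<forall>i<length (active G). demand G (active G ! i) \<le> card (class_of S (active G ! i + 2))"
    using card_undirected_prescribed[OF S] active_nth by (auto simp: dominating_def)
next
  assume met: "\<forall>i<length (active G). demand G (active G ! i) \<le> card (class_of S (active G ! i + 2))"
  have "demand G j \<le> card (undirected ` S \<inter> prescribed G j)" if j: "j < nsets G" for j
  proof (cases "demand G j = 0")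
    case False
    then obtain i where "i < length (active G)" "active G ! i = j"
      using j set_active[of G] by (metis (mono_tags, lifting) in_set_conv_nth mem_Collect_eq)
    then show ?thesis using met card_undirected_prescribed[OF S j] by auto
  qed simp
  then show "dominating G (undirected ` S)" by (simp add: dominating_def)
qed

lemma perfect_matching_imp_vdegree:
  assumes "perfect_matching G F" "u < nverts G"
  shows "vdegree F u = 1"
proof -
  have "u \<in> \<Union>F" using assms by (simp add: perfect_matching_def)
  then obtain e where "e \<in> F" "u \<in> e" by blast
  then have "{e \<in> F. u \<in> e} = {e}" using assms(1) unfolding perfect_matching_def by blast
  then show ?thesis by (simp add: vdegree_def)
qed

lemma vdegree_imp_perfect_matching:
  assumes F: "F \<subseteq> edges G" and degree: "\<And>u. u < nverts G \<Longrightarrow> vdegree F u = 1"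
  shows "perfect_matching G F"
proof -
  have vertex: "u < nverts G" if e: "e \<in> F" "u \<in> e" for e u
  proof -
    obtain a b where "e = undirected (a, b)" "b < a" "a < nverts G" using edge_cases[of e] e(1) F by blast
    then show ?thesis using e(2) by (auto simp: undirected_def)
  qed
  have one: "\<exists>e. {e \<in> F. u \<in> e} = {e}" if "u < nverts G" for u
    using degree[OF that] card_1_singletonE[of "{e \<in> F. u \<in> e}"] by (metis vdegree_def)
  have "e = e'" if "e \<in> F" "e' \<in> F" "u \<in> e" "u \<in> e'" for e e' u
    using one[OF vertex[OF that(1,3)]] that by blast
  moreover have "\<Union>F = {..<nverts G}"
  proof (intro equalityI subsetI)
    fix u assume "u \<in> {..<nverts G}"
    then show "u \<in> \<Union>F" using one[of u] by blast
  qed (use vertex in blast)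
  ultimately show ?thesis using F unfolding perfect_matching_def by blast
qed

lemma solves_iff_vdegree:
  assumes F: "F \<subseteq> edges G"
  shows "solves F P \<longleftrightarrow> (\<forall>u<nverts G. vdegree F u = problem_degree P u) \<and> dominating G F"
proof (cases P)
  case (Dominating_Matching H)
  then show ?thesis using perfect_matching_imp_vdegree[of F] vdegree_imp_perfect_matching[OF F] by auto
next
  case (Dominating_F_Factor H d)
  then show ?thesis using F by (simp add: f_factor_def)
qed

lemma solves_undirected_iff:
  assumes S: "S \<subseteq> pairs"
  shows "solves (undirected ` S) P \<longleftrightarrow> solution S"
proof -
  have "undirected ` S \<subseteq> edges G" using S undirected_pairs by blast
  then show ?thesis
    using S by (simp add: solves_iff_vdegree vdegree_undirected[OF S] dominating_undirected[OF S] solution_def)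
qed

lemma solves_imp_solution:
  assumes "solves F P"
  shows "\<exists>S. solution S"
proof -
  have "F \<subseteq> edges G" using assms by (cases P) (auto simp: perfect_matching_def f_factor_def)
  then obtain S where "S \<subseteq> pairs" "F = undirected ` S"
    unfolding undirected_pairs[symmetric] by (auto simp: subset_image_iff)
  then show ?thesis using assms solves_undirected_iff by blast
qed

lemma length_degree_list: "length (degree_list P) = (if problem_kind P = 0 then 0 else nverts G)"
  using wf by (cases P) auto

lemma init_mem_encode:
  defines "s \<equiv> init_mem (encode P)"
  shows "s r_in 0 = problem_kind P" "s r_in 1 = nverts G"
    and "u < nverts G \<Longrightarrow> v < nverts G \<Longrightarrow> s r_in (2 + (u * nverts G + v)) = edge_label G u v"
    and "u < length (degree_list P) \<Longrightarrow> s r_in (2 + nverts G * nverts G + u) = degree_list P ! u"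
    and "i < length (encode_demands G) \<Longrightarrow>
      s r_in (2 + nverts G * nverts G + length (degree_list P) + i) = encode_demands G ! i"
proof -
  show "s r_in 0 = problem_kind P" "s r_in 1 = nverts G" by (simp_all add: s_def init_mem_def encode_eq)
  show "s r_in (2 + (u * nverts G + v)) = edge_label G u v" if uv: "u < nverts G" "v < nverts G"
  proof -
    have "(u + 1) * nverts G \<le> nverts G * nverts G" using uv by (intro mult_le_mono1) simp
    then have "u * nverts G + v < nverts G * nverts G" using uv by simp
    then show ?thesis
      using nth_encode_matrix[OF uv]
      by (simp add: s_def init_mem_def encode_eq nth_append length_encode_matrix)
  qed
qed (simp_all add: s_def init_mem_def encode_eq nth_append length_encode_matrix)

lemma holds_input_encode: "holds_input (init_mem (encode P))"
proof -
  let ?s = "init_mem (encode P)" and ?n = "nverts G"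
  have pos: "demand_pos ?s = 2 + ?n * ?n + length (degree_list P)"
    by (simp add: demand_pos_def init_mem_encode length_degree_list)
  have demands: "?s r_in (demand_pos ?s + i) = encode_demands G ! i"
    if "i < 1 + length (active G) * 2" for i
    unfolding pos using that by (intro init_mem_encode) (simp add: length_encode_demands)
  show ?thesis
    unfolding holds_input_def
  proof (intro conjI allI impI)
    show "?s r_in (demand_pos ?s) = length (active G)" using demands[of 0] by (simp add: encode_demands_eq)
    fix i assume i: "i < length (active G)"
    show "?s r_in (demand_pos ?s + 1 + (i + i)) + 2 = active_label G i"
      using demands[of "1 + (i + i)"] nth_encode_demands(1)[OF i] i
      by (simp add: active_label_def add.assoc)
    show "?s r_in (demand_pos ?s + 2 + (i + i)) = active_demand G i"
      using demands[of "2 + (i + i)"] nth_encode_demands(2)[OF i] i by (simp add: add.assoc)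
  next
    fix u assume "u < ?n"
    then show "problem_degree P u = (if ?s r_in 0 = 0 then 1 else ?s r_in (2 + ?n * ?n + u))"
      using init_mem_encode(4)[of u] by (simp add: init_mem_encode(1) problem_degree_eq length_degree_list)
  qed (rule init_mem_encode; assumption)+
qed

definition instance_size :: nat where
  "instance_size = nverts G + length (active G) + place (length (active G)) + 2"

lemma exec_factor_program:
  "\<exists>t s \<omega>'. exec factor_program (init_mem (encode P)) \<omega> t s \<omega>' \<and>
     t \<le> time_bound (instance_size ^ 26) factor_program \<and> outcome (tape_prefix \<omega>) s"
proof -
  have "init_mem (encode P) r_out 0 = 0" "init_mem (encode P) r_lcharge = (\<lambda>_. 0)"
    by (simp_all add: init_mem_def)
  from wp_factor_program[OF holds_input_encode this loop_bound_power]
  show ?thesis unfolding wp_def by (simp add: instance_size_def)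
qed

lemma halts_within_instance_size:
  assumes "real instance_size \<le> poly r (real (nverts G))"
  shows "halts_within factor_program P
    (poly (smult (real (cost factor_program)) ((1 + r ^ 26) ^ depth factor_program)) (real (nverts G)))"
  unfolding halts_within_def
proof
  fix \<omega>
  obtain t s \<omega>' where exec: "exec factor_program (init_mem (encode P)) \<omega> t s \<omega>'"
    and t: "t \<le> time_bound (instance_size ^ 26) factor_program"
    using exec_factor_program by blast
  have "real (Suc (instance_size ^ 26)) \<le> 1 + poly r (real (nverts G)) ^ 26"
    using power_mono[OF assms, of 26] by simp
  then have "real (Suc (instance_size ^ 26)) ^ depth factor_program \<le>
      (1 + poly r (real (nverts G)) ^ 26) ^ depth factor_program"
    by (rule power_mono) simp
  then have "real (time_bound (instance_size ^ 26) factor_program) \<le>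
      poly (smult (real (cost factor_program)) ((1 + r ^ 26) ^ depth factor_program)) (real (nverts G))"
    by (simp add: time_bound_def mult_left_mono del: of_nat_Suc)
  then have "real t
      \<le> poly (smult (real (cost factor_program)) ((1 + r ^ 26) ^ depth factor_program)) (real (nverts G))"
    using t by (meson of_nat_le_iff order_trans)
  with exec show "\<exists>t s \<omega>'. exec factor_program (init_mem (encode P)) \<omega> t s \<omega>' \<and>
      real t \<le> poly (smult (real (cost factor_program)) ((1 + r ^ 26) ^ depth factor_program)) (real (nverts G))"
    by blast
qed

lemma place_le_demand_product: "place (length (active G)) \<le> demand_product G"
  unfolding prod_active_demand[symmetric] place_def by (rule prod_mono) (simp add: demand_cap_def)

lemma place_le_power: "place i \<le> (2 * (nverts G * nverts G) + 1) ^ i"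
proof -
  have "place i \<le> (\<Prod>i'<i. 2 * (nverts G * nverts G) + 1)"
    unfolding place_def using gadget_order_le
    by (intro prod_mono) (simp add: demand_cap_def min.coboundedI2)
  then show ?thesis by simp
qed

lemma instance_size_le_demand_product: "instance_size \<le> nverts G + 2 * demand_product G + 2"
  using length_active_le_demand_product[of G] place_le_demand_product by (simp add: instance_size_def)

lemma instance_size_le_nsets:
  assumes "nsets G \<le> K"
  shows "instance_size \<le> nverts G + K + (2 * (nverts G * nverts G) + 1) ^ K + 2"
proof -
  have active: "length (active G) \<le> K" using length_active_le[of G] assms by simp
  have "place (length (active G)) \<le> (2 * (nverts G * nverts G) + 1) ^ K"
    by (rule order_trans[OF place_le_power power_increasing[OF active]]) simp
  then show ?thesis using active by (simp add: instance_size_def)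
qed

lemma returns_iff_out_edges:
  "\<exists>s. outcome (tape_prefix \<omega>) s \<and> (\<forall>F. returns factor_program P \<omega> F \<longleftrightarrow> out_edges s = Some F)"
proof -
  obtain t s \<omega>' where exec: "exec factor_program (init_mem (encode P)) \<omega> t s \<omega>'" "outcome (tape_prefix \<omega>) s"
    using exec_factor_program by blast
  then have "returns factor_program P \<omega> F \<longleftrightarrow> out_edges s = Some F" for F
    unfolding returns_def using exec_deterministic[OF exec(1)] by blast
  then show ?thesis using exec(2) by blast
qed

lemma returns_imp_solves:
  assumes "returns factor_program P \<omega> F"
  shows "solves F P"
proof -
  obtain s where "outcome (tape_prefix \<omega>) s" "out_edges s = Some F"
    using returns_iff_out_edges assms by blast
  then show ?thesis using solves_undirected_iff[OF candidate_pairs] by (auto simp: outcome_def)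
qed

lemma returns_solution_iff:
  "(\<exists>F. returns factor_program P \<omega> F \<and> solves F P) \<longleftrightarrow> (\<exists>w<modulus. solution (candidate (tape_prefix \<omega>) w))"
proof -
  obtain s where s: "outcome (tape_prefix \<omega>) s" "\<forall>F. returns factor_program P \<omega> F \<longleftrightarrow> out_edges s = Some F"
    using returns_iff_out_edges by blast
  have "(\<exists>F. returns factor_program P \<omega> F \<and> solves F P) \<longleftrightarrow> out_edges s \<noteq> None"
    using returns_imp_solves s(2) by auto
  also have "\<dots> \<longleftrightarrow> (\<exists>w<modulus. solution (candidate (tape_prefix \<omega>) w))"
    using s(1) by (cases "out_edges s") (auto simp: outcome_def)
  finally show ?thesis .
qed

lemma prob_returns_solution:
  assumes "solves F P" "0 < nverts G"
  shows "measure coin_tape {\<omega>. \<exists>F. returns factor_program P \<omega> F \<and> solves F P} \<ge> 1 - 1 / real (nverts G)"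
proof -
  obtain S where S: "solution S" using solves_imp_solution[OF assms(1)] by blast
  have "1 - 1 / real (nverts G)
      \<le> measure coin_tape {\<omega>. isolating target_matchings (random_weight (tape_prefix \<omega>))}"
    by (rule prob_isolating_target_matchings[OF S assms(2)])
  also have "\<dots> \<le> measure coin_tape {\<omega>. \<exists>w<modulus. solution (candidate (tape_prefix \<omega>) w)}"
  proof (rule finite_measure.finite_measure_mono[OF prob_space.finite_measure[OF prob_space_coin_tape]])
    show "{\<omega>. isolating target_matchings (random_weight (tape_prefix \<omega>))} \<subseteq>
        {\<omega>. \<exists>w<modulus. solution (candidate (tape_prefix \<omega>) w)}"
      using isolating_imp_candidate_solution[OF S] by blast
    show "{\<omega>. \<exists>w<modulus. solution (candidate (tape_prefix \<omega>) w)} \<in> sets coin_tape"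
      using sets_coin_tape_stake[of "length gadget_list * nbits" "{bs. \<exists>w<modulus. solution (candidate bs w)}"]
      by (simp add: tape_prefix_def)
  qed
  finally show ?thesis unfolding returns_solution_iff .
qed

end

section \<open>The algorithm\<close>

lemma demand_product_le_power:
  assumes wf: "wf_dom_graph G" and K: "nsets G \<le> K"
    and feasible: "\<And>j. j < nsets G \<Longrightarrow> demand G j \<le> card (prescribed G j)"
  shows "demand_product G \<le> (nverts G * nverts G + 1) ^ K"
proof -
  let ?V = "{..<nverts G}"
  have edges: "edges G \<subseteq> undirected ` (?V \<times> ?V)"
  proof
    fix e assume "e \<in> edges G"
    then obtain u v where "e = {u, v}" "u < nverts G" "v < nverts G"
      using wf unfolding wf_dom_graph_def by blast
    then have "e = undirected (u, v)" "(u, v) \<in> ?V \<times> ?V" by (simp_all add: undirected_def)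
    then show "e \<in> undirected ` (?V \<times> ?V)" by blast
  qed
  have "demand G j \<le> nverts G * nverts G" if "j < nsets G" for j
  proof -
    have "prescribed G j \<subseteq> undirected ` (?V \<times> ?V)" using wf that edges unfolding wf_dom_graph_def by blast
    then have "card (prescribed G j) \<le> card (undirected ` (?V \<times> ?V))" by (intro card_mono) simp_all
    also have "\<dots> \<le> card (?V \<times> ?V)" by (rule card_image_le) simp
    finally show ?thesis using feasible[OF that] by simp
  qed
  then have "demand_product G \<le> (\<Prod>j<nsets G. nverts G * nverts G + 1)"
    unfolding demand_product_def by (intro prod_mono) simp
  also have "\<dots> = (nverts G * nverts G + 1) ^ nsets G" by simp
  also have "\<dots> \<le> (nverts G * nverts G + 1) ^ K" by (rule power_increasing[OF K]) simp
  finally show ?thesis .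
qed

lemma demand_product_le_poly:
  "\<exists>p :: real poly. \<forall>G. wf_dom_graph G \<and> nsets G \<le> K \<and> (\<forall>j<nsets G. demand G j \<le> card (prescribed G j)) \<longrightarrow>
     real (demand_product G) \<le> poly p (real (nverts G))"
proof (intro exI[of _ "[:1, 0, 1:] ^ K"] allI impI)
  fix G assume "wf_dom_graph G \<and> nsets G \<le> K \<and> (\<forall>j<nsets G. demand G j \<le> card (prescribed G j))"
  then have "demand_product G \<le> (nverts G * nverts G + 1) ^ K" by (intro demand_product_le_power) auto
  then have "real (demand_product G) \<le> real ((nverts G * nverts G + 1) ^ K)" by (rule of_nat_mono)
  then show "real (demand_product G) \<le> poly ([:1, 0, 1:] ^ K) (real (nverts G))" by (simp add: add.commute)
qed

lemma factor_program_poly_time_demand_product: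
  "\<exists>q :: real poly. \<forall>P. wf_problem P \<and>
      real (demand_product (graph P)) \<le> C * poly p (real (nverts (graph P))) \<longrightarrow>
     halts_within factor_program P (poly q (real (nverts (graph P))))"
proof (intro exI allI impI)
  fix P assume P: "wf_problem P \<and> real (demand_product (graph P)) \<le> C * poly p (real (nverts (graph P)))"
  interpret wf_instance P using P by unfold_locales blast
  have "real instance_size \<le> poly ([:2, 1:] + smult (2 * C) p) (real (nverts (graph P)))"
    using of_nat_mono[OF instance_size_le_demand_product, where 'a = real] P by simp
  then show "halts_within factor_program P (poly (smult (real (cost factor_program))
      ((1 + ([:2, 1:] + smult (2 * C) p) ^ 26) ^ depth factor_program)) (real (nverts (graph P))))"
    by (rule halts_within_instance_size)
qed

lemma factor_program_poly_time_nsets: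
  "\<exists>q :: real poly. \<forall>P. wf_problem P \<and> nsets (graph P) \<le> K \<longrightarrow>
     halts_within factor_program P (poly q (real (nverts (graph P))))"
proof (intro exI allI impI)
  fix P assume P: "wf_problem P \<and> nsets (graph P) \<le> K"
  interpret wf_instance P using P by unfold_locales blast
  have "real instance_size \<le> poly ([:real K + 2, 1:] + [:1, 0, 2:] ^ K) (real (nverts (graph P)))"
    using of_nat_mono[OF instance_size_le_nsets[OF conjunct2[OF P]], where 'a = real]
    by (simp add: algebra_simps)
  then show "halts_within factor_program P (poly (smult (real (cost factor_program))
      ((1 + ([:real K + 2, 1:] + [:1, 0, 2:] ^ K) ^ 26) ^ depth factor_program)) (real (nverts (graph P))))"
    by (rule halts_within_instance_size)
qed

lemma factor_program_finds_solution:
  assumes "wf_problem P" "\<exists>F. solves F P"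
  shows "measure coin_tape {\<omega>. \<exists>F. returns factor_program P \<omega> F \<and> solves F P}
    \<ge> 1 - 2 * inverse (real (Suc (nverts (graph P))))"
proof (cases "nverts (graph P) = 0")
  case True
  then have "1 - 2 * inverse (real (Suc (nverts (graph P)))) \<le> 0" by simp
  then show ?thesis using measure_nonneg order_trans by blast
next
  case False
  interpret wf_instance P using assms(1) by unfold_locales
  have "1 / real (nverts (graph P)) \<le> 2 * inverse (real (Suc (nverts (graph P))))"
    using False by (simp add: field_simps)
  then show ?thesis using prob_returns_solution assms(2) False by force
qed

theorem theorem2:
  "(\<exists>A :: com.
      (\<forall>(p :: real poly) (C :: real). \<exists>q :: real poly. \<forall>P.
         wf_problem P \<and> real (demand_product (graph P)) \<le> C * poly p (real (nverts (graph P))) \<longrightarrow>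
         halts_within A P (poly q (real (nverts (graph P))))) \<and>
      (\<forall>K :: nat. \<exists>q :: real poly. \<forall>P.
         wf_problem P \<and> nsets (graph P) \<le> K \<longrightarrow>
         halts_within A P (poly q (real (nverts (graph P))))) \<and>
      (\<forall>P \<omega> F. wf_problem P \<and> returns A P \<omega> F \<longrightarrow> solves F P) \<and>
      (\<exists>\<epsilon> :: nat \<Rightarrow> real. \<epsilon> \<longlonglongrightarrow> 0 \<and>
         (\<forall>P. wf_problem P \<and> (\<exists>F. solves F P) \<longrightarrow>
            measure coin_tape {\<omega>. \<exists>F. returns A P \<omega> F \<and> solves F P}
              \<ge> 1 - \<epsilon> (nverts (graph P))))) \<and>
   (\<forall>K :: nat. \<exists>p :: real poly. \<forall>G.
      wf_dom_graph G \<and> nsets G \<le> K \<and> (\<forall>j<nsets G. demand G j \<le> card (prescribed G j)) \<longrightarrow>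
      real (demand_product G) \<le> poly p (real (nverts G)))"
proof (intro conjI exI[of _ factor_program] exI[of _ "\<lambda>n. 2 * inverse (real (Suc n))"] allI
    factor_program_poly_time_demand_product factor_program_poly_time_nsets demand_product_le_poly)
  show "wf_problem P \<and> returns factor_program P \<omega> F \<longrightarrow> solves F P" for P \<omega> F
    using wf_instance.returns_imp_solves by (auto simp: wf_instance_def)
  show "(\<lambda>n. 2 * inverse (real (Suc n))) \<longlonglongrightarrow> 0"
    by (rule tendsto_mult_right_zero[OF LIMSEQ_inverse_real_of_nat])
  show "wf_problem P \<and> (\<exists>F. solves F P) \<longrightarrow>
      measure coin_tape {\<omega>. \<exists>F. returns factor_program P \<omega> F \<and> solves F P}
        \<ge> 1 - 2 * inverse (real (Suc (nverts (graph P))))" for P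
    using factor_program_finds_solution by blast
qed

end
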